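(* Let $N$ be a positive integer, let $p$ be a prime number or $p=\infty$, and let $\phi_p:\mathbb{Q}_p^N\to\mathbb{Q}_p^N$ be an endomorphism. Then $$h_A(\phi_p)=\sum_{|\lambda_i^{(p)}|_p>1}\log|\lambda_i^{(p)}|_p,$$ where $\{\lambda_i^{(p)}:i=1,\ldots,N\}$ are the eigenvalues of $\phi_p$ (counted with multiplicity), contained in some finite extension $K_p$ of $\mathbb{Q}_p$.
   Context: For a prime $p$, $\mathbb{Q}_p$ is the field of $p$-adic numbers with $p$-adic norm $|-|_p$ (normalized by $|p|_p=1/p$); $\mathbb{Q}_\infty=\mathbb{R}$ and $|-|_\infty$ is the usual absolute value. On a finite extension $K_p$ of $\mathbb{Q}_p$, $|-|_p$ denotes the unique extension of the norm of $\mathbb{Q}_p$. Endomorphisms of topological groups are continuous group endomorphisms; those of $\mathbb{Q}_p^N$ are automatically $\mathbb{Q}_p$-linear, and the eigenvalues of $\phi_p$ are those of its matrix with respect to the canonical base. Algebraic entropy: let $G$ be a locally compact Abelian group with Haar measure $\mu$, $\phi:G\to G$ a continuous endomorphism, and let $\mathcal{C}(G)$ be the family of compact neighborhoods of $0$ in $G$. For $C\in\mathcal{C}(G)$ and $n\geq 1$ put $T_n(\phi,C)=C+\phi C+\ldots+\phi^{n-1}C$, $H_A(\phi,C)=\limsup_{n\to\infty}\frac{\log\mu(T_n(\phi,C))}{n}$ (independent of the choice of $\mu$), and $h_A(\phi)=\sup\{H_A(\phi,C):C\in\mathcal{C}(G)\}$. *)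

theory Defs
  imports
    "HOL-Analysis.Analysis"
    "HOL-Algebra.Algebraic_Closure_Type"
    "HOL-Computational_Algebra.Computational_Algebra"
    "HOL-Library.Extended_Nat"
begin

unbundle no fps_syntax

section \<open>Absolute values and the fields \<open>\<rat>\<^sub>p\<close>\<close>

text \<open>The index \<open>\<infinity> :: enat\<close> stands for the archimedean place.\<close>

definition rat_abs :: "enat \<Rightarrow> rat \<Rightarrow> real" where
  "rat_abs p x = (case p of
      enat q \<Rightarrow> (if x = 0 then 0
        else real q powi (int (multiplicity (int q) (snd (quotient_of x)))
                        - int (multiplicity (int q) (fst (quotient_of x)))))
    | \<infinity> \<Rightarrow> real_of_rat \<bar>x\<bar>)"

definition abs_value_on :: "'a::field set \<Rightarrow> ('a \<Rightarrow> real) \<Rightarrow> bool" where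
  "abs_value_on K v \<longleftrightarrow>
     (\<forall>x\<in>K. 0 \<le> v x) \<and> (\<forall>x\<in>K. v x = 0 \<longleftrightarrow> x = 0) \<and>
     (\<forall>x\<in>K. \<forall>y\<in>K. v (x * y) = v x * v y) \<and>
     (\<forall>x\<in>K. \<forall>y\<in>K. v (x + y) \<le> v x + v y)"

text \<open>On a type carrying the metric \<open>dist x y = \<bar>x - y\<bar>\<^sub>p\<close>, the absolute value is the
  distance from \<open>0\<close>.\<close>

definition Qp_abs :: "'k::{field_char_0,metric_space} \<Rightarrow> real" where
  "Qp_abs x = dist x 0"

text \<open>The field \<open>\<rat>\<^sub>p\<close> is the completion of \<open>\<rat>\<close> with respect to \<open>\<bar>_\<bar>\<^sub>p\<close>, which is determined up
  to a unique isometric isomorphism. Since \<open>p\<close> is a term and not a type, the definition says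
  that the type \<open>'k\<close> is such a completion. For \<open>p = \<infinity>\<close> it is the field of real numbers.\<close>

definition is_Qp :: "enat \<Rightarrow> 'k::{field_char_0,metric_space} itself \<Rightarrow> bool" where
  "is_Qp p T \<longleftrightarrow>
     abs_value_on (UNIV :: 'k set) Qp_abs \<and>
     (\<forall>x y :: 'k. dist x y = Qp_abs (x - y)) \<and>
     complete (UNIV :: 'k set) \<and>
     closure (range of_rat) = (UNIV :: 'k set) \<and>
     (\<forall>x. Qp_abs (of_rat x :: 'k) = rat_abs p x)"

lemma is_Qp_real: "is_Qp \<infinity> TYPE(real)"
proof -
  have "real_of_rat \<bar>x\<bar> = \<bar>real_of_rat x\<bar>" for x
    by (simp add: abs_if of_rat_minus)
  moreover have "closure (range real_of_rat) = UNIV"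
    using Rats_closure_real by (simp add: Rats_def)
  ultimately show ?thesis
    by (simp add: is_Qp_def abs_value_on_def Qp_abs_def rat_abs_def
        dist_real_def abs_mult complete_UNIV abs_triangle_ineq)
qed

text \<open>Finite extensions of \<open>'k\<close> are taken inside its algebraic closure: subfields that contain
  \<open>'k\<close> and are spanned over \<open>'k\<close> by a finite set.\<close>

definition finite_extension :: "'k::field alg_closure set \<Rightarrow> bool" where
  "finite_extension K \<longleftrightarrow>
     range to_ac \<subseteq> K \<and>
     (\<forall>x\<in>K. \<forall>y\<in>K. x + y \<in> K \<and> x * y \<in> K) \<and>
     (\<forall>x\<in>K. - x \<in> K \<and> inverse x \<in> K) \<and>
     (\<exists>B. finite B \<and> K = {(\<Sum>b\<in>B. to_ac (c b) * b) |c. True})"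

definition extends_Qp_abs ::
    "'k::{field_char_0,metric_space} alg_closure set \<Rightarrow> ('k alg_closure \<Rightarrow> real) \<Rightarrow> bool" where
  "extends_Qp_abs K v \<longleftrightarrow> abs_value_on K v \<and> (\<forall>x. v (to_ac x) = Qp_abs x)"

section \<open>Eigenvalues\<close>

definition charpoly :: "'a::comm_ring_1^'n^'n \<Rightarrow> 'a poly" where
  "charpoly A = det (\<chi> i j. (if i = j then [:0, 1:] else 0) - [:A $ i $ j:])"

definition eigenvalues :: "('k::field^'n \<Rightarrow> 'k^'n) \<Rightarrow> 'k alg_closure multiset" where
  "eigenvalues f = proots (map_poly to_ac (charpoly (matrix f)))"

section \<open>Haar measures and algebraic entropy\<close>

text \<open>The type \<open>'a\<close> plays the role of a locally compact abelian group. Continuity of the group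
  operations and local compactness are properties of the particular type and are not needed to
  state the definitions.\<close>

definition haar_measure :: "'a::{ab_group_add,t2_space} measure \<Rightarrow> bool" where
  "haar_measure M \<longleftrightarrow>
     sets M = sets borel \<and>
     (\<forall>x. \<forall>A\<in>sets borel. emeasure M ((+) x ` A) = emeasure M A) \<and>
     (\<forall>C. compact C \<longrightarrow> emeasure M C < \<infinity>) \<and>
     (\<forall>U. open U \<and> U \<noteq> {} \<longrightarrow> 0 < emeasure M U) \<and>
     (\<forall>A\<in>sets borel. emeasure M A = (INF U\<in>{U. open U \<and> A \<subseteq> U}. emeasure M U)) \<and>
     (\<forall>U. open U \<longrightarrow> emeasure M U = (SUP C\<in>{C. compact C \<and> C \<subseteq> U}. emeasure M C))"

definition compact_nhds :: "'a::{ab_group_add,t2_space} set set" where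
  "compact_nhds = {C. compact C \<and> 0 \<in> interior C}"

text \<open>The sum is a Minkowski sum of sets (\<^theory>\<open>HOL-Library.Set_Algebras\<close>).\<close>

definition trajectory :: "nat \<Rightarrow> ('a::ab_group_add \<Rightarrow> 'a) \<Rightarrow> 'a set \<Rightarrow> 'a set" where
  "trajectory n f C = (\<Sum>i<n. (f ^^ i) ` C)"

definition entropy_wrt ::
    "'a::{ab_group_add,t2_space} measure \<Rightarrow> ('a \<Rightarrow> 'a) \<Rightarrow> 'a set \<Rightarrow> ereal" where
  "entropy_wrt M f C = limsup (\<lambda>n. ereal (ln (measure M (trajectory n f C)) / real n))"

definition algebraic_entropy ::
    "'a::{ab_group_add,t2_space} measure \<Rightarrow> ('a \<Rightarrow> 'a) \<Rightarrow> ereal" where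
  "algebraic_entropy M f = (SUP C\<in>compact_nhds. entropy_wrt M f C)"

end

theory Submission
  imports Defs "HOL-Real_Asymp.Real_Asymp"
begin

text \<open>
  Write \<open>k\<close> for the field \<open>\<rat>\<^sub>p\<close>, \<open>N\<close> for the dimension, \<open>A\<close> for the matrix of \<open>\<phi>\<close> and \<open>R\<close> for the product
  of \<open>max 1 (v \<lambda>)\<close> over the eigenvalues \<open>\<lambda>\<close>. The claim is that the measure of the \<open>n\<close>-th trajectory
  grows like \<open>R ^ n\<close>, up to factors that are polynomial in \<open>n\<close>. The link between the two sides is the
  largest absolute value \<open>D\<^sub>n\<close> of a determinant of \<open>N\<close> vectors chosen among the \<open>A\<^sup>i e\<^sub>j\<close> with \<open>i < n\<close>.

  On the analytic side, a compact neighbourhood \<open>C\<close> of \<open>0\<close> lies between two cubes. A matrix \<open>G\<close> with \<open>N\<close> of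
  the vectors \<open>A\<^sup>i e\<^sub>j\<close> as columns maps a small fixed cube into \<open>T\<^sub>n(\<phi>, C)\<close>. If the determinant of \<open>G\<close> is
  largest possible, Cramer's rule writes every other \<open>A\<^sup>i e\<^sub>j\<close> as a combination of the columns of \<open>G\<close> with
  coefficients of absolute value at most \<open>1\<close>, so \<open>T\<^sub>n(\<phi>, C)\<close> lies in the image under \<open>G\<close> of a cube of size
  \<open>O(n)\<close>. Since Haar measure scales by the absolute value of the determinant, the measure of \<open>T\<^sub>n(\<phi>, C)\<close>
  agrees with \<open>D\<^sub>n\<close> up to a polynomial factor (\<open>measure_trajectory_lower\<close>, \<open>measure_trajectory_upper\<close>). In
  particular all \<open>C\<close> have the same growth rate.

  On the algebraic side, \<open>A\<close> is brought to upper triangular form \<open>T\<close> by a base change over \<open>K\<close>, with the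
  eigenvalues on the diagonal in order of decreasing absolute value. Then the entries of \<open>T\<^sup>i\<close> in row \<open>r\<close>
  are bounded by a polynomial in \<open>i\<close> times \<open>max 1 (v \<lambda>\<^sub>r) ^ i\<close>, and the Leibniz formula bounds \<open>D\<^sub>n\<close> by a
  polynomial times \<open>R ^ n\<close>. Conversely the vectors \<open>T ^ (n - 1) e\<^sub>r\<close> for \<open>v \<lambda>\<^sub>r > 1\<close> together with the \<open>e\<^sub>r\<close>
  for the remaining \<open>r\<close> form a triangular matrix whose determinant has absolute value \<open>R ^ (n - 1)\<close>, and
  multilinearity turns this into a lower bound for \<open>D\<^sub>n\<close> (\<open>det_orbit_matrix_upper\<close>,
  \<open>det_orbit_matrix_lower\<close>). Only the given \<open>v\<close> on \<open>K\<close> is available to measure matrix entries, so the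
  triangularisation has to stay inside \<open>K\<close>; this rests on the fact that a singular matrix over \<open>K\<close> has a
  kernel vector over \<open>K\<close> (\<open>singular_kernel\<close>).

  The archimedean and the non-archimedean case are treated together. What distinguishes \<open>k\<close>, besides
  completeness and density of the rationals, is a self-similarity of its unit ball: it is covered by
  finitely many translates of its multiple by some \<open>\<theta>\<close>, where the number of translates is the inverse of
  the absolute value of \<open>\<theta>\<close> and two translates meet in at most one point (locale \<open>tiled_field\<close>). This
  yields local compactness by iteration, and it fixes the factor by which a dilation scales Haar measure.
  That linear maps scale Haar measure by some factor follows from the uniqueness of invariant measures,
  which is a computation with Fubini's theorem; the factor is multiplicative, it is \<open>1\<close> on transvections,
  and the tiling identifies it on dilations (\<open>modulus_eq_det\<close>).
\<close>

no_notation Formal_Power_Series.fps_nth (infixl "$" 75)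

section \<open>Absolute values on subfields\<close>

text \<open>The absolute value is only given on the carrier \<open>K\<close>, while matrices have entries in the surrounding type.
  Each estimate is therefore accompanied by a closure property of \<open>K\<close>.\<close>

locale valued_subfield =
  fixes K :: "'a::field_char_0 set" and v :: "'a \<Rightarrow> real"
  assumes abs_value: "abs_value_on K v"
    and one_closed: "1 \<in> K"
    and add_closed: "x \<in> K \<Longrightarrow> y \<in> K \<Longrightarrow> x + y \<in> K"
    and mult_closed: "x \<in> K \<Longrightarrow> y \<in> K \<Longrightarrow> x * y \<in> K"
    and uminus_closed: "x \<in> K \<Longrightarrow> - x \<in> K"
    and inverse_closed: "x \<in> K \<Longrightarrow> inverse x \<in> K"
begin

lemma zero_closed: "0 \<in> K"
  using add_closed[OF one_closed uminus_closed[OF one_closed]] by simp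

lemma diff_closed: "x \<in> K \<Longrightarrow> y \<in> K \<Longrightarrow> x - y \<in> K"
  using add_closed[OF _ uminus_closed] by force

lemma divide_closed: "x \<in> K \<Longrightarrow> y \<in> K \<Longrightarrow> x / y \<in> K"
  by (simp add: divide_inverse mult_closed inverse_closed)

lemma sum_closed: "(\<And>i. i \<in> S \<Longrightarrow> f i \<in> K) \<Longrightarrow> sum f S \<in> K"
  by (induction S rule: infinite_finite_induct) (auto simp: zero_closed add_closed)

lemma prod_closed: "(\<And>i. i \<in> S \<Longrightarrow> f i \<in> K) \<Longrightarrow> prod f S \<in> K"
  by (induction S rule: infinite_finite_induct) (auto simp: one_closed mult_closed)

lemma power_closed: "x \<in> K \<Longrightarrow> x ^ n \<in> K"
  by (induction n) (auto simp: one_closed mult_closed)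

lemma sign_closed: "of_int (sign p) \<in> K"
  by (cases p rule: sign_cases) (simp_all add: one_closed uminus_closed)

lemma det_closed:
  fixes A :: "'a^'n^'n"
  assumes "\<And>i j. A $ i $ j \<in> K"
  shows "det A \<in> K"
  unfolding det_def by (intro sum_closed mult_closed prod_closed assms sign_closed)

lemma v_nonneg: "x \<in> K \<Longrightarrow> 0 \<le> v x"
  and v_eq_0: "x \<in> K \<Longrightarrow> v x = 0 \<longleftrightarrow> x = 0"
  and v_mult: "x \<in> K \<Longrightarrow> y \<in> K \<Longrightarrow> v (x * y) = v x * v y"
  and v_add: "x \<in> K \<Longrightarrow> y \<in> K \<Longrightarrow> v (x + y) \<le> v x + v y"
  using abs_value unfolding abs_value_on_def by auto

lemma v_zero [simp]: "v 0 = 0"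
  using v_eq_0 zero_closed by blast

lemma v_pos: "x \<in> K \<Longrightarrow> x \<noteq> 0 \<Longrightarrow> 0 < v x"
  using v_nonneg v_eq_0 less_eq_real_def by metis

lemma v_one [simp]: "v 1 = 1"
  using v_mult[OF one_closed one_closed] v_eq_0[OF one_closed] by simp

lemma v_minus_one [simp]: "v (- 1) = 1"
proof -
  have "v (- 1) * v (- 1) = 1"
    using v_mult[of "-1" "-1"] uminus_closed[OF one_closed] by simp
  with v_nonneg[OF uminus_closed[OF one_closed]] show ?thesis
    by (simp add: square_eq_1_iff)
qed

lemma v_minus: "x \<in> K \<Longrightarrow> v (- x) = v x"
  using v_mult[of "-1" x] uminus_closed[OF one_closed] by simp

lemma v_diff_swap: "x \<in> K \<Longrightarrow> y \<in> K \<Longrightarrow> v (x - y) = v (y - x)"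
  using v_minus[of "x - y"] diff_closed[of x y] by simp

lemma v_sum:
  assumes "\<And>i. i \<in> S \<Longrightarrow> f i \<in> K"
  shows "v (sum f S) \<le> (\<Sum>i\<in>S. v (f i))"
  using assms
proof (induction S rule: infinite_finite_induct)
  case (insert x S)
  have "v (f x + sum f S) \<le> v (f x) + v (sum f S)"
    using insert.prems by (intro v_add sum_closed) auto
  also have "\<dots> \<le> v (f x) + (\<Sum>i\<in>S. v (f i))"
    using insert by simp
  finally show ?case using insert by simp
qed auto

lemma v_prod:
  assumes "\<And>i. i \<in> S \<Longrightarrow> f i \<in> K"
  shows "v (prod f S) = (\<Prod>i\<in>S. v (f i))"
  using assms
  by (induction S rule: infinite_finite_induct) (auto simp: v_mult prod_closed)

lemma v_power: "x \<in> K \<Longrightarrow> v (x ^ n) = v x ^ n"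
  by (induction n) (auto simp: v_mult power_closed)

lemma v_inverse: "x \<in> K \<Longrightarrow> v (inverse x) = inverse (v x)"
proof (cases "x = 0")
  case False
  assume "x \<in> K"
  then have "v x * v (inverse x) = 1"
    using False v_mult[OF _ inverse_closed, of x x] by simp
  then show ?thesis by (rule inverse_unique[symmetric])
qed auto

lemma v_divide: "x \<in> K \<Longrightarrow> y \<in> K \<Longrightarrow> v (x / y) = v x / v y"
  by (simp add: divide_inverse v_mult v_inverse inverse_closed)

lemma v_sign: "v (of_int (sign p)) = 1"
  by (cases p rule: sign_cases) simp_all

lemma v_det_le:
  fixes A :: "'a^'n^'n"
  assumes "\<And>i j. A $ i $ j \<in> K"
  shows "v (det A) \<le> (\<Sum>p | p permutes (UNIV :: 'n set). \<Prod>i\<in>UNIV. v (A $ i $ p i))"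
proof -
  have "v (det A) \<le> (\<Sum>p | p permutes (UNIV :: 'n set).
      v (of_int (sign p) * (\<Prod>i\<in>UNIV. A $ i $ p i)))"
    unfolding det_def by (intro v_sum mult_closed prod_closed assms sign_closed)
  also have "\<dots> = (\<Sum>p | p permutes (UNIV :: 'n set). \<Prod>i\<in>UNIV. v (A $ i $ p i))"
    by (intro sum.cong refl) (simp add: v_mult v_prod v_sign assms prod_closed sign_closed)
  finally show ?thesis .
qed

end

section \<open>Self-similar tilings of the unit ball\<close>

text \<open>For the reals, the unit ball \<open>[-1, 1]\<close> is tiled by two translates of its half, which overlap in the point
  \<open>0\<close>. For the \<open>p\<close>-adic numbers it is the disjoint union of the \<open>p\<close> residue classes modulo \<open>p\<close>. The overlap
  condition is phrased so as to cover both cases.\<close>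

locale tiled_field =
  fixes \<theta> :: "'k::{field_char_0,metric_space}" and F :: "'k set"
  assumes abs_value_k: "abs_value_on (UNIV :: 'k set) Qp_abs"
    and dist_eq: "\<And>x y :: 'k. dist x y = Qp_abs (x - y)"
    and complete_k: "complete (UNIV :: 'k set)"
    and dense_rat: "closure (range of_rat) = (UNIV :: 'k set)"
    and finite_F: "finite F" and card_F: "real (card F) * Qp_abs \<theta> = 1"
    and two_le_card_F: "2 \<le> card F"
    and tile_cover: "\<And>x. Qp_abs x \<le> 1 \<longleftrightarrow> (\<exists>j\<in>F. Qp_abs (x - j) \<le> Qp_abs \<theta>)"
    and tile_overlap: "\<And>i j x y. i \<in> F \<Longrightarrow> j \<in> F \<Longrightarrow> i \<noteq> j \<Longrightarrow>
      Qp_abs (x - i) \<le> Qp_abs \<theta> \<Longrightarrow> Qp_abs (x - j) \<le> Qp_abs \<theta> \<Longrightarrow>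
      Qp_abs (y - i) \<le> Qp_abs \<theta> \<Longrightarrow> Qp_abs (y - j) \<le> Qp_abs \<theta> \<Longrightarrow> x = y"

lemma valued_subfield_UNIV: "abs_value_on UNIV v \<Longrightarrow> valued_subfield UNIV v"
  by unfold_locales auto

context tiled_field
begin

sublocale valued_subfield "UNIV :: 'k set" Qp_abs
  by (rule valued_subfield_UNIV) (rule abs_value_k)

end

text \<open>Since the rationals are dense, it suffices to check the tiling on rationals, with inequalities that are
  relaxed by arbitrarily small \<open>e\<close>. The finiteness of \<open>F\<close> allows the passage to the limit in the covering
  condition. Below, the archimedean conditions hold for all rationals with exactly this slack, and the
  \<open>p\<close>-adic ones because the values are discrete.\<close>

lemma tiled_fieldI:
  fixes \<theta> :: "'k::{field_char_0,metric_space}" and F :: "'k set"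
  assumes abs: "abs_value_on (UNIV :: 'k set) Qp_abs"
    and dist: "\<And>x y :: 'k. dist x y = Qp_abs (x - y)"
    and compl: "complete (UNIV :: 'k set)"
    and dense: "closure (range of_rat) = (UNIV :: 'k set)"
    and F: "finite F" "real (card F) * Qp_abs \<theta> = 1" "2 \<le> card F"
    and d: "0 < d"
    and cover: "\<And>q e. 0 < e \<Longrightarrow> e < d \<Longrightarrow> Qp_abs (of_rat q :: 'k) \<le> 1 + e \<Longrightarrow>
      \<exists>j\<in>F. Qp_abs (of_rat q - j) \<le> Qp_abs \<theta> + e"
    and inside: "\<And>q j e. 0 < e \<Longrightarrow> e < d \<Longrightarrow> j \<in> F \<Longrightarrow> Qp_abs (of_rat q - j) \<le> Qp_abs \<theta> + e
      \<Longrightarrow> Qp_abs (of_rat q :: 'k) \<le> 1 + e"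
    and overlap: "\<And>i j q e. 0 < e \<Longrightarrow> e < d \<Longrightarrow> i \<in> F \<Longrightarrow> j \<in> F \<Longrightarrow> i \<noteq> j \<Longrightarrow>
      Qp_abs (of_rat q - i) \<le> Qp_abs \<theta> + e \<Longrightarrow> Qp_abs (of_rat q - j) \<le> Qp_abs \<theta> + e \<Longrightarrow>
      Qp_abs (of_rat q :: 'k) \<le> e"
  shows "tiled_field \<theta> F"
proof -
  interpret valued_subfield UNIV "Qp_abs :: 'k \<Rightarrow> real"
    by (rule valued_subfield_UNIV) (rule abs)
  have approx: "\<exists>q. Qp_abs (of_rat q - x) < e" if "0 < e" for x :: 'k and e
    using that dense closure_approachable[of x "range of_rat"] by (auto simp: dist)
  have tri: "Qp_abs (x - z) \<le> Qp_abs (x - y) + Qp_abs (y - z)" for x y z :: 'k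
    using v_add[of "x - y" "y - z"] by simp
  have small: "s \<le> t" if "\<And>e. 0 < e \<Longrightarrow> e < d \<Longrightarrow> s \<le> t + 2 * e" for s t :: real
  proof (rule ccontr)
    assume "\<not> s \<le> t"
    \<comment> \<open>If \<open>s > t\<close>, this \<open>e\<close> contradicts the hypothesis, because \<open>2 * e < s - t\<close>.\<close>
    define e where "e = min (d / 2) ((s - t) / 3)"
    have "0 < e" "e < d" "e \<le> (s - t) / 3"
      using \<open>\<not> s \<le> t\<close> d min.cobounded2[of "d / 2" "(s - t) / 3"] by (simp_all add: e_def)
    with that[of e] \<open>\<not> s \<le> t\<close> show False by argo
  qed
  have covered: "\<exists>j\<in>F. Qp_abs (x - j) \<le> Qp_abs \<theta>" if x: "Qp_abs x \<le> 1" for x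
  proof -
    define m where "m = Min ((\<lambda>j. Qp_abs (x - j)) ` F)"
    have "F \<noteq> {}" using F by auto
    then have "m \<in> (\<lambda>j. Qp_abs (x - j)) ` F"
      unfolding m_def using F by (intro Min_in) auto
    then obtain j where j: "j \<in> F" "m = Qp_abs (x - j)" by auto
    have "m \<le> Qp_abs \<theta>"
    proof (rule small)
      fix e assume e: "0 < e" "e < d"
      then obtain q where q: "Qp_abs (of_rat q - x) < e" using approx by blast
      have "Qp_abs (of_rat q :: 'k) \<le> 1 + e" using tri[of "of_rat q" 0 x] q x unfolding diff_0_right by linarith
      then obtain i where i: "i \<in> F" "Qp_abs (of_rat q - i) \<le> Qp_abs \<theta> + e"
        using cover e by blast
      have "m \<le> Qp_abs (x - i)" unfolding m_def using F i by simp
      also have "\<dots> \<le> Qp_abs \<theta> + 2 * e"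
        using tri[of x i "of_rat q"] q i v_diff_swap[of x "of_rat q"] by simp
      finally show "m \<le> Qp_abs \<theta> + 2 * e" .
    qed
    with j show ?thesis by auto
  qed
  have inside': "Qp_abs x \<le> 1" if j: "j \<in> F" and x: "Qp_abs (x - j) \<le> Qp_abs \<theta>" for x j
  proof (rule small)
    fix e assume e: "0 < e" "e < d"
    then obtain q where q: "Qp_abs (of_rat q - x) < e" using approx by blast
    have "Qp_abs (of_rat q - j) \<le> Qp_abs \<theta> + e" using tri[of "of_rat q" j x] q x by simp
    from inside[OF e j this] show "Qp_abs x \<le> 1 + 2 * e"
      using tri[of x 0 "of_rat q"] q v_diff_swap[of x "of_rat q"] by simp
  qed
  have overlap': "x = 0" if ij: "i \<in> F" "j \<in> F" "i \<noteq> j"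
      "Qp_abs (x - i) \<le> Qp_abs \<theta>" "Qp_abs (x - j) \<le> Qp_abs \<theta>" for x i j
  proof -
    have "Qp_abs x \<le> 0"
    proof (rule small)
      fix e assume e: "0 < e" "e < d"
      then obtain q where q: "Qp_abs (of_rat q - x) < e" using approx by blast
      have "Qp_abs (of_rat q - i) \<le> Qp_abs \<theta> + e" "Qp_abs (of_rat q - j) \<le> Qp_abs \<theta> + e"
        using tri[of "of_rat q" i x] tri[of "of_rat q" j x] q ij by simp_all
      from overlap[OF e ij(1-3) this] show "Qp_abs x \<le> 0 + 2 * e"
        using tri[of x 0 "of_rat q"] q v_diff_swap[of x "of_rat q"] by simp
    qed
    then show ?thesis using v_nonneg[of x] v_eq_0[of x] by simp
  qed
  show ?thesis
  proof (rule tiled_field.intro)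
    fix x :: 'k
    show "Qp_abs x \<le> 1 \<longleftrightarrow> (\<exists>j\<in>F. Qp_abs (x - j) \<le> Qp_abs \<theta>)"
      using covered inside' by blast
  next
    fix i j x y :: 'k
    assume "i \<in> F" "j \<in> F" "i \<noteq> j" "Qp_abs (x - i) \<le> Qp_abs \<theta>" "Qp_abs (x - j) \<le> Qp_abs \<theta>"
      "Qp_abs (y - i) \<le> Qp_abs \<theta>" "Qp_abs (y - j) \<le> Qp_abs \<theta>"
    then show "x = y" using overlap'[of i j x] overlap'[of i j y] by simp
  qed (fact abs dist compl dense F)+
qed

lemma tiled_field_real:
  assumes "is_Qp \<infinity> TYPE('k::{field_char_0,metric_space})"
  shows "tiled_field (1/2 :: 'k) {1/2, - 1/2}"
proof -
  have "real_of_rat \<bar>x\<bar> = \<bar>real_of_rat x\<bar>" for x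
    by (simp add: abs_if of_rat_minus)
  then have r: "Qp_abs (of_rat x :: 'k) = \<bar>real_of_rat x\<bar>" for x
    using assms by (simp add: is_Qp_def rat_abs_def)
  have h: "Qp_abs (1/2 :: 'k) = 1/2"
    using r[of "1/2"] by (simp add: of_rat_divide)
  have e1: "Qp_abs (of_rat q - 1/2 :: 'k) = \<bar>real_of_rat q - 1/2\<bar>" for q
    using r[of "q - 1/2"] by (simp add: of_rat_diff of_rat_divide)
  have e2: "Qp_abs (of_rat q - - 1/2 :: 'k) = \<bar>real_of_rat q + 1/2\<bar>" for q
    using r[of "q + 1/2"] by (simp add: of_rat_add of_rat_divide)
  have ne: "(1/2 :: 'k) \<noteq> - 1/2" by (simp add: field_simps)
  show ?thesis
  proof (rule tiled_fieldI[where d = 1])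
    fix q :: rat and e :: real assume e: "0 < e" "e < 1" "Qp_abs (of_rat q :: 'k) \<le> 1 + e"
    show "\<exists>j\<in>{1/2, - 1/2}. Qp_abs (of_rat q - j :: 'k) \<le> Qp_abs (1/2 :: 'k) + e"
      using e(1,3) unfolding h r bex_simps by (simp only: e1 e2 bex_simps) argo
  next
    fix q :: rat and j :: 'k and e :: real
    assume e: "0 < e" "e < 1" "j \<in> {1/2, - 1/2}" "Qp_abs (of_rat q - j) \<le> Qp_abs (1/2 :: 'k) + e"
    from e(3) show "Qp_abs (of_rat q :: 'k) \<le> 1 + e"
    proof
      assume "j = 1/2"
      with e(4) have "\<bar>real_of_rat q - 1/2\<bar> \<le> 1/2 + e" unfolding h by (simp only: e1)
      then show ?thesis unfolding r by argo
    next
      assume "j \<in> {- 1/2}"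
      with e(4) have "\<bar>real_of_rat q + 1/2\<bar> \<le> 1/2 + e" unfolding h singleton_iff by (simp only: e2)
      then show ?thesis unfolding r by argo
    qed
  next
    fix q :: rat and i j :: 'k and e :: real
    assume e: "0 < e" "e < 1" "i \<in> {1/2, - 1/2}" "j \<in> {1/2, - 1/2}" "i \<noteq> j"
      "Qp_abs (of_rat q - i) \<le> Qp_abs (1/2 :: 'k) + e"
      "Qp_abs (of_rat q - j) \<le> Qp_abs (1/2 :: 'k) + e"
    then have "Qp_abs (of_rat q - 1/2 :: 'k) \<le> 1/2 + e" "Qp_abs (of_rat q - - 1/2 :: 'k) \<le> 1/2 + e"
      unfolding h by (metis insertE singletonD)+
    then show "Qp_abs (of_rat q :: 'k) \<le> e"
      unfolding r e1 e2 by argo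
  next
    show "real (card {1/2, - 1/2 :: 'k}) * Qp_abs (1/2 :: 'k) = 1" "2 \<le> card {1/2, - 1/2 :: 'k}"
      unfolding h using ne by simp_all
  qed (use assms[unfolded is_Qp_def] in blast, use assms[unfolded is_Qp_def] in blast,
      use assms[unfolded is_Qp_def] in blast, use assms[unfolded is_Qp_def] in blast, simp_all)
qed

context
  fixes p :: nat
  assumes p: "Factorial_Ring.prime p" and Qp: "is_Qp (enat p) TYPE('k::{field_char_0,metric_space})"
begin

interpretation valued_subfield UNIV "Qp_abs :: 'k \<Rightarrow> real"
  by (rule valued_subfield_UNIV) (use Qp in \<open>simp add: is_Qp_def\<close>)

lemma Qp_abs_int:
  assumes "m \<noteq> 0"
  shows "Qp_abs (of_int m :: 'k) = real p powi (- int (multiplicity (int p) m))"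
proof -
  have "Qp_abs (of_rat (of_int m) :: 'k) = rat_abs (enat p) (of_int m)"
    using Qp unfolding is_Qp_def by blast
  then show ?thesis using assms by (simp add: rat_abs_def)
qed

lemma Qp_abs_int_le_1: "Qp_abs (of_int m :: 'k) \<le> 1"
proof (cases "m = 0")
  case False
  have "1 \<le> real p ^ multiplicity (int p) m"
    using prime_ge_1_nat[OF p] by (intro one_le_power) simp
  then show ?thesis
    using False by (simp add: Qp_abs_int power_int_minus inverse_le_1_iff)
qed simp

lemma Qp_abs_int_unit: "\<not> int p dvd m \<Longrightarrow> Qp_abs (of_int m :: 'k) = 1"
  by (cases "m = 0") (auto simp: Qp_abs_int not_dvd_imp_multiplicity_0)

lemma Qp_abs_int_dvd: "int p dvd m \<Longrightarrow> Qp_abs (of_int m :: 'k) \<le> 1 / real p"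
proof (cases "m = 0")
  case False
  assume "int p dvd m"
  have "\<not> is_unit (int p)" using p by (auto dest: prime_gt_1_nat)
  then have "0 < multiplicity (int p) m"
    using False \<open>int p dvd m\<close> by (simp add: multiplicity_gt_zero_iff)
  then have "real p ^ 1 \<le> real p ^ multiplicity (int p) m"
    using p by (intro power_increasing) (auto dest: prime_ge_1_nat)
  then show ?thesis
    using False p by (simp add: Qp_abs_int power_int_minus field_simps prime_gt_0_nat)
qed auto

lemma Qp_abs_int_ge: "int p dvd m \<longleftrightarrow> Qp_abs (of_int m :: 'k) < 1"
proof -
  have "1 / real p < 1" using prime_gt_1_nat[OF p] by simp
  then show ?thesis using Qp_abs_int_dvd[of m] Qp_abs_int_unit[of m] by force
qed

text \<open>In a reduced fraction whose denominator is divisible by \<open>p\<close>, the numerator is a unit, so the absolute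
  value is at least \<open>p\<close>. All other rationals are quotients of integers with a unit as denominator, which
  reduces every \<open>p\<close>-adic estimate to divisibility by \<open>p\<close>.\<close>

lemma rat_unit_denominator:
  assumes "Qp_abs (of_rat q :: 'k) < real p"
  obtains a b where "q = of_int a / of_int b" "\<not> int p dvd b"
proof -
  obtain a b where ab: "quotient_of q = (a, b)" by fastforce
  then have q: "q = of_int a / of_int b" and cop: "coprime a b" and b: "0 < b"
    by (simp_all add: quotient_of_div quotient_of_coprime quotient_of_denom_pos)
  have "\<not> int p dvd b"
  proof
    assume *: "int p dvd b"
    then have "\<not> int p dvd a"
      using cop p coprime_common_divisor[OF cop, of "int p"] by auto
    then have "Qp_abs (of_rat q :: 'k) = 1 / Qp_abs (of_int b :: 'k)"
      unfolding q of_rat_divide by (simp add: v_divide Qp_abs_int_unit)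
    moreover have "Qp_abs (of_int b :: 'k) \<le> 1 / real p" using * by (rule Qp_abs_int_dvd)
    moreover have "0 < Qp_abs (of_int b :: 'k)" using b by (intro v_pos) auto
    ultimately have "real p \<le> Qp_abs (of_rat q :: 'k)"
      using prime_gt_0_nat[OF p] le_imp_inverse_le[of "Qp_abs (of_int b :: 'k)" "1 / real p"]
      by (simp add: inverse_eq_divide)
    with assms show False by simp
  qed
  with q that show thesis by blast
qed

lemma tiled_field_padic: "tiled_field (of_nat p :: 'k) (of_nat ` {..<p})"
proof -
  have p1: "1 < real p" using prime_gt_1_nat[OF p] by simp
  have pp: "Qp_abs (of_nat p :: 'k) = 1 / real p"
    using Qp_abs_int[of "int p"] p1 by (simp add: power_int_minus multiplicity_self inverse_eq_divide)
  \<comment> \<open>The gap between \<open>1 / p\<close> and \<open>1\<close>: an absolute value below \<open>1 / p + d\<close> is at most \<open>1 / p\<close>.\<close>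
  define d where "d = 1 - 1 / real p"
  have d: "0 < d" "1 / real p + d = 1" "d < 1" using p1 by (auto simp: d_def)
  have dp: "1 + d < real p"
  proof -
    have "0 < (real p - 1) * (1 - 1 / real p)"
      using p1 by (intro mult_pos_pos) auto
    also have "\<dots> = real p + 1 / real p - (real p * (1 / real p) + 1)"
      by (simp only: left_diff_distrib right_diff_distrib mult_1 mult_1_right)
    also have "real p * (1 / real p) = 1"
      using p1 by simp
    finally show ?thesis unfolding d_def by simp
  qed
  have val: "Qp_abs (of_rat (of_int a / of_int b) - of_int j :: 'k) = Qp_abs (of_int (a - j * b) :: 'k)"
    if "\<not> int p dvd b" for a b j
  proof -
    have b0: "(of_int b :: 'k) \<noteq> 0" using that by auto
    then have "(of_rat (of_int a / of_int b) - of_int j :: 'k) = of_int (a - j * b) / of_int b"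
      by (simp add: of_rat_divide field_simps)
    then show ?thesis using that by (simp add: v_divide Qp_abs_int_unit del: of_int_diff of_int_mult)
  qed
  have small: "int p dvd a - j * b"
    if "\<not> int p dvd b" "Qp_abs (of_rat (of_int a / of_int b) - of_int j :: 'k) \<le> Qp_abs (of_nat p :: 'k) + e"
      "e < d" for a b j e
  proof -
    have "Qp_abs (of_int (a - j * b) :: 'k) \<le> 1 / real p + e"
      using that(2) by (simp only: val[OF that(1)] pp)
    then show ?thesis
      using that(3) d Qp_abs_int_ge[of "a - j * b"] by linarith
  qed
  show ?thesis
  proof (rule tiled_fieldI[where d = d])
    fix q :: rat and e :: real assume e: "0 < e" "e < d" "Qp_abs (of_rat q :: 'k) \<le> 1 + e"
    then have "Qp_abs (of_rat q :: 'k) < real p" using dp by simp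
    then obtain a b where q: "q = of_int a / of_int b" and b: "\<not> int p dvd b"
      by (rule rat_unit_denominator)
    have "coprime (int p) b" using p b by (intro prime_imp_coprime) auto
    then obtain y z where yz: "y * b + z * int p = 1"
      using bezout_int[of b "int p"] by (auto simp: coprime_commute coprime_iff_gcd_eq_1)
    \<comment> \<open>The residue class of \<open>a / b\<close>, as \<open>y\<close> inverts \<open>b\<close> modulo \<open>p\<close>.\<close>
    define j where "j = (a * y) mod int p"
    have j: "0 \<le> j" "j < int p" using prime_gt_0_nat[OF p] by (auto simp: j_def)
    have "a - j * b = a * (y * b + z * int p) - j * b" using yz by simp
    also have "\<dots> = (a * y - j) * b + a * z * int p" by (simp add: algebra_simps)
    also have "a * y - j = int p * (a * y div int p)" by (simp add: j_def minus_mod_eq_mult_div)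
    finally have "int p dvd a - j * b" by simp
    then have "Qp_abs (of_rat q - of_int j :: 'k) \<le> 1 / real p"
      unfolding q val[OF b] by (rule Qp_abs_int_dvd)
    moreover have "(of_int j :: 'k) = of_nat (nat j)" "nat j < p" using j by auto
    ultimately show "\<exists>j\<in>of_nat ` {..<p}. Qp_abs (of_rat q - j :: 'k) \<le> Qp_abs (of_nat p :: 'k) + e"
      unfolding pp using e by (intro bexI[of _ "of_int j"]) auto
  next
    fix q :: rat and j :: 'k and e :: real
    assume e: "0 < e" "e < d" "j \<in> of_nat ` {..<p}" "Qp_abs (of_rat q - j) \<le> Qp_abs (of_nat p :: 'k) + e"
    then obtain i where i: "j = of_int (int i)" by auto
    have "Qp_abs (of_rat (q - of_nat i) :: 'k) < real p"
      using e d dp i unfolding pp by (simp add: of_rat_diff)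
    then obtain a b where ab: "q - of_nat i = of_int a / of_int b" and b: "\<not> int p dvd b"
      by (rule rat_unit_denominator)
    then have "of_rat q = (of_rat (of_int a / of_int b) - of_int (- int i) :: 'k)"
      by (simp flip: ab add: of_rat_diff)
    then have "Qp_abs (of_rat q :: 'k) \<le> 1"
      by (simp only: val[OF b] Qp_abs_int_le_1)
    then show "Qp_abs (of_rat q :: 'k) \<le> 1 + e" using e by simp
  next
    fix q :: rat and i j :: 'k and e :: real
    assume e: "0 < e" "e < d" "i \<in> of_nat ` {..<p}" "j \<in> of_nat ` {..<p}" "i \<noteq> j"
      "Qp_abs (of_rat q - i) \<le> Qp_abs (of_nat p :: 'k) + e"
      "Qp_abs (of_rat q - j) \<le> Qp_abs (of_nat p :: 'k) + e"
    then obtain i' j' where ij: "i = of_int (int i')" "j = of_int (int j')" "i' < p" "j' < p" by auto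
    have "Qp_abs i \<le> 1" unfolding ij using Qp_abs_int_le_1 .
    then have "Qp_abs (of_rat q :: 'k) < real p"
      using v_add[of "of_rat q - i" i] e d prime_ge_2_nat[OF p] unfolding pp by simp
    then obtain a b where q: "q = of_int a / of_int b" and b: "\<not> int p dvd b"
      by (rule rat_unit_denominator)
    have "int p dvd a - int i' * b" "int p dvd a - int j' * b"
      using e ij b q by (auto intro!: small)
    then have "int p dvd (a - int i' * b) - (a - int j' * b)" by (rule dvd_diff)
    then have "int p dvd (int j' - int i') * b" by (simp add: algebra_simps)
    then have "int p dvd int j' - int i'"
      using b p by (simp add: prime_dvd_mult_iff)
    then have "int j' mod int p = int i' mod int p" by (simp only: mod_eq_dvd_iff)
    then have "i' = j'" using ij(3,4) by simp
    then show "Qp_abs (of_rat q :: 'k) \<le> e" using e(5) ij by simp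
  next
    have "card (of_nat ` {..<p} :: 'k set) = p"
      by (simp add: card_image inj_on_def)
    then show "real (card (of_nat ` {..<p} :: 'k set)) * Qp_abs (of_nat p :: 'k) = 1"
       "2 \<le> card (of_nat ` {..<p} :: 'k set)"
      using p1 unfolding pp by (auto simp: prime_ge_2_nat[OF p])
  qed (use Qp[unfolded is_Qp_def] in blast, use Qp[unfolded is_Qp_def] in blast,
      use Qp[unfolded is_Qp_def] in blast, use Qp[unfolded is_Qp_def] in blast, simp_all add: d)
qed

end

theorem is_Qp_tiled_field:
  fixes T :: "'k::{field_char_0,metric_space} itself"
  assumes "p = \<infinity> \<or> (\<exists>q. Factorial_Ring.prime q \<and> p = enat q)"
    and "is_Qp p TYPE('k)"
  shows "\<exists>(\<theta> :: 'k) F. tiled_field \<theta> F"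
  using assms(1)
proof
  assume "p = \<infinity>"
  with assms(2) have "is_Qp \<infinity> TYPE('k)" by simp
  then show ?thesis by (blast dest: tiled_field_real)
next
  assume "\<exists>q. Factorial_Ring.prime q \<and> p = enat q"
  then obtain q where q: "Factorial_Ring.prime q" "p = enat q" by blast
  with assms(2) have "is_Qp (enat q) TYPE('k)" by simp
  with q(1) show ?thesis by (blast dest: tiled_field_padic)
qed

section \<open>The topology of \<open>\<rat>\<^sub>p\<^sup>N\<close>\<close>

context tiled_field
begin

lemma theta_pos: "0 < Qp_abs \<theta>" and theta_less: "Qp_abs \<theta> < 1"
proof -
  show "0 < Qp_abs \<theta>" using card_F v_nonneg[of \<theta>] by (cases "Qp_abs \<theta> = 0") auto
  moreover have "2 * Qp_abs \<theta> \<le> real (card F) * Qp_abs \<theta>"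
    using two_le_card_F v_nonneg[of \<theta>] by (intro mult_right_mono) auto
  ultimately show "Qp_abs \<theta> < 1" using card_F by simp
qed

lemma theta_nonzero: "\<theta> \<noteq> 0"
  using theta_pos by auto

text \<open>Rescaling the tiling of the unit ball tiles each ball of radius \<open>Qp_abs \<theta> ^ m\<close> by balls of the next
  smaller radius.\<close>

lemma unit_ball_totally_bounded:
  "\<exists>S. finite S \<and> cball (0 :: 'k) 1 \<subseteq> (\<Union>s\<in>S. cball s (Qp_abs \<theta> ^ m))"
proof (induction m)
  case 0
  show ?case by (rule exI[of _ "{0}"]) simp
next
  case (Suc m)
  then obtain S where S: "finite S" "cball (0 :: 'k) 1 \<subseteq> (\<Union>s\<in>S. cball s (Qp_abs \<theta> ^ m))" by blast
  define S' where "S' = (\<lambda>(s, j). s + \<theta> ^ m * j) ` (S \<times> F)"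
  have "x \<in> (\<Union>s\<in>S'. cball s (Qp_abs \<theta> ^ Suc m))" if x: "x \<in> cball 0 1" for x
  proof -
    obtain s where s: "s \<in> S" "x \<in> cball s (Qp_abs \<theta> ^ m)" using S x by blast
    then have s': "Qp_abs (x - s) \<le> Qp_abs \<theta> ^ m"
      using dist_commute[of s x] by (simp add: dist_eq)
    define y where "y = (x - s) / \<theta> ^ m"
    have "Qp_abs y \<le> 1"
      using s' theta_pos by (simp add: y_def v_divide v_power)
    then obtain j where j: "j \<in> F" "Qp_abs (y - j) \<le> Qp_abs \<theta>" using tile_cover by blast
    have "\<theta> ^ m * y = x - s" using theta_nonzero by (simp add: y_def)
    then have "x - (s + \<theta> ^ m * j) = \<theta> ^ m * (y - j)"
      by (simp add: right_diff_distrib)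
    then have "Qp_abs (x - (s + \<theta> ^ m * j)) \<le> Qp_abs \<theta> ^ m * Qp_abs \<theta>"
      using j v_nonneg[of \<theta>] by (simp add: v_mult v_power mult_left_mono)
    then have "x \<in> cball (s + \<theta> ^ m * j) (Qp_abs \<theta> ^ Suc m)"
      using dist_commute[of "s + \<theta> ^ m * j" x] by (simp add: dist_eq mult.commute)
    moreover have "s + \<theta> ^ m * j \<in> S'"
      unfolding S'_def using s(1) j(1) by (intro image_eqI[of _ _ "(s, j)"]) auto
    ultimately show ?thesis by blast
  qed
  moreover have "finite S'" using S finite_F by (simp add: S'_def)
  ultimately show ?case by blast
qed

lemma compact_unit_ball: "compact (cball (0 :: 'k) 1)"
proof -
  have "complete (cball (0 :: 'k) 1)"
    using complete_Int_closed[OF complete_k closed_cball[of "0 :: 'k" 1]] by simp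
  moreover have "\<exists>S. finite S \<and> cball (0 :: 'k) 1 \<subseteq> (\<Union>s\<in>S. ball s e)" if e: "0 < e" for e
  proof -
    obtain m where m: "Qp_abs \<theta> ^ m < e"
      using real_arch_pow_inv[OF e theta_less] by blast
    obtain S where S: "finite S" "cball (0 :: 'k) 1 \<subseteq> (\<Union>s\<in>S. cball s (Qp_abs \<theta> ^ m))"
      using unit_ball_totally_bounded by blast
    have "cball s (Qp_abs \<theta> ^ m) \<subseteq> ball s e" for s :: 'k using m by auto
    with S show ?thesis by (intro exI[of _ S]) blast
  qed
  ultimately show ?thesis unfolding compact_eq_totally_bounded by blast
qed

definition cube :: "real \<Rightarrow> ('k^'n) set" where
  "cube r = {x. \<forall>i. Qp_abs (x $ i) \<le> r}"

lemma cubeI: "(\<And>i. Qp_abs (x $ i) \<le> r) \<Longrightarrow> x \<in> cube r"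
  and cubeD: "x \<in> cube r \<Longrightarrow> Qp_abs (x $ i) \<le> r"
  by (auto simp: cube_def)

lemma cube_mono: "r \<le> s \<Longrightarrow> cube r \<subseteq> cube s"
  by (intro subsetI cubeI) (rule order_trans[OF cubeD])

lemma dist_vec_le_sum: "dist x y \<le> (\<Sum>i\<in>UNIV. Qp_abs (x $ i - y $ i))" for x y :: "'k^'n"
  unfolding dist_vec_def by (simp only: dist_eq[symmetric]) (rule L2_set_le_sum, simp)

lemma Qp_abs_nth_le_dist: "Qp_abs (x $ i - y $ i) \<le> dist x y" for x y :: "'k^'n"
  using dist_vec_nth_le[of x i y] by (simp add: dist_eq)

lemma continuous_matrix_vector_mult: "continuous_on S ((*v) (A :: 'k^'n^'m))"
proof -
  define C where "C = (\<Sum>i\<in>UNIV. \<Sum>j\<in>UNIV. Qp_abs (A $ i $ j))"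
  have C: "0 \<le> C" by (auto simp: C_def intro!: sum_nonneg v_nonneg)
  have "dist (A *v x) (A *v y) \<le> C * dist x y" for x y
  proof -
    have "Qp_abs ((A *v x) $ i - (A *v y) $ i) \<le> (\<Sum>j\<in>UNIV. Qp_abs (A $ i $ j) * dist x y)" for i
    proof -
      have "Qp_abs ((A *v x) $ i - (A *v y) $ i) = Qp_abs (\<Sum>j\<in>UNIV. A $ i $ j * (x $ j - y $ j))"
        by (simp add: matrix_vector_mult_def sum_subtractf right_diff_distrib)
      also have "\<dots> \<le> (\<Sum>j\<in>UNIV. Qp_abs (A $ i $ j * (x $ j - y $ j)))"
        by (rule v_sum) simp
      also have "\<dots> \<le> (\<Sum>j\<in>UNIV. Qp_abs (A $ i $ j) * dist x y)"
        by (intro sum_mono) (simp add: v_mult mult_left_mono v_nonneg Qp_abs_nth_le_dist)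
      finally show ?thesis .
    qed
    then have "dist (A *v x) (A *v y) \<le> (\<Sum>i\<in>UNIV. \<Sum>j\<in>UNIV. Qp_abs (A $ i $ j) * dist x y)"
      by (intro order_trans[OF dist_vec_le_sum] sum_mono)
    then show ?thesis by (simp add: C_def sum_distrib_right)
  qed
  then have "C-lipschitz_on S ((*v) A)" using C by (intro lipschitz_onI)
  then show ?thesis by (rule lipschitz_on_continuous_on)
qed

lemma smult_eq_matrix: "c *s x = mat c *v x" for x :: "'k^'n"
  by (simp add: vec_eq_iff matrix_vector_mult_def mat_def if_distrib[of "\<lambda>a. a * _"] cong: if_cong)

lemma continuous_smult: "continuous_on S (\<lambda>x :: 'k^'n. c *s x)"
  unfolding smult_eq_matrix by (rule continuous_matrix_vector_mult)

lemma continuous_smult_scalar: "continuous_on S (\<lambda>c :: 'k. c *s (x :: 'k^'n))"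
proof -
  define C where "C = (\<Sum>i\<in>UNIV. Qp_abs (x $ i))"
  have "dist (c *s x) (d *s x) \<le> C * dist c d" for c d
    using dist_vec_le_sum[of "c *s x" "d *s x"]
    by (simp add: C_def dist_eq v_mult sum_distrib_right flip: left_diff_distrib)
      (simp add: mult.commute)
  moreover have "0 \<le> C" by (auto simp: C_def intro!: sum_nonneg v_nonneg)
  ultimately have "C-lipschitz_on S (\<lambda>c. c *s x)" by (intro lipschitz_onI)
  then show ?thesis by (rule lipschitz_on_continuous_on)
qed

text \<open>By Tychonoff's theorem, after viewing the cube as the continuous image of a product of unit balls.\<close>

lemma compact_unit_cube: "compact (cube 1 :: ('k^'n) set)"
proof -
  have "compactin (product_topology (\<lambda>_. euclidean) UNIV) (PiE (UNIV :: 'n set) (\<lambda>_. cball (0 :: 'k) 1))"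
    unfolding compactin_PiE by (simp add: compact_unit_ball)
  then have "compact (PiE (UNIV :: 'n set) (\<lambda>_. cball (0 :: 'k) 1))"
    by (simp add: euclidean_product_topology)
  moreover have "continuous_on (PiE (UNIV :: 'n set) (\<lambda>_. cball (0 :: 'k) 1)) (\<lambda>f. \<chi> i. f i)"
    by (intro continuous_on_vec_lambda continuous_on_subset[OF continuous_on_product_coordinates]) auto
  ultimately have "compact ((\<lambda>f. \<chi> i. f i) ` PiE (UNIV :: 'n set) (\<lambda>_. cball (0 :: 'k) 1))"
    by (rule compact_continuous_image[rotated])
  moreover have "(\<lambda>f. \<chi> i. f i) ` PiE (UNIV :: 'n set) (\<lambda>_. cball (0 :: 'k) 1) = cube 1"
  proof (intro equalityI subsetI)
    fix x :: "'k^'n" assume "x \<in> cube 1"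
    then have "x = (\<chi> i. vec_nth x i)" "vec_nth x \<in> PiE (UNIV :: 'n set) (\<lambda>_. cball (0 :: 'k) 1)"
      by (auto simp: dist_eq v_minus dest: cubeD)
    then show "x \<in> (\<lambda>f. \<chi> i. f i) ` PiE (UNIV :: 'n set) (\<lambda>_. cball (0 :: 'k) 1)" by blast
  qed (auto intro!: cubeI simp: dist_eq v_minus PiE_UNIV_domain dest!: spec)
  ultimately show ?thesis by simp
qed

lemma scaled_cube: "c \<noteq> 0 \<Longrightarrow> (\<lambda>x. c *s x) ` cube r = (cube (Qp_abs c * r) :: ('k^'n) set)"
proof (intro equalityI subsetI)
  fix x :: "'k^'n" assume c: "c \<noteq> 0" and "x \<in> cube (Qp_abs c * r)"
  then have "inverse c *s x \<in> cube r"
  proof (intro cubeI)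
    fix i
    have "Qp_abs (inverse c) * Qp_abs (x $ i) \<le> inverse (Qp_abs c) * (Qp_abs c * r)"
      using cubeD[OF \<open>x \<in> cube _\<close>, of i] v_pos[of c] c
      unfolding v_inverse[OF UNIV_I] by (intro mult_left_mono) auto
    then show "Qp_abs ((inverse c *s x) $ i) \<le> r" using v_pos[of c] c
      by (simp add: v_mult flip: mult.assoc)
  qed
  moreover have "x = c *s (inverse c *s x)" using c by (simp add: vec_eq_iff)
  ultimately show "x \<in> (\<lambda>x. c *s x) ` cube r" by blast
next
  fix x :: "'k^'n" assume "x \<in> (\<lambda>x. c *s x) ` cube r"
  then obtain y where "x = c *s y" "y \<in> cube r" by blast
  then have "Qp_abs (x $ i) \<le> Qp_abs c * r" for i
    using mult_left_mono[OF cubeD v_nonneg[OF UNIV_I]] by (simp add: v_mult)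
  then show "x \<in> cube (Qp_abs c * r)" by (rule cubeI)
qed

text \<open>The powers of \<open>\<theta>\<close> are the scalars whose effect on measures is directly visible from the tiling. They come
  within the factor \<open>Qp_abs \<theta>\<close> of every size.\<close>

lemma theta_power_approx:
  assumes "1 \<le> r"
  shows "\<exists>m. r \<le> Qp_abs (inverse (\<theta> ^ m)) \<and> Qp_abs (inverse (\<theta> ^ m)) \<le> r / Qp_abs \<theta>"
proof -
  define P where "P m \<longleftrightarrow> Qp_abs \<theta> ^ m \<le> 1 / r" for m
  have "\<exists>m. P m"
    using real_arch_pow_inv[of "1 / r" "Qp_abs \<theta>"] assms theta_less unfolding P_def
    by (auto intro: less_imp_le)
  then have P: "P (Least P)" by (auto intro: LeastI_ex)
  have min: "\<not> P k" if "k < Least P" for k using that by (rule not_less_Least)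
  define m where "m = Least P"
  have pos: "0 < Qp_abs \<theta> ^ m" using theta_pos by simp
  show ?thesis
  proof (intro exI conjI)
    show "r \<le> Qp_abs (inverse (\<theta> ^ m))"
      using P pos assms unfolding P_def m_def[symmetric]
      by (simp add: v_divide v_power inverse_eq_divide pos_le_divide_eq mult.commute)
    show "Qp_abs (inverse (\<theta> ^ m)) \<le> r / Qp_abs \<theta>"
    proof (cases m)
      case 0
      then show ?thesis using assms theta_pos theta_less by (simp add: field_simps)
    next
      case (Suc k)
      then have "1 / r < Qp_abs \<theta> ^ k" using min[of k] unfolding P_def m_def[symmetric] by simp
      then show ?thesis using Suc theta_pos assms
        by (simp add: v_divide v_power v_mult inverse_eq_divide pos_divide_le_eq pos_divide_less_eq
            mult.commute less_imp_le)
    qed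
  qed
qed

lemma large_scalar:
  assumes "1 \<le> r"
  shows "\<exists>c :: 'k. r \<le> Qp_abs c \<and> Qp_abs c \<le> r / Qp_abs \<theta>"
  using theta_power_approx[OF assms] by blast

lemma compact_cube: "compact (cube r :: ('k^'n) set)"
proof -
  obtain c :: 'k where c: "max 1 r \<le> Qp_abs c" using large_scalar[of "max 1 r"] by auto
  then have c1: "1 \<le> Qp_abs c" "r \<le> Qp_abs c" by simp_all
  then have "c \<noteq> 0" by auto
  have "compact ((\<lambda>x :: 'k^'n. c *s x) ` cube 1)"
    by (intro compact_continuous_image continuous_smult compact_unit_cube)
  then have *: "compact (cube (Qp_abs c) :: ('k^'n) set)"
    using \<open>c \<noteq> 0\<close> by (simp add: scaled_cube)
  have "cube r = (\<Inter>i. {x :: 'k^'n. dist (x $ i) 0 \<le> r})"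
    by (auto simp: cube_def dist_eq)
  moreover have "closed (\<Inter>i. {x :: 'k^'n. dist (x $ i) 0 \<le> r})"
    by (intro closed_INT ballI closed_Collect_le continuous_intros)
  ultimately have "closed (cube r :: ('k^'n) set)" by simp
  then have "compact (cube (Qp_abs c) \<inter> cube r :: ('k^'n) set)" by (rule compact_Int_closed[OF *])
  moreover have "cube (Qp_abs c) \<inter> cube r = (cube r :: ('k^'n) set)"
    by (rule Int_absorb1) (rule cube_mono[OF c1(2)])
  ultimately show ?thesis by simp
qed

lemma compact_subset_cube:
  assumes "compact (C :: ('k^'n) set)"
  shows "\<exists>r\<ge>1. C \<subseteq> cube r"
proof -
  have "bounded C" using assms by (rule compact_imp_bounded)
  then obtain e where e: "\<forall>x\<in>C. dist 0 x \<le> e"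
    using bounded_any_center by blast
  have "C \<subseteq> cube (max 1 e)"
  proof (intro subsetI cubeI)
    fix x i assume "x \<in> C"
    then have "dist x 0 \<le> e" using e dist_commute[of x 0] by metis
    moreover have "Qp_abs (x $ i) \<le> dist x 0"
      using Qp_abs_nth_le_dist[of x i 0] by simp
    ultimately show "Qp_abs (x $ i) \<le> max 1 e" by linarith
  qed
  then show ?thesis by (intro exI[of _ "max 1 e"] conjI) simp_all
qed

lemma cube_subset_neighbourhood:
  assumes "0 \<in> interior (C :: ('k^'n) set)"
  obtains c :: 'k where "c \<noteq> 0" "cube (Qp_abs c) \<subseteq> C"
proof -
  obtain e where e: "0 < e" "ball 0 e \<subseteq> C" using assms mem_interior by blast
  have N: "0 < real CARD('n)" by simp
  obtain m where m: "Qp_abs \<theta> ^ m < e / real CARD('n)"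
    using real_arch_pow_inv[OF _ theta_less, of "e / real CARD('n)"] e by auto
  have "x \<in> C" if x: "x \<in> cube (Qp_abs (\<theta> ^ m))" for x
  proof -
    have "dist x 0 \<le> (\<Sum>i\<in>(UNIV :: 'n set). Qp_abs (x $ i))"
      using dist_vec_le_sum[of x 0] by simp
    also have "\<dots> \<le> (\<Sum>i\<in>(UNIV :: 'n set). Qp_abs \<theta> ^ m)"
      using x by (intro sum_mono) (auto simp: v_power dest: cubeD)
    also have "\<dots> < e" using m N by (simp add: field_simps)
    finally show ?thesis using e by (auto simp: dist_commute)
  qed
  then show thesis using theta_nonzero by (intro that[of "\<theta> ^ m"]) auto
qed

lemma cube_neighbourhood: "0 < r \<Longrightarrow> 0 \<in> interior (cube r :: ('k^'n) set)"
proof -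
  assume r: "0 < r"
  have "ball 0 r \<subseteq> (cube r :: ('k^'n) set)"
  proof
    fix x :: "'k^'n" assume "x \<in> ball 0 r"
    then have "dist x 0 < r" by (simp add: dist_commute)
    then have "Qp_abs (x $ i) \<le> r" for i
      using Qp_abs_nth_le_dist[of x i 0] by simp
    then show "x \<in> cube r" by (rule cubeI)
  qed
  then show ?thesis using r mem_interior by blast
qed

text \<open>An additive map is \<open>\<rat>\<close>-linear, and by continuity this extends to the closure of the rationals.\<close>

lemma additive_continuous_linear:
  assumes "Modules.additive (\<phi> :: 'k^'n \<Rightarrow> 'k^'n)" and "continuous_on UNIV \<phi>"
  shows "Vector_Spaces.linear (*s) (*s) \<phi>"
proof -
  interpret additive \<phi> by fact
  have nat: "\<phi> (of_nat m *s x) = of_nat m *s \<phi> x" for m x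
    by (induction m) (auto simp: zero add vector_sadd_rdistrib)
  have neg: "of_int (- int m) *s x = - (of_nat m *s x)" for m and x :: "'k^'n"
    by (simp add: vec_eq_iff)
  have int: "\<phi> (of_int m *s x) = of_int m *s \<phi> x" for m x
  proof (cases m rule: int_cases2)
    case (nonneg n)
    then show ?thesis by (simp add: nat)
  next
    case (nonpos n)
    then show ?thesis by (simp only: neg minus nat)
  qed
  have rat: "\<phi> (of_rat q *s x) = of_rat q *s \<phi> x" for q x
  proof -
    obtain a b where "quotient_of q = (a, b)" by fastforce
    then have q: "q = of_int a / of_int b" "b \<noteq> 0"
      using quotient_of_div quotient_of_denom_pos by force+
    have b: "(of_int b :: 'k) \<noteq> 0" using q by simp
    have "of_int b *s \<phi> (of_rat q *s x) = \<phi> (of_int b *s (of_rat q *s x))" by (simp only: int)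
    also have "of_int b *s (of_rat q *s x) = of_int a *s x"
      using b by (simp add: q of_rat_divide)
    also have "\<phi> (of_int a *s x) = of_int b *s (of_rat q *s \<phi> x)"
      using b by (simp add: q of_rat_divide int)
    finally show ?thesis using b by (simp only: vector_mul_lcancel) simp
  qed
  have "\<phi> (c *s x) = c *s \<phi> x" for c x
  proof -
    have "continuous_on UNIV (\<lambda>c. \<phi> (c *s x))"
      by (rule continuous_on_compose2[OF assms(2) continuous_smult_scalar]) simp
    then have "closed {c. \<phi> (c *s x) = c *s \<phi> x}"
      by (intro closed_Collect_eq continuous_smult_scalar)
    then have "closure (range of_rat) \<subseteq> {c. \<phi> (c *s x) = c *s \<phi> x}"
      using rat by (intro closure_minimal) auto
    then show ?thesis using dense_rat by auto
  qed
  then show ?thesis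
    by (simp add: Vector_Spaces.linear_iff vec.vector_space_axioms add)
qed

end

section \<open>Uniqueness of translation-invariant measures\<close>

context tiled_field
begin

lemma dist_add_left: "dist (a + x) (a + y) = dist x y" for x y :: "'k^'n"
  by (simp add: dist_vec_def dist_eq)

lemma dist_add_le: "dist (x + y) (x' + y') \<le> dist x x' + dist y y'" for x y :: "'k^'n"
  using dist_triangle[of "x + y" "x' + y'" "x' + y"] dist_add_left[of y x x'] dist_add_left[of x' y y']
  by (simp only: add.commute[of y])

lemma dist_diff_le: "dist (x - y) (x' - y') \<le> dist x x' + dist y y'" for x y :: "'k^'n"
proof -
  have "dist (- y) (- y') = dist y y'"
  proof -
    have "dist (- a) (- b) = dist a b" for a b :: 'k
    proof -
      have "- a - - b = - (a - b)" by simp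
      then show ?thesis by (simp only: dist_eq v_minus[OF UNIV_I])
    qed
    then show ?thesis by (simp add: dist_vec_def)
  qed
  then show ?thesis using dist_add_le[of x "- y" x' "- y'"] by simp
qed

lemma continuous_translation: "continuous_on S ((+) (a :: 'k^'n))"
  by (rule lipschitz_on_continuous_on[of 1], rule lipschitz_onI) (simp_all add: dist_add_left)

lemma dist_fst_snd_le: "dist (fst p) (fst q) + dist (snd p) (snd q) \<le> 2 * dist p q"
  using dist_fst_le[of p q] dist_snd_le[of p q] by simp

lemma continuous_add_pair: "continuous_on UNIV (\<lambda>(x :: 'k^'n, y). x + y)"
proof (rule lipschitz_on_continuous_on[of 2], rule lipschitz_onI)
  fix p q :: "('k^'n) \<times> ('k^'n)"
  show "dist (case p of (x, y) \<Rightarrow> x + y) (case q of (x, y) \<Rightarrow> x + y) \<le> 2 * dist p q"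
    using dist_add_le[of "fst p" "snd p" "fst q" "snd q"] dist_fst_snd_le[of p q]
    by (simp add: case_prod_beta)
qed simp

lemma continuous_diff_pair: "continuous_on UNIV (\<lambda>(x :: 'k^'n, y). x - y)"
proof (rule lipschitz_on_continuous_on[of 2], rule lipschitz_onI)
  fix p q :: "('k^'n) \<times> ('k^'n)"
  show "dist (case p of (x, y) \<Rightarrow> x - y) (case q of (x, y) \<Rightarrow> x - y) \<le> 2 * dist p q"
    using dist_diff_le[of "fst p" "snd p" "fst q" "snd q"] dist_fst_snd_le[of p q]
    by (simp add: case_prod_beta)
qed simp

definition rational_points :: "('k^'n) set" where
  "rational_points = range (\<lambda>q. \<chi> i. of_rat (q i))"

lemma countable_rational_points: "countable rational_points"
  by (simp add: rational_points_def)

lemma rational_points_dense: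
  assumes "0 < e"
  shows "\<exists>d\<in>rational_points. dist d (x :: 'k^'n) < e"
proof -
  have N: "0 < real CARD('n)" by simp
  have "\<exists>q. dist (of_rat q) (x $ i) < e / real CARD('n)" for i
    using dense_rat closure_approachable[of "x $ i" "range of_rat"] assms by auto
  then obtain q where q: "\<And>i. dist (of_rat (q i)) (x $ i) < e / real CARD('n)" by metis
  have "dist (\<chi> i. of_rat (q i)) x \<le> (\<Sum>i\<in>UNIV. dist (of_rat (q i)) (x $ i))"
    using dist_vec_le_sum[of "\<chi> i. of_rat (q i)" x] by (simp add: dist_eq)
  also have "\<dots> < (\<Sum>i\<in>(UNIV :: 'n set). e / real CARD('n))"
    by (rule sum_strict_mono) (use q in auto)
  also have "\<dots> = e" using N by simp
  finally show ?thesis unfolding rational_points_def by blast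
qed

text \<open>The rationals make \<open>k\<^sup>N\<close> second countable, so an open subset of the product is a countable union of boxes.
  Hence addition is measurable for the product \<open>\<sigma>\<close>-algebra, which Fubini's theorem asks for.\<close>

lemma open_in_pair_measure:
  fixes W :: "(('k^'n) \<times> ('k^'n)) set"
  assumes "open W" and [simp]: "sets M = sets borel" "sets N = sets borel"
  shows "W \<in> sets (pair_measure M N)"
proof -
  define B :: "('k^'n) \<times> ('k^'n) \<times> nat \<Rightarrow> (('k^'n) \<times> ('k^'n)) set"
    where "B = (\<lambda>(a, b, m). ball a (1 / real (Suc m)) \<times> ball b (1 / real (Suc m)))"
  define I where "I = {t \<in> rational_points \<times> rational_points \<times> (UNIV :: nat set). B t \<subseteq> W}"
  have W: "W = (\<Union>t\<in>I. B t)"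
  proof (intro equalityI subsetI)
    fix z assume "z \<in> W"
    obtain x y where z: "z = (x, y)" by fastforce
    obtain U V where UV: "open U" "open V" "z \<in> U \<times> V" "U \<times> V \<subseteq> W"
      using \<open>open W\<close> \<open>z \<in> W\<close> by (rule open_prod_elim)
    then have xy: "x \<in> U" "y \<in> V" by (simp_all add: z)
    obtain e where e: "0 < e" "ball x e \<subseteq> U" using openE[OF UV(1) xy(1)] .
    obtain e' where e': "0 < e'" "ball y e' \<subseteq> V" using openE[OF UV(2) xy(2)] .
    obtain m where m: "1 / real (Suc m) < min e e' / 2"
      using nat_approx_posE[of "min e e' / 2"] e(1) e'(1) by (metis half_gt_zero min_less_iff_conj)
    define r where "r = 1 / real (Suc m)"
    have r: "0 < r" "2 * r < e" "2 * r < e'" using m by (auto simp: r_def)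
    obtain a where a: "a \<in> rational_points" "dist a x < r" using rational_points_dense r by blast
    obtain b where b: "b \<in> rational_points" "dist b y < r" using rational_points_dense r by blast
    have "ball a r \<subseteq> ball x e"
    proof
      fix w assume "w \<in> ball a r"
      then show "w \<in> ball x e" using a r dist_triangle[of x w a] dist_commute[of x a] by simp
    qed
    moreover have "ball b r \<subseteq> ball y e'"
    proof
      fix w assume "w \<in> ball b r"
      then show "w \<in> ball y e'" using b r dist_triangle[of y w b] dist_commute[of y b] by simp
    qed
    ultimately have "ball a r \<times> ball b r \<subseteq> W" using e(2) e'(2) UV(4) by blast
    then have "B (a, b, m) \<subseteq> W" by (simp add: B_def r_def)
    then have "(a, b, m) \<in> I" using a b by (simp add: I_def)
    moreover have "z \<in> B (a, b, m)" using a b by (simp add: z B_def r_def)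
    ultimately show "z \<in> (\<Union>t\<in>I. B t)" by blast
  qed (auto simp: I_def)
  have "countable I"
  proof (rule countable_subset)
    show "I \<subseteq> rational_points \<times> rational_points \<times> UNIV" by (auto simp: I_def)
    show "countable (rational_points \<times> rational_points \<times> (UNIV :: nat set))"
      by (intro countable_SIGMA countable_rational_points) auto
  qed
  moreover have "B t \<in> sets (pair_measure M N)" for t
    unfolding B_def by (cases t) (simp add: pair_measureI)
  ultimately show ?thesis unfolding W by (intro sets.countable_UN') auto
qed

lemma continuous_pair_measurable:
  fixes f :: "('k^'n) \<times> ('k^'n) \<Rightarrow> 'b::topological_space"
  assumes "continuous_on UNIV f" and "sets M = sets borel" "sets N = sets borel"
  shows "f \<in> borel_measurable (pair_measure M N)"
proof (rule borel_measurableI)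
  fix S :: "'b set" assume "open S"
  then have "open (f -` S)" using assms(1) by (rule open_vimage)
  moreover have "space (pair_measure M N) = UNIV"
    using sets_eq_imp_space_eq[OF assms(2)] sets_eq_imp_space_eq[OF assms(3)]
    by (simp add: space_pair_measure)
  ultimately show "f -` S \<inter> space (pair_measure M N) \<in> sets (pair_measure M N)"
    using open_in_pair_measure[OF _ assms(2,3)] by (simp only: Int_UNIV_right)
qed

end

text \<open>The push-forward of a Haar measure along an invertible linear map inherits these properties at once, and
  they determine a measure up to a factor.\<close>

locale invariant_measure = tiled_field \<theta> F
  for \<theta> :: "'k::{field_char_0,metric_space}" and F :: "'k set" +
  fixes M :: "('k^'n) measure"
  assumes sets_M [simp]: "sets M = sets borel"
    and emeasure_translate: "\<And>x A. A \<in> sets borel \<Longrightarrow> emeasure M ((+) x ` A) = emeasure M A"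
    and emeasure_cube_finite: "\<And>r. emeasure M (cube r) < \<infinity>"
begin

lemma space_M [simp]: "space M = UNIV"
  using sets_eq_imp_space_eq[OF sets_M] by simp

lemma cube_borel [simp]: "(cube r :: ('k^'n) set) \<in> sets borel"
  by (intro borel_closed compact_imp_closed compact_cube)

lemma sigma_finite: "sigma_finite_measure M"
proof
  have "(\<Union>n. cube (real n) :: ('k^'n) set) = UNIV"
  proof (intro equalityI subsetI)
    fix x :: "'k^'n"
    obtain n where n: "(\<Sum>i\<in>UNIV. Qp_abs (x $ i)) \<le> real n" using real_arch_simple by blast
    have "Qp_abs (x $ i) \<le> (\<Sum>i\<in>UNIV. Qp_abs (x $ i))" for i
      by (rule member_le_sum) (auto simp: v_nonneg)
    then have "x \<in> cube (real n)" using n by (intro cubeI) (meson order_trans)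
    then show "x \<in> (\<Union>n. cube (real n))" by blast
  qed auto
  then show "\<exists>A. countable A \<and> A \<subseteq> sets M \<and> \<Union>A = space M \<and> (\<forall>a\<in>A. emeasure M a \<noteq> \<infinity>)"
    using less_imp_neq[OF emeasure_cube_finite]
    by (intro exI[of _ "range (\<lambda>n::nat. cube (real n))"] conjI) (auto simp del: infinity_ennreal_def)
qed

lemma measurable_translation: "(+) a \<in> measurable M M"
  by (subst measurable_cong_sets[OF sets_M sets_M])
    (intro borel_measurable_continuous_onI continuous_translation)

lemma distr_translation: "distr M M ((+) a) = M"
proof (rule measure_eqI)
  fix A assume "A \<in> sets (distr M M ((+) a))"
  then have A: "A \<in> sets borel" by simp
  have eq: "(+) a -` A = (+) (- a) ` A"
  proof (intro equalityI subsetI)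
    fix x assume "x \<in> (+) a -` A"
    then have "x = - a + (a + x)" "a + x \<in> A" by auto
    then show "x \<in> (+) (- a) ` A" by blast
  qed auto
  have "emeasure (distr M M ((+) a)) A = emeasure M ((+) a -` A \<inter> space M)"
    using A measurable_translation by (intro emeasure_distr) simp_all
  then show "emeasure (distr M M ((+) a)) A = emeasure M A"
    by (simp only: eq space_M Int_UNIV_right emeasure_translate[OF A])
qed simp

lemma borel_measurable_M: "borel_measurable M = borel_measurable borel"
  by (rule measurable_cong_sets) simp_all

lemma nn_integral_translation:
  assumes "f \<in> borel_measurable borel"
  shows "(\<integral>\<^sup>+x. f (a + x) \<partial>M) = (\<integral>\<^sup>+x. f x \<partial>M)"
proof -
  have "(\<integral>\<^sup>+x. f x \<partial>distr M M ((+) a)) = (\<integral>\<^sup>+x. f (a + x) \<partial>M)"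
  proof (rule nn_integral_distr)
    show "(+) a \<in> measurable M M" by (rule measurable_translation)
    show "f \<in> borel_measurable (distr M M ((+) a))"
      using assms by (simp only: measurable_distr_eq1 borel_measurable_M)
  qed
  then show ?thesis by (simp add: distr_translation)
qed

end

text \<open>Both sides are equal to the integral of \<open>1\<^sub>A(x + y) 1\<^sub>Q(y)\<close> over \<open>x\<close> and \<open>y\<close>, for the unit cube \<open>Q\<close>. Integrating
  over \<open>x\<close> first gives the left side. Substituting \<open>y - x\<close> for \<open>y\<close> turns the integrand into
  \<open>1\<^sub>A(y) 1\<^sub>Q(y - x)\<close>; as \<open>Q\<close> is symmetric, the integral of \<open>1\<^sub>Q(y - x)\<close> over \<open>x\<close> is the measure of \<open>Q\<close> for every \<open>y\<close>,
  and the right side results.\<close>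

lemma (in tiled_field) invariant_measure_unique:
  assumes "invariant_measure \<theta> F (M :: ('k^'n) measure)" "invariant_measure \<theta> F N"
    and A: "A \<in> sets borel"
  shows "emeasure M A * emeasure N (cube 1) = emeasure N A * emeasure M (cube 1)"
proof -
  interpret M: invariant_measure \<theta> F M by fact
  interpret N: invariant_measure \<theta> F N by fact
  interpret MN: pair_sigma_finite M N
    using M.sigma_finite N.sigma_finite by (simp add: pair_sigma_finite_def)
  let ?Q = "cube 1 :: ('k^'n) set"
  let ?i = "\<lambda>A x. indicator A x :: ennreal"
  have Q [measurable]: "?Q \<in> sets borel" by simp
  note A [measurable]
  have iA: "?i A \<in> borel_measurable borel" and iQ: "?i ?Q \<in> borel_measurable borel"
    by simp_all
  have comp: "(\<lambda>z. ?i B (f z)) \<in> borel_measurable (pair_measure M N)"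
    if "continuous_on UNIV f" "B \<in> sets borel" for f and B :: "('k^'n) set"
    using continuous_pair_measurable[OF that(1) M.sets_M N.sets_M]
    by (rule measurable_compose) (use that(2) in simp)
  have snd: "continuous_on UNIV (snd :: ('k^'n) \<times> ('k^'n) \<Rightarrow> 'k^'n)"
    by (intro continuous_on_snd continuous_on_id)
  have add: "continuous_on UNIV (\<lambda>z :: ('k^'n) \<times> ('k^'n). fst z + snd z)"
    using continuous_add_pair by (simp only: case_prod_beta')
  have diff: "continuous_on UNIV (\<lambda>z :: ('k^'n) \<times> ('k^'n). snd z - fst z)"
    using continuous_on_compose2[OF continuous_diff_pair continuous_on_swap[of UNIV] subset_UNIV]
    by (simp only: case_prod_beta' prod.swap_def fst_conv snd_conv)
  have m1: "(\<lambda>z. ?i A (fst z + snd z) * ?i ?Q (snd z)) \<in> borel_measurable (pair_measure M N)"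
    by (intro borel_measurable_times_ennreal comp[OF add A] comp[OF snd Q])
  have m2: "(\<lambda>z. ?i A (snd z) * ?i ?Q (snd z - fst z)) \<in> borel_measurable (pair_measure M N)"
    by (intro borel_measurable_times_ennreal comp[OF diff Q] comp[OF snd A])
  have sym: "?i ?Q (y - x) = ?i ?Q (- y + x)" for x y
  proof -
    have "Qp_abs ((y - x) $ i) = Qp_abs ((- y + x) $ i)" for i
      using v_diff_swap[of "y $ i" "x $ i"] by simp
    then show ?thesis by (simp add: cube_def indicator_def)
  qed
  have "emeasure M A * emeasure N ?Q = (\<integral>\<^sup>+y. \<integral>\<^sup>+x. ?i A x * ?i ?Q y \<partial>M \<partial>N)"
    using iA iQ A
    by (simp add: nn_integral_multc nn_integral_cmult M.borel_measurable_M N.borel_measurable_M)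
  also have "\<dots> = (\<integral>\<^sup>+y. \<integral>\<^sup>+x. ?i A (x + y) * ?i ?Q y \<partial>M \<partial>N)"
  proof (rule nn_integral_cong)
    fix y
    have "(\<integral>\<^sup>+x. ?i A x * ?i ?Q y \<partial>M) = (\<integral>\<^sup>+x. ?i A (y + x) * ?i ?Q y \<partial>M)"
      using M.nn_integral_translation[of "\<lambda>x. ?i A x * ?i ?Q y" y] by simp
    then show "(\<integral>\<^sup>+x. ?i A x * ?i ?Q y \<partial>M) = (\<integral>\<^sup>+x. ?i A (x + y) * ?i ?Q y \<partial>M)"
      by (simp add: add.commute)
  qed
  also have "\<dots> = (\<integral>\<^sup>+x. \<integral>\<^sup>+y. ?i A (x + y) * ?i ?Q y \<partial>N \<partial>M)"
    using m1 by (intro MN.Fubini') (simp only: case_prod_beta')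
  also have "\<dots> = (\<integral>\<^sup>+x. \<integral>\<^sup>+y. ?i A y * ?i ?Q (y - x) \<partial>N \<partial>M)"
  proof (rule nn_integral_cong)
    fix x
    have m: "(\<lambda>y. ?i A y * ?i ?Q (y - x)) \<in> borel_measurable borel"
    proof -
      have "(\<lambda>y. - x + y) \<in> borel_measurable borel"
        by (rule borel_measurable_continuous_onI) (rule continuous_translation)
      then have "(\<lambda>y. ?i ?Q (- x + y)) \<in> borel_measurable borel"
        using iQ by (rule measurable_compose)
      then show ?thesis using iA by (intro borel_measurable_times_ennreal) simp_all
    qed
    show "(\<integral>\<^sup>+y. ?i A (x + y) * ?i ?Q y \<partial>N) = (\<integral>\<^sup>+y. ?i A y * ?i ?Q (y - x) \<partial>N)"
      using N.nn_integral_translation[OF m, of x] by simp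
  qed
  also have "\<dots> = (\<integral>\<^sup>+y. \<integral>\<^sup>+x. ?i A y * ?i ?Q (y - x) \<partial>M \<partial>N)"
    using m2 by (intro MN.Fubini'[symmetric]) (simp only: case_prod_beta')
  also have "\<dots> = (\<integral>\<^sup>+y. ?i A y * emeasure M ?Q \<partial>N)"
  proof (rule nn_integral_cong)
    fix y
    have meas: "(\<lambda>x. ?i ?Q (- y + x)) \<in> borel_measurable M"
    proof (rule measurable_compose[OF M.measurable_translation])
      show "?i ?Q \<in> borel_measurable M"
        using iQ by (simp only: M.borel_measurable_M)
    qed
    have "(\<integral>\<^sup>+x. ?i A y * ?i ?Q (y - x) \<partial>M) = ?i A y * (\<integral>\<^sup>+x. ?i ?Q (- y + x) \<partial>M)"
      unfolding sym using meas by (rule nn_integral_cmult)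
    also have "(\<integral>\<^sup>+x. ?i ?Q (- y + x) \<partial>M) = emeasure M ?Q"
      using M.nn_integral_translation[OF iQ, of "- y"] by simp
    finally show "(\<integral>\<^sup>+x. ?i A y * ?i ?Q (y - x) \<partial>M) = ?i A y * emeasure M ?Q" .
  qed
  also have "\<dots> = emeasure N A * emeasure M ?Q"
    using A iA by (simp add: nn_integral_multc N.borel_measurable_M)
  finally show ?thesis .
qed

section \<open>Elementary matrices\<close>

text \<open>The identity matrix with column \<open>k\<close> replaced by \<open>y\<close>. Dilations of one coordinate and transvections are the
  cases \<open>y = axis k c\<close> and \<open>y $ k = 1\<close>. As a transvection can bring a nonzero entry into the pivot position,
  these matrices alone generate all invertible ones.\<close>

definition elem_mat :: "'n \<Rightarrow> 'a::field^'n \<Rightarrow> 'a^'n^'n" where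
  "elem_mat k y = (\<chi> i j. if j = k then y $ i else if i = j then 1 else 0)"

lemma elem_vec: "elem_mat k y *v x = (\<chi> i. if i = k then y $ k * x $ k else x $ i + y $ i * x $ k)"
proof -
  have "(\<Sum>j\<in>UNIV. elem_mat k y $ i $ j * x $ j) = (if i = k then y $ k * x $ k else x $ i + y $ i * x $ k)" for i
  proof -
    have "(\<Sum>j\<in>UNIV. elem_mat k y $ i $ j * x $ j)
        = y $ i * x $ k + (\<Sum>j\<in>UNIV - {k}. elem_mat k y $ i $ j * x $ j)"
      by (subst sum.remove[of _ k]) (simp_all add: elem_mat_def)
    also have "(\<Sum>j\<in>UNIV - {k}. elem_mat k y $ i $ j * x $ j) = (\<Sum>j\<in>UNIV - {k}. if j = i then x $ i else 0)"
      by (rule sum.cong) (auto simp: elem_mat_def)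
    also have "\<dots> = (if i = k then 0 else x $ i)" by (simp add: sum.delta)
    finally show ?thesis by (auto simp: add.commute)
  qed
  then show ?thesis by (simp add: matrix_vector_mult_def)
qed

lemma elem_mult:
  "elem_mat k y ** elem_mat k z = elem_mat k (\<chi> i. if i = k then y $ k * z $ k else z $ i + y $ i * z $ k)"
  by (simp add: matrix_eq elem_vec vec_eq_iff algebra_simps flip: matrix_vector_mul_assoc)

lemma elem_one: "elem_mat k (axis k 1) = mat 1"
  by (simp add: matrix_eq elem_vec vec_eq_iff axis_def)

lemma det_elem_mat: "det (elem_mat k y) = y $ k"
proof -
  have "elem_mat k y = (\<chi> i j. if j = k then (mat 1 *v y) $ i else mat 1 $ i $ j)"
    by (simp only: matrix_vector_mul_lid) (auto simp add: elem_mat_def mat_def vec_eq_iff)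
  then show ?thesis using cramer_lemma[of k "mat 1" y] by simp
qed

lemma elem_fixes_axis: "j \<noteq> k \<Longrightarrow> elem_mat k y *v axis j 1 = axis j 1"
  by (auto simp: elem_vec vec_eq_iff axis_def)

definition elem_inv :: "'n \<Rightarrow> 'a::field^'n \<Rightarrow> 'a^'n" where
  "elem_inv k y = (\<chi> i. if i = k then 1 / y $ k else - y $ i / y $ k)"

lemma elem_inverse: "y $ k \<noteq> 0 \<Longrightarrow> elem_mat k y ** elem_mat k (elem_inv k y) = mat 1"
  by (simp add: elem_mult elem_inv_def flip: elem_one[of k]) (simp add: vec_eq_iff elem_mat_def axis_def)

lemma invertible_elem_mat: "y $ k \<noteq> 0 \<Longrightarrow> invertible (elem_mat k y)"
  by (simp add: invertible_det_nz det_elem_mat)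

lemma matrix_vec_axis: "A *v x = (\<Sum>j\<in>UNIV. x $ j *s (A *v axis j 1))" for A :: "'a::field^'n^'m"
  by (subst (1) basis_expansion[of x, symmetric]) (simp only: vec.sum vec.scale)

text \<open>Gauss elimination: multiplication by an elementary matrix turns one further column into a unit vector and
  keeps those already treated. If the pivot vanishes, a transvection first adds another row to it.\<close>

lemma invertible_elementary_induct [consumes 1, case_names one elem]:
  fixes A :: "'a::field^'n^'n"
  assumes "invertible A" and one: "P (mat 1)"
    and step: "\<And>k y A. y $ k \<noteq> 0 \<Longrightarrow> invertible A \<Longrightarrow> P A \<Longrightarrow> P (elem_mat k y ** A)"
  shows "P A"
proof -
  have "P A" if "finite S" "invertible A" "\<And>j. j \<notin> S \<Longrightarrow> A *v axis j 1 = axis j 1" for S A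
    using that
  proof (induction S arbitrary: A)
    case empty
    then have "A *v x = x" for x by (subst matrix_vec_axis) (simp add: basis_expansion)
    then have "A = mat 1" by (simp add: matrix_eq)
    with one show ?case by simp
  next
    case (insert k S A)
    have pivot: "P B" if B: "invertible B" "\<And>j. j \<notin> insert k S \<Longrightarrow> B *v axis j 1 = axis j 1"
      and y: "(B *v axis k 1) $ k \<noteq> 0" for B
    proof -
      define y where "y = B *v axis k 1"
      have yk: "y $ k \<noteq> 0" using y by (simp add: y_def)
      have inv: "elem_mat k (elem_inv k y) ** elem_mat k y = mat 1" "elem_mat k y ** elem_mat k (elem_inv k y) = mat 1"
        using elem_inverse[of y k] yk matrix_left_right_inverse by blast+
      have zk: "elem_inv k y $ k \<noteq> 0" using yk by (simp add: elem_inv_def)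
      have "P (elem_mat k (elem_inv k y) ** B)"
      proof (rule insert.IH)
        show "invertible (elem_mat k (elem_inv k y) ** B)"
          using B zk by (intro invertible_mult invertible_elem_mat)
        fix j assume j: "j \<notin> S"
        show "(elem_mat k (elem_inv k y) ** B) *v axis j 1 = axis j 1"
        proof (cases "j = k")
          case True
          have "elem_mat k y *v axis k 1 = y" by (auto simp: elem_vec vec_eq_iff axis_def)
          then have "elem_mat k (elem_inv k y) *v y = axis k 1"
            using inv(1) by (metis matrix_vector_mul_assoc matrix_vector_mul_lid)
          then show ?thesis using True by (simp add: y_def flip: matrix_vector_mul_assoc)
        next
          case False
          then show ?thesis using B(2)[of j] j elem_fixes_axis[OF False]
            by (simp flip: matrix_vector_mul_assoc)
        qed
      qed
      then have "P (elem_mat k y ** (elem_mat k (elem_inv k y) ** B))"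
        by (rule step[rotated 2]) (use yk zk B in \<open>auto intro!: invertible_mult invertible_elem_mat\<close>)
      then show ?thesis by (simp add: inv matrix_mul_assoc)
    qed
    define y where "y = A *v axis k 1"
    show ?case
    proof (cases "y $ k = 0")
      case False
      then show ?thesis using insert.prems pivot[of A] by (simp add: y_def)
    next
      case True
      have "\<exists>l\<in>S. y $ l \<noteq> 0"
      proof (rule ccontr)
        assume no: "\<not> (\<exists>l\<in>S. y $ l \<noteq> 0)"
        have "A *v y = (\<Sum>j\<in>UNIV. y $ j *s (A *v axis j 1))"
          by (rule matrix_vec_axis)
        also have "\<dots> = (\<Sum>j\<in>UNIV. y $ j *s axis j 1)"
        proof (intro sum.cong refl)
          fix j
          show "y $ j *s (A *v axis j 1) = y $ j *s axis j 1"
            using no True insert.prems(2)[of j] by (cases "j \<in> insert k S") auto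
        qed
        also have "\<dots> = A *v axis k 1" by (simp add: basis_expansion y_def)
        finally have "y = axis k 1"
          using insert.prems by (metis invertible_def matrix_vector_mul_assoc matrix_vector_mul_lid)
        with True show False by (simp add: axis_def)
      qed
      then obtain l where l: "l \<in> S" "y $ l \<noteq> 0" by blast
      then have lk: "l \<noteq> k" using insert.hyps by auto
      define a b :: "'a^'n" where "a = axis l 1 + axis k 1" and "b = axis l 1 - axis k 1"
      have ab: "a $ l = 1" "b $ l = 1" using lk by (simp_all add: a_def b_def axis_def)
      have "elem_mat l b ** elem_mat l a = mat 1"
        using lk by (simp add: elem_mult flip: elem_one[of l])
          (simp add: vec_eq_iff elem_mat_def axis_def a_def b_def)
      moreover have "P (elem_mat l a ** A)"
      proof (rule pivot)
        show "invertible (elem_mat l a ** A)"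
          using insert.prems ab by (intro invertible_mult invertible_elem_mat) auto
        show "(elem_mat l a ** A) *v axis j 1 = axis j 1" if "j \<notin> insert k S" for j
          using that l insert.prems(2)[of j] elem_fixes_axis[of j l a] by (auto simp flip: matrix_vector_mul_assoc)
        have e: "(elem_mat l a ** A) *v axis k 1 = elem_mat l a *v y"
          by (simp add: y_def matrix_vector_mul_assoc)
        show "((elem_mat l a ** A) *v axis k 1) $ k \<noteq> 0"
          unfolding e using lk l True by (simp add: elem_vec a_def axis_def)
      qed
      then have "P (elem_mat l b ** (elem_mat l a ** A))"
        by (rule step[rotated 2])
          (use insert.prems ab in \<open>auto intro!: invertible_mult invertible_elem_mat\<close>)
      ultimately show ?thesis by (simp add: matrix_mul_assoc)
    qed
  qed
  from this[of UNIV] show ?thesis using assms(1) by simp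
qed

section \<open>Haar measure scales by the determinant\<close>

locale haar = invariant_measure \<theta> F M
  for \<theta> :: "'k::{field_char_0,metric_space}" and F :: "'k set" and M :: "('k^'n) measure" +
  assumes cube_pos: "0 < measure M (cube 1)"
begin

lemma fmeasurable_subset_cube: "S \<in> sets borel \<Longrightarrow> S \<subseteq> cube r \<Longrightarrow> S \<in> fmeasurable M"
  using emeasure_cube_finite[of r] emeasure_mono[of S "cube r" M] by (intro fmeasurableI) auto

lemma compact_fmeasurable: "compact S \<Longrightarrow> S \<in> fmeasurable M"
  using compact_subset_cube[of S] fmeasurable_subset_cube[of S] by (auto intro: borel_compact)

lemma compact_matrix_image: "compact S \<Longrightarrow> compact ((*v) (A :: 'k^'n^'n) ` S)"
  by (intro compact_continuous_image continuous_matrix_vector_mult)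

lemma measure_translate: "S \<in> sets borel \<Longrightarrow> measure M ((+) x ` S) = measure M S"
  by (simp add: measure_def emeasure_translate)

definition modulus :: "'k^'n^'n \<Rightarrow> real" where
  "modulus A = measure M ((*v) A ` cube 1) / measure M (cube 1)"

lemma modulus_nonneg: "0 \<le> modulus A"
  by (simp add: modulus_def)

lemma invertible_image_eq_vimage:
  assumes "A ** B = mat 1" "B ** A = mat (1 :: 'k)"
  shows "(*v) (A :: 'k^'n^'n) ` S = (*v) B -` S"
proof (intro equalityI subsetI)
  fix x assume "x \<in> (*v) B -` S"
  moreover have "x = A *v (B *v x)" using assms by (simp add: matrix_vector_mul_assoc)
  ultimately show "x \<in> (*v) A ` S" by blast
qed (use assms in \<open>auto simp: matrix_vector_mul_assoc\<close>)

lemma matrix_borel_measurable: "(*v) (A :: 'k^'n^'n) \<in> borel_measurable borel"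
  by (intro borel_measurable_continuous_onI continuous_matrix_vector_mult)

lemma invertible_image_borel:
  assumes "invertible (A :: 'k^'n^'n)" "S \<in> sets borel"
  shows "(*v) A ` S \<in> sets borel"
proof -
  obtain B where B: "A ** B = mat 1" "B ** A = mat 1" using assms(1) by (auto simp: invertible_def)
  show ?thesis
    using measurable_sets[OF matrix_borel_measurable[of B] assms(2)]
    by (simp add: invertible_image_eq_vimage[OF B])
qed

text \<open>The set function \<open>S \<mapsto> M (A S)\<close> is again an invariant measure, hence a multiple of \<open>M\<close>.\<close>

lemma measure_matrix_image:
  assumes A: "invertible (A :: 'k^'n^'n)" and S: "S \<in> sets borel"
  shows "measure M ((*v) A ` S) = modulus A * measure M S"
proof -
  obtain B where B: "A ** B = mat 1" "B ** A = mat 1" using A by (auto simp: invertible_def)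
  define N where "N = distr M borel ((*v) B)"
  have N: "emeasure N S = emeasure M ((*v) A ` S)" if "S \<in> sets borel" for S
  proof -
    have "(*v) B \<in> measurable M borel"
      using matrix_borel_measurable by (simp add: borel_measurable_M)
    then have "emeasure N S = emeasure M ((*v) B -` S \<inter> space M)"
      unfolding N_def using that by (rule emeasure_distr)
    then show ?thesis by (simp add: invertible_image_eq_vimage[OF B])
  qed
  have inv: "invariant_measure \<theta> F N"
  proof unfold_locales
    show "sets N = sets borel" by (simp add: N_def)
    fix x and T :: "('k^'n) set" assume T: "T \<in> sets borel"
    have "(+) x ` T = (\<lambda>y. - x + y) -` T"
    proof (intro equalityI subsetI)
      fix z assume "z \<in> (\<lambda>y. - x + y) -` T"
      then show "z \<in> (+) x ` T" by (intro image_eqI[of _ _ "- x + z"]) simp_all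
    qed auto
    moreover have "(\<lambda>y. - x + y) \<in> borel_measurable (borel :: ('k^'n) measure)"
      by (rule borel_measurable_continuous_onI) (rule continuous_translation)
    ultimately have T': "(+) x ` T \<in> sets borel"
      using measurable_sets[of "\<lambda>y. - x + y" borel borel T] T by simp
    have "(*v) A ` (+) x ` T = (+) (A *v x) ` (*v) A ` T"
      by (simp add: image_image matrix_vector_right_distrib)
    then show "emeasure N ((+) x ` T) = emeasure N T"
      using T T' A by (simp add: N emeasure_translate invertible_image_borel)
  next
    fix r
    show "emeasure N (cube r) < \<infinity>"
      using compact_fmeasurable[OF compact_matrix_image[OF compact_cube]]
      by (simp add: N fmeasurable_def)
  qed
  have "emeasure M S * emeasure N (cube 1) = emeasure N S * emeasure M (cube 1)"
    by (rule invariant_measure_unique[OF _ inv S]) unfold_locales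
  then have "enn2real (emeasure M S * emeasure N (cube 1)) = enn2real (emeasure N S * emeasure M (cube 1))"
    by simp
  then have "measure M S * measure M ((*v) A ` cube 1) = measure M ((*v) A ` S) * measure M (cube 1)"
    using S by (simp add: enn2real_mult N measure_def)
  then show ?thesis using cube_pos by (simp add: modulus_def field_simps)
qed

lemma modulus_one: "modulus (mat 1) = 1"
  using cube_pos by (simp add: modulus_def)

lemma modulus_mult:
  assumes "invertible A" "invertible B"
  shows "modulus (A ** B) = modulus A * modulus B"
proof -
  have "(*v) (A ** B) ` cube 1 = (*v) A ` (*v) B ` cube 1"
    by (simp add: image_image matrix_vector_mul_assoc)
  then show ?thesis
    using assms measure_matrix_image[OF assms(1) invertible_image_borel[OF assms(2) cube_borel]]
    by (simp add: modulus_def)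
qed

lemma modulus_inverse: "A ** B = mat 1 \<Longrightarrow> modulus A * modulus B = 1"
  using modulus_mult[of A B] modulus_one invertible_left_inverse invertible_right_inverse by metis

lemma modulus_mono:
  assumes "(*v) A ` cube 1 \<subseteq> (*v) B ` cube 1"
  shows "modulus A \<le> modulus B"
  unfolding modulus_def using assms cube_pos
  by (intro divide_right_mono measure_mono_fmeasurable fmeasurableD compact_fmeasurable
      compact_matrix_image compact_cube) auto

text \<open>For a transvection \<open>E\<close>, conjugation by the dilation with factor \<open>2\<close> gives \<open>E ** E\<close>. Conjugation does not
  change the modulus \<open>m\<close>, so \<open>m * m = m\<close>.\<close>

lemma modulus_transvection:
  fixes y :: "'k^'n"
  assumes y: "y $ k = 1"
  shows "modulus (elem_mat k y) = 1"
proof -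
  define D D' :: "'k^'n^'n" where "D = elem_mat k (axis k 2)" and "D' = elem_mat k (axis k (1/2))"
  have inv: "invertible (elem_mat k y)" "invertible D" "invertible D'"
    using y by (auto simp: D_def D'_def axis_def intro!: invertible_elem_mat)
  have DD: "D' ** D = mat 1"
    unfolding D_def D'_def elem_mult elem_one[of k, symmetric]
    by (rule arg_cong[of _ _ "elem_mat k"]) (simp add: vec_eq_iff axis_def)
  have "elem_mat k y ** elem_mat k y = D' ** (elem_mat k y ** D)"
    unfolding D_def D'_def elem_mult
    by (rule arg_cong[of _ _ "elem_mat k"]) (simp add: vec_eq_iff axis_def y)
  then have "modulus (elem_mat k y) * modulus (elem_mat k y) = modulus D' * (modulus (elem_mat k y) * modulus D)"
    using inv by (simp add: modulus_mult[symmetric] invertible_mult)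
  also have "\<dots> = modulus (elem_mat k y)" using modulus_inverse[OF DD] by (simp add: algebra_simps)
  finally have "modulus (elem_mat k y) = 0 \<or> modulus (elem_mat k y) = 1" by simp
  moreover have "modulus (elem_mat k y) * modulus (elem_mat k (elem_inv k y)) = 1"
    using elem_inverse[of y k] y by (intro modulus_inverse) simp
  ultimately show ?thesis by auto
qed

lemma diag_image_cube:
  assumes c: "c \<noteq> 0"
  shows "(*v) (elem_mat k (axis k c)) ` cube 1 = {x :: 'k^'n. Qp_abs (x $ k) \<le> Qp_abs c \<and> (\<forall>i. i \<noteq> k \<longrightarrow> Qp_abs (x $ i) \<le> 1)}"
    (is "?L = ?R")
proof (intro equalityI subsetI)
  fix x assume "x \<in> ?L"
  then obtain z where z: "x = elem_mat k (axis k c) *v z" "z \<in> cube 1" by blast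
  have "Qp_abs (c * z $ k) \<le> Qp_abs c * 1"
    unfolding v_mult[OF UNIV_I UNIV_I] using cubeD[OF z(2)] v_nonneg[of c] by (intro mult_left_mono) auto
  then show "x \<in> ?R" using cubeD[OF z(2)] by (simp add: z elem_vec axis_def)
next
  fix x assume x: "x \<in> ?R"
  define z where "z = (\<chi> i. if i = k then x $ k / c else x $ i)"
  have "z \<in> cube 1"
  proof (rule cubeI)
    fix i show "Qp_abs (z $ i) \<le> 1"
      using x v_pos[of c] c by (auto simp: z_def v_divide)
  qed
  moreover have "x = elem_mat k (axis k c) *v z" using c by (simp add: z_def elem_vec axis_def vec_eq_iff)
  ultimately show "x \<in> ?L" by blast
qed

lemma hyperplane_compact: "compact {x :: 'k^'n. x \<in> cube 1 \<and> x $ k = a}"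
proof -
  have "closed {x :: 'k^'n. x $ k = a}" by (intro closed_Collect_eq continuous_intros)
  then have "compact (cube 1 \<inter> {x :: 'k^'n. x $ k = a})" by (intro compact_Int_closed compact_cube)
  then show ?thesis by (simp add: Int_def)
qed

text \<open>The translates of the slice \<open>x $ k = 0\<close> to the heights \<open>\<theta> ^ n\<close> are infinitely many disjoint subsets of the
  unit cube with the same measure.\<close>

lemma hyperplane_null: "measure M {x. x \<in> cube 1 \<and> x $ k = a} = 0"
proof -
  define H where "H = {x :: 'k^'n. x \<in> cube 1 \<and> x $ k = 0}"
  have H: "H \<in> sets borel" unfolding H_def by (intro borel_compact hyperplane_compact)
  have trans: "(+) (axis k t) ` H = {x. x \<in> cube 1 \<and> x $ k = t}" if "Qp_abs t \<le> 1" for t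
  proof (intro equalityI subsetI)
    fix x assume "x \<in> {x. x \<in> cube 1 \<and> x $ k = t}"
    then have x: "x \<in> cube 1" "x $ k = t" by auto
    have "x - axis k t \<in> H"
      using x cubeD[OF x(1)] by (auto simp: H_def axis_def intro!: cubeI)
    then show "x \<in> (+) (axis k t) ` H" by (intro image_eqI[of _ _ "x - axis k t"]) simp_all
  next
    fix x assume "x \<in> (+) (axis k t) ` H"
    then obtain z where z: "x = axis k t + z" "z \<in> cube 1" "z $ k = 0" by (auto simp: H_def)
    have "Qp_abs (x $ i) \<le> 1" for i
      using z cubeD[OF z(2), of i] that by (cases "i = k") (auto simp: axis_def)
    then show "x \<in> {x. x \<in> cube 1 \<and> x $ k = t}" using z by (auto intro!: cubeI simp: axis_def)
  qed
  have bound: "real m * measure M H \<le> measure M (cube 1)" for m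
  proof -
    define B where "B n = {x :: 'k^'n. x \<in> cube 1 \<and> x $ k = \<theta> ^ n}" for n
    have B: "B n \<in> fmeasurable M" for n
      unfolding B_def by (intro compact_fmeasurable hyperplane_compact)
    have "measure M (B n) = measure M H" for n
    proof -
      have "Qp_abs (\<theta> ^ n) \<le> 1"
        using theta_less theta_pos by (simp add: v_power power_le_one)
      then show ?thesis using measure_translate[OF H] trans by (metis B_def)
    qed
    moreover have "pairwise (\<lambda>i j. disjnt (B i) (B j)) {..<m}"
    proof (rule pairwiseI)
      fix i j :: nat assume ij: "i \<noteq> j"
      have "Qp_abs \<theta> ^ i \<noteq> Qp_abs \<theta> ^ j"
        using ij theta_less theta_pos power_inject_exp'[of "Qp_abs \<theta>" i j] by simp
      then have "\<theta> ^ i \<noteq> \<theta> ^ j" by (metis v_power UNIV_I)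
      then show "disjnt (B i) (B j)" by (auto simp: B_def disjnt_def)
    qed
    ultimately have "real m * measure M H = measure M (\<Union>n<m. B n)"
      using B by (subst measure_UNION') auto
    also have "\<dots> \<le> measure M (cube 1)"
      using B by (intro measure_mono_fmeasurable compact_fmeasurable compact_cube sets.finite_UN)
        (use fmeasurableD[OF B] in \<open>auto simp: B_def\<close>)
    finally show ?thesis .
  qed
  have "measure M H \<le> 0"
  proof (rule ccontr)
    assume "\<not> measure M H \<le> 0"
    then obtain m where "measure M (cube 1) < real m * measure M H"
      using reals_Archimedean3[of "measure M H"] by auto
    with bound[of m] show False by simp
  qed
  then have H0: "measure M H = 0" by (simp add: order_antisym)
  show ?thesis
  proof (cases "Qp_abs a \<le> 1")
    case True
    then show ?thesis using H0 measure_translate[OF H] trans by metis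
  next
    case False
    then have "{x. x \<in> cube 1 \<and> x $ k = a} = {}" using cubeD by blast
    then show ?thesis by (simp only: measure_empty)
  qed
qed

text \<open>The tiling of the unit ball in the coordinate \<open>k\<close> decomposes the unit cube, up to null sets, into \<open>card F\<close>
  translates of its image under the dilation by \<open>\<theta>\<close>.\<close>

lemma modulus_diag_theta: "modulus (elem_mat k (axis k \<theta>)) = Qp_abs \<theta>"
proof -
  define D where "D = (elem_mat k (axis k \<theta>) :: 'k^'n^'n)"
  define T where "T j = (+) (axis k j) ` (*v) D ` cube 1" for j
  have D: "invertible D" using theta_nonzero by (simp add: D_def invertible_elem_mat axis_def)
  have Dc: "(*v) D ` cube 1 \<in> sets borel" by (intro invertible_image_borel D cube_borel)
  have T: "x \<in> T j \<longleftrightarrow> Qp_abs (x $ k - j) \<le> Qp_abs \<theta> \<and> (\<forall>i. i \<noteq> k \<longrightarrow> Qp_abs (x $ i) \<le> 1)" for x j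
  proof -
    have "x \<in> T j \<longleftrightarrow> x - axis k j \<in> (*v) D ` cube 1"
      unfolding T_def by (metis add_diff_cancel_left' diff_add_cancel add.commute image_iff)
    then show ?thesis unfolding D_def diag_image_cube[OF theta_nonzero]
      by (auto simp: axis_def)
  qed
  have cover: "cube 1 = (\<Union>j\<in>F. T j)"
  proof (intro equalityI subsetI)
    fix x :: "'k^'n" assume x: "x \<in> cube 1"
    then show "x \<in> (\<Union>j\<in>F. T j)"
      using tile_cover[of "x $ k"] by (auto simp: T dest: cubeD)
  next
    fix x assume "x \<in> (\<Union>j\<in>F. T j)"
    then obtain j where j: "j \<in> F" "x \<in> T j" by blast
    then have "Qp_abs (x $ k) \<le> 1" using tile_cover[of "x $ k"] by (auto simp: T)
    then have "Qp_abs (x $ i) \<le> 1" for i using j by (cases "i = k") (auto simp: T)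
    then show "x \<in> cube 1" by (rule cubeI)
  qed
  have meas: "T j \<in> fmeasurable M" for j
    unfolding T_def by (intro compact_fmeasurable compact_continuous_image continuous_translation
        compact_matrix_image compact_cube)
  have "measure M (cube 1) = (\<Sum>j\<in>F. measure M (T j))"
    unfolding cover
  proof (rule measure_UNION_AE[OF finite_F meas], rule pairwiseI)
    fix i j assume ij: "i \<in> F" "j \<in> F" "i \<noteq> j"
    show "AE x in M. x \<notin> T i \<or> x \<notin> T j"
    proof (cases "T i \<inter> T j = {}")
      case False
      then obtain z where z: "z \<in> T i" "z \<in> T j" by blast
      have sub: "T i \<inter> T j \<subseteq> {x. x \<in> cube 1 \<and> x $ k = z $ k}"
      proof
        fix x assume x: "x \<in> T i \<inter> T j"
        then have "x $ k = z $ k" using tile_overlap[OF ij, of "x $ k" "z $ k"] z by (auto simp: T)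
        moreover have "x \<in> cube 1" using x ij cover by blast
        ultimately show "x \<in> {x. x \<in> cube 1 \<and> x $ k = z $ k}" by blast
      qed
      have "{x. x \<in> cube 1 \<and> x $ k = z $ k} \<in> null_sets M"
        using hyperplane_null[of k "z $ k"] compact_fmeasurable[OF hyperplane_compact[of k "z $ k"]]
        by (intro null_setsI) (auto simp: emeasure_eq_measure2 dest: fmeasurableD)
      then show ?thesis by (rule AE_I') (use sub in auto)
    qed auto
  qed
  also have "\<dots> = real (card F) * (modulus D * measure M (cube 1))"
    unfolding T_def measure_translate[OF Dc] by (simp add: measure_matrix_image[OF D])
  finally have "real (card F) * modulus D = 1" using cube_pos by simp
  then show ?thesis using card_F two_le_card_F unfolding D_def
    by (metis mult_cancel_left mult_zero_left zero_neq_one)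
qed

text \<open>The modulus \<open>\<delta>\<close> of a dilation is multiplicative and monotone in the absolute value of the factor, and it is
  known on powers of \<open>\<theta>\<close>. Enclosing \<open>c ^ n\<close> between consecutive powers of \<open>\<theta>\<close> shows that the \<open>n\<close>-th power of
  \<open>\<delta> c / Qp_abs c\<close> is bounded above and below independently of \<open>n\<close>, so this quotient is \<open>1\<close>. This is carried out for
  \<open>Qp_abs c \<ge> 1\<close>; the other case follows by inversion.\<close>

lemma modulus_diag:
  assumes c: "c \<noteq> 0"
  shows "modulus (elem_mat k (axis k c)) = Qp_abs c"
proof -
  define \<delta> where "\<delta> c = modulus (elem_mat k (axis k c) :: 'k^'n^'n)" for c
  have inv: "invertible (elem_mat k (axis k c) :: 'k^'n^'n)" if "c \<noteq> 0" for c
    using that by (simp add: invertible_elem_mat axis_def)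
  have mult: "\<delta> (c * d) = \<delta> c * \<delta> d" if "c \<noteq> 0" "d \<noteq> 0" for c d
  proof -
    have "(elem_mat k (axis k (c * d)) :: 'k^'n^'n) = elem_mat k (axis k c) ** elem_mat k (axis k d)"
      unfolding elem_mult by (rule arg_cong[of _ _ "elem_mat k"]) (simp add: vec_eq_iff axis_def)
    then show ?thesis using that inv by (simp add: \<delta>_def modulus_mult)
  qed
  have one: "\<delta> 1 = 1" by (simp add: \<delta>_def elem_one modulus_one)
  have pow: "\<delta> (c ^ n) = \<delta> c ^ n" if "c \<noteq> 0" for c n
    using that by (induction n) (simp_all add: one mult)
  have inverse: "\<delta> (inverse c) = inverse (\<delta> c)" if "c \<noteq> 0" for c
    using that mult[of c "inverse c"] one by (simp add: inverse_unique[symmetric])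
  have pos: "0 < \<delta> c" if "c \<noteq> 0" for c
    using that mult[of c "inverse c"] one modulus_nonneg unfolding \<delta>_def
    by (metis less_eq_real_def mult_zero_left nonzero_imp_inverse_nonzero right_inverse zero_neq_one)
  have mono: "\<delta> c \<le> \<delta> d" if "c \<noteq> 0" "d \<noteq> 0" "Qp_abs c \<le> Qp_abs d" for c d
    unfolding \<delta>_def using that by (intro modulus_mono) (auto simp: diag_image_cube)
  have \<theta>: "\<delta> (inverse (\<theta> ^ m)) = Qp_abs (inverse (\<theta> ^ m))" for m
    by (simp only: inverse[OF power_not_zero[OF theta_nonzero]] pow[OF theta_nonzero]
        v_inverse[OF UNIV_I] v_power[OF UNIV_I] \<delta>_def[of \<theta>] modulus_diag_theta)
  have bounded: "x \<le> 1" if "\<And>n. x ^ n \<le> b" for x b :: real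
    using that real_arch_pow[of x b] by (meson not_le)
  have ge1: "\<delta> c = Qp_abs c" if c: "1 \<le> Qp_abs c" for c
  proof -
    have c0: "c \<noteq> 0" "0 < Qp_abs c" using c by auto
    have dpos: "0 < \<delta> c" using pos c0 by blast
    have bounds: "\<delta> c ^ n \<le> Qp_abs c ^ n / Qp_abs \<theta>" "Qp_abs c ^ n * Qp_abs \<theta> \<le> \<delta> c ^ n" for n
    proof -
      obtain m where m: "Qp_abs c ^ n \<le> Qp_abs (inverse (\<theta> ^ m))"
          "Qp_abs (inverse (\<theta> ^ m)) \<le> Qp_abs c ^ n / Qp_abs \<theta>"
        using theta_power_approx[of "Qp_abs c ^ n"] c by auto
      have nz: "inverse (\<theta> ^ m) \<noteq> 0" "c ^ n \<noteq> 0" using theta_nonzero c0 by simp_all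
      have "\<delta> (c ^ n) \<le> \<delta> (inverse (\<theta> ^ m))"
        using m(1) by (intro mono[OF nz(2,1)]) (simp only: v_power[OF UNIV_I])
      then show "\<delta> c ^ n \<le> Qp_abs c ^ n / Qp_abs \<theta>"
        using m(2) unfolding \<theta> pow[OF c0(1)] by (rule order_trans)
      have "Qp_abs (inverse (\<theta> ^ m) * \<theta>) \<le> Qp_abs (c ^ n)"
        unfolding v_mult[OF UNIV_I UNIV_I] v_power[OF UNIV_I, of c]
        using m(2) theta_pos by (simp only: pos_le_divide_eq)
      then have "\<delta> (inverse (\<theta> ^ m) * \<theta>) \<le> \<delta> (c ^ n)"
        using nz theta_nonzero by (intro mono) simp_all
      then have "Qp_abs (inverse (\<theta> ^ m)) * Qp_abs \<theta> \<le> \<delta> c ^ n"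
        using modulus_diag_theta[of k]
        by (simp only: mult[OF nz(1) theta_nonzero] \<theta> pow[OF c0(1)] \<delta>_def[of \<theta>])
      then show "Qp_abs c ^ n * Qp_abs \<theta> \<le> \<delta> c ^ n"
        using mult_right_mono[OF m(1) less_imp_le[OF theta_pos]] by linarith
    qed
    have "\<delta> c / Qp_abs c \<le> 1"
    proof (rule bounded)
      fix n show "(\<delta> c / Qp_abs c) ^ n \<le> 1 / Qp_abs \<theta>"
        using bounds(1)[of n] c0(2) by (simp add: power_divide pos_divide_le_eq)
    qed
    moreover have "Qp_abs c / \<delta> c \<le> 1"
    proof (rule bounded)
      fix n show "(Qp_abs c / \<delta> c) ^ n \<le> 1 / Qp_abs \<theta>"
        using bounds(2)[of n] dpos theta_pos by (simp add: power_divide divide_le_eq pos_le_divide_eq)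
    qed
    ultimately show ?thesis using dpos c0(2) by simp
  qed
  have "\<delta> c = Qp_abs c"
  proof (cases "1 \<le> Qp_abs c")
    case False
    have "1 \<le> Qp_abs (inverse c)"
      using False v_pos[of c] c unfolding v_inverse[OF UNIV_I] by (simp add: one_le_inverse)
    then have "\<delta> (inverse c) = inverse (Qp_abs c)" using ge1 v_inverse by auto
    then show ?thesis using inverse[OF c] by (simp only: inverse_eq_iff_eq)
  qed (rule ge1)
  then show ?thesis by (simp add: \<delta>_def)
qed

theorem modulus_eq_det:
  assumes "invertible A"
  shows "modulus A = Qp_abs (det A)"
  using assms
proof (induction A rule: invertible_elementary_induct)
  case one
  show ?case by (simp add: modulus_one)
next
  case (elem k y A)
  define t where "t = (\<chi> i. if i = k then 1 else y $ i / y $ k)"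
  have "elem_mat k y = elem_mat k t ** elem_mat k (axis k (y $ k))"
    unfolding elem_mult using elem.hyps
    by (intro arg_cong[of _ _ "elem_mat k"]) (simp add: vec_eq_iff axis_def t_def)
  then have "modulus (elem_mat k y) = modulus (elem_mat k t) * modulus (elem_mat k (axis k (y $ k)))"
    using elem.hyps by (simp add: modulus_mult invertible_elem_mat t_def axis_def)
  also have "\<dots> = Qp_abs (y $ k)"
    using elem.hyps by (simp add: modulus_transvection modulus_diag t_def)
  finally show ?case
    using elem by (simp add: modulus_mult invertible_elem_mat det_mul det_elem_mat v_mult)
qed

corollary measure_linear_image:
  assumes "det (A :: 'k^'n^'n) \<noteq> 0" "S \<in> sets borel"
  shows "measure M ((*v) A ` S) = Qp_abs (det A) * measure M S"
  using assms by (simp add: measure_matrix_image modulus_eq_det invertible_det_nz)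

end

section \<open>Finite extensions containing given algebraic elements\<close>

interpretation ac: vector_space "\<lambda>(c :: 'k::field) x. to_ac c * x"
  by unfold_locales (simp_all add: algebra_simps)

text \<open>With scalars acting through the embedding into the algebraic closure, a finite extension is a subfield
  that is the span of a finite set, and span induction becomes available.\<close>

lemma finite_extension_iff_span:
  "finite_extension (K :: 'k::field alg_closure set) \<longleftrightarrow>
     range to_ac \<subseteq> K \<and> (\<forall>x\<in>K. \<forall>y\<in>K. x + y \<in> K \<and> x * y \<in> K) \<and>
     (\<forall>x\<in>K. - x \<in> K \<and> inverse x \<in> K) \<and> (\<exists>B. finite B \<and> K = ac.span B)"
proof -
  have "{(\<Sum>b\<in>B. to_ac (c b) * b) |c. True} = ac.span B" if "finite B" for B :: "'k alg_closure set"
    using that by (auto simp: ac.span_finite)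
  then have "(\<exists>B. finite B \<and> K = {(\<Sum>b\<in>B. to_ac (c b) * b) |c. True})
      \<longleftrightarrow> (\<exists>B. finite B \<and> K = ac.span B)"
    by (intro iff_exI conj_cong refl) (simp only:)
  then show ?thesis unfolding finite_extension_def by (simp only:)
qed

lemma finite_extension_base: "finite_extension (range to_ac :: 'k::field alg_closure set)"
  unfolding finite_extension_def
proof (intro conjI ballI)
  fix x y :: "'k alg_closure" assume "x \<in> range to_ac" "y \<in> range to_ac"
  then show "x + y \<in> range to_ac" "x * y \<in> range to_ac"
    by (auto simp flip: to_ac_add to_ac_mult)
next
  fix x :: "'k alg_closure" assume "x \<in> range to_ac"
  then show "- x \<in> range to_ac" "inverse x \<in> range to_ac"
    by (auto simp flip: to_ac_minus to_ac_inverse)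
next
  show "\<exists>B. finite B \<and> range to_ac = {(\<Sum>b\<in>B. to_ac (c b :: 'k) * b) |c. True}"
  proof (rule exI[of _ "{1 :: 'k alg_closure}"], intro conjI equalityI subsetI)
    fix x :: "'k alg_closure" assume "x \<in> range to_ac"
    then obtain a where "x = to_ac a" by blast
    then have "x = (\<Sum>b\<in>{1}. to_ac ((\<lambda>_. a) b) * b)" by simp
    then show "x \<in> {(\<Sum>b\<in>{1}. to_ac (c b :: 'k) * b) |c. True}"
      by (intro CollectI exI[of _ "\<lambda>_. a"] conjI TrueI)
  qed auto
qed auto

text \<open>Dividing an annihilating polynomial by the largest power of the variable makes its constant term nonzero.
  Such an equation expresses the inverse of \<open>y\<close> as a polynomial in \<open>y\<close>.\<close>

lemma alg_closure_algebraic_unit: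
  fixes y :: "'k::field alg_closure"
  assumes "y \<noteq> 0"
  obtains a s where "a \<noteq> 0" "to_ac a + y * poly (map_poly to_ac s) y = 0"
proof -
  obtain q :: "'k poly" where q: "q \<noteq> 0" "poly (map_poly to_ac q) y = 0"
    by (rule alg_closure_algebraic)
  then have "\<exists>a s. a \<noteq> 0 \<and> to_ac a + y * poly (map_poly to_ac s) y = 0"
  proof (induction q)
    case (pCons a s)
    have eq: "to_ac a + y * poly (map_poly to_ac s) y = 0"
      using pCons.prems by (simp add: map_poly_pCons)
    show ?case
    proof (cases "a = 0")
      case True
      then show ?thesis using pCons eq assms by simp
    qed (use eq in blast)
  qed simp
  then show thesis using that by blast
qed

text \<open>If \<open>x\<close> is a root of a polynomial of degree \<open>d\<close> and \<open>B\<close> spans \<open>K\<close>, then the products of elements of \<open>B\<close> with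
  \<open>1, x, \<dots>, x ^ (d - 1)\<close> span a ring, because \<open>x ^ d\<close> reduces to lower powers. It is a field since all its
  elements are algebraic.\<close>

lemma finite_extension_adjoin:
  fixes x :: "'k::field alg_closure"
  assumes K: "finite_extension K"
  obtains K' where "finite_extension K'" "K \<subseteq> K'" "x \<in> K'"
proof -
  obtain B where B: "finite B" "K = ac.span B" using K by (auto simp: finite_extension_iff_span)
  have base: "to_ac c \<in> K" for c using K by (auto simp: finite_extension_def)
  have mult: "a * b \<in> K" if "a \<in> K" "b \<in> K" for a b using K that by (auto simp: finite_extension_def)
  obtain q :: "'k poly" where q: "q \<noteq> 0" "poly (map_poly to_ac q) x = 0"
    by (rule alg_closure_algebraic)
  define d where "d = Polynomial.degree q"
  have d: "0 < d"
  proof (rule ccontr)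
    assume "\<not> 0 < d"
    then obtain a where "q = [:a:]" using degree_eq_zeroE[of q] by (auto simp: d_def)
    then show False using q by (simp add: map_poly_pCons)
  qed
  define c where "c i = - Polynomial.coeff q i / Polynomial.coeff q d" for i
  have xd: "x ^ d = (\<Sum>i<d. to_ac (c i) * x ^ i)"
  proof -
    have dm: "Polynomial.degree (map_poly to_ac q) = d" unfolding d_def by (rule degree_map_poly) simp
    have l: "Polynomial.coeff q d \<noteq> 0" using q by (simp add: d_def)
    have "0 = (\<Sum>i\<le>d. to_ac (Polynomial.coeff q i) * x ^ i)"
      using q(2) by (simp add: poly_altdef dm coeff_map_poly)
    also have "\<dots> = to_ac (Polynomial.coeff q d) * x ^ d + (\<Sum>i<d. to_ac (Polynomial.coeff q i) * x ^ i)"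
      by (simp add: lessThan_Suc_atMost[symmetric] add.commute)
    finally have "to_ac (Polynomial.coeff q d) * x ^ d = (\<Sum>i<d. - to_ac (Polynomial.coeff q i) * x ^ i)"
      by (simp add: sum_negf eq_neg_iff_add_eq_0)
    also have "\<dots> = to_ac (Polynomial.coeff q d) * (\<Sum>i<d. to_ac (c i) * x ^ i)"
      using l by (simp add: c_def sum_distrib_left)
    finally show ?thesis using l by simp
  qed
  define B' where "B' = (\<lambda>(b, i). b * x ^ i) ` (B \<times> {..<d})"
  define K' where "K' = ac.span B'"
  have B': "b * x ^ i \<in> K'" if "b \<in> B" "i < d" for b i
    unfolding K'_def B'_def using that by (intro ac.span_base) force
  have K'_add: "a + b \<in> K'" if "a \<in> K'" "b \<in> K'" for a b
    using that ac.span_add unfolding K'_def by blast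
  have K'_scale: "to_ac a * b \<in> K'" if "b \<in> K'" for a b
    using that ac.span_scale unfolding K'_def by blast
  have K'_0: "0 \<in> K'" unfolding K'_def by (rule ac.span_zero)
  have induct: "Q z" if "z \<in> K'" "Q 0"
      "\<And>a b i y. b \<in> B \<Longrightarrow> i < d \<Longrightarrow> Q y \<Longrightarrow> Q (to_ac a * (b * x ^ i) + y)" for Q z
    using that(1) unfolding K'_def
  proof (induction rule: ac.span_induct_alt)
    case (step c b y)
    then obtain b' i where "b = b' * x ^ i" "b' \<in> B" "i < d" unfolding B'_def by auto
    with step that(3) show ?case by blast
  qed (rule that(2))
  have low: "y * x ^ i \<in> K'" if "y \<in> K" "i < d" for y i
    using that(1) unfolding B(2)
  proof (induction rule: ac.span_induct_alt)
    case (step c b y)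
    have "b * x ^ i \<in> K'" using step(1) that(2) by (rule B')
    then have "to_ac c * (b * x ^ i) + y * x ^ i \<in> K'"
      using K'_add[OF K'_scale] step by blast
    then show ?case by (simp add: algebra_simps)
  qed (simp add: K'_0)
  have mulx: "x * z \<in> K'" if "z \<in> K'" for z
    using that
  proof (rule induct)
    fix a b i y assume b: "b \<in> B" "i < d" "x * y \<in> K'"
    have "x * (b * x ^ i) \<in> K'"
    proof (cases "Suc i < d")
      case True
      then show ?thesis using B'[OF b(1) True] by (simp add: algebra_simps)
    next
      case False
      then have "Suc i = d" using b by simp
      then have "x * (b * x ^ i) = b * x ^ d" by (simp add: algebra_simps flip: power_Suc)
      also have "\<dots> = (\<Sum>i<d. to_ac (c i) * (b * x ^ i))"
        by (simp add: xd sum_distrib_left algebra_simps)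
      also have "\<dots> \<in> K'"
        unfolding K'_def by (intro ac.span_sum ac.span_scale) (use B' b in \<open>auto simp: K'_def\<close>)
      finally show ?thesis .
    qed
    then have "to_ac a * (x * (b * x ^ i)) + x * y \<in> K'" using b by (intro K'_add K'_scale)
    then show "x * (to_ac a * (b * x ^ i) + y) \<in> K'" by (simp add: algebra_simps)
  qed (simp add: K'_0)
  have mulK: "y * z \<in> K'" if y: "y \<in> K" and "z \<in> K'" for y z
    using that(2)
  proof (rule induct)
    fix a b i w assume b: "b \<in> B" "i < d" "y * w \<in> K'"
    have "y * b \<in> K" using y b B ac.span_base by (intro mult) auto
    then have "to_ac a * ((y * b) * x ^ i) + y * w \<in> K'" using b low by (intro K'_add K'_scale) auto
    then show "y * (to_ac a * (b * x ^ i) + w) \<in> K'" by (simp add: algebra_simps)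
  qed (simp add: K'_0)
  have mulpow: "x ^ i * z \<in> K'" if "z \<in> K'" for i z
    using that by (induction i) (auto simp: mult.assoc mulx)
  have K'_mult: "w * z \<in> K'" if "w \<in> K'" "z \<in> K'" for w z
    using that(1)
  proof (rule induct)
    fix a b i y assume b: "b \<in> B" "i < d" "y * z \<in> K'"
    have "b \<in> K" using b B ac.span_base by auto
    then have "b * (x ^ i * z) \<in> K'" by (intro mulK mulpow that(2))
    then have "to_ac a * (b * (x ^ i * z)) + y * z \<in> K'"
      using b by (intro K'_add K'_scale)
    then show "(to_ac a * (b * x ^ i) + y) * z \<in> K'" by (simp add: algebra_simps)
  qed (simp add: K'_0)
  have sub: "K \<subseteq> K'" using low[of _ 0] d by auto
  have x: "x \<in> K'" using mulx[of 1] sub base[of 1] by auto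
  have K'_neg: "- y \<in> K'" if "y \<in> K'" for y
    using K'_scale[OF that, of "-1"] by simp
  have K'_poly: "poly (map_poly to_ac s) y \<in> K'" if "y \<in> K'" for s y
  proof (induction s)
    case (pCons a s)
    have "to_ac a \<in> K'" using sub base by blast
    then show ?case using pCons that by (simp add: map_poly_pCons K'_add K'_mult)
  qed (simp add: K'_0)
  have K'_inv: "inverse y \<in> K'" if y: "y \<in> K'" for y
  proof (cases "y = 0")
    case False
    then obtain a s where as: "a \<noteq> 0" "to_ac a + y * poly (map_poly to_ac s) y = 0"
      by (rule alg_closure_algebraic_unit)
    then have "y * poly (map_poly to_ac s) y = - to_ac a" by (simp add: eq_neg_iff_add_eq_0 add.commute)
    then have "y * (to_ac (- 1 / a) * poly (map_poly to_ac s) y) = 1"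
      using as(1) by (simp add: mult.left_commute)
    then have "inverse y = to_ac (- 1 / a) * poly (map_poly to_ac s) y" by (rule inverse_unique)
    then show ?thesis using K'_scale[OF K'_poly[OF y], of "- 1 / a" s] by (simp only:)
  qed (simp add: K'_0)
  have "finite_extension K'"
    unfolding finite_extension_iff_span
  proof (intro conjI ballI exI[of _ B'])
    show "range to_ac \<subseteq> K'" using sub base by blast
    show "finite B'" using B(1) by (simp add: B'_def)
    show "K' = ac.span B'" by (rule K'_def)
  qed (rule K'_add K'_mult K'_neg K'_inv; assumption)+
  then show thesis using sub x that by blast
qed

lemma finite_extension_exists:
  fixes S :: "'k::field alg_closure set"
  assumes "finite S"
  shows "\<exists>K. finite_extension K \<and> S \<subseteq> K"
  using assms
proof (induction S)
  case empty
  then show ?case using finite_extension_base by blast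
next
  case (insert x S)
  then obtain K where K: "finite_extension K" "S \<subseteq> K" by blast
  obtain K' where "finite_extension K'" "K \<subseteq> K'" "x \<in> K'"
    using K(1) by (rule finite_extension_adjoin)
  with K show ?case by blast
qed

section \<open>Characteristic polynomials and kernels over a subfield\<close>

lemma det_hom:
  fixes h :: "'a::comm_ring_1 \<Rightarrow> 'b::comm_ring_1" and A :: "'a^'n^'n"
  assumes zero: "h 0 = 0" and one: "h 1 = 1" and add: "\<And>x y. h (x + y) = h x + h y"
    and mult: "\<And>x y. h (x * y) = h x * h y"
  shows "h (det A) = det (\<chi> i j. h (A $ i $ j))"
proof -
  have sum: "h (sum g S) = (\<Sum>x\<in>S. h (g x))" for g :: "'c \<Rightarrow> 'a" and S
    by (induction S rule: infinite_finite_induct) (simp_all add: zero add)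
  have prod: "h (prod g S) = (\<Prod>x\<in>S. h (g x))" for g :: "'c \<Rightarrow> 'a" and S
    by (induction S rule: infinite_finite_induct) (simp_all add: one mult)
  have "h (- 1) + h 1 = 0" using add[of "-1" 1] zero by simp
  then have "h (- 1) = - 1" by (simp add: one eq_neg_iff_add_eq_0)
  then have sign: "h (of_int (sign p)) = of_int (sign p)" for p :: "'n \<Rightarrow> 'n"
    by (cases p rule: sign_cases) (simp_all add: one)
  show ?thesis unfolding det_def by (simp add: sum prod mult sign)
qed

text \<open>The matrix \<open>A\<close> with the rows and columns of the indices \<open>f 0, \<dots>, f (l - 1)\<close> replaced by those of the
  identity. An enumeration \<open>f\<close> stands in for an order on the index type.\<close>

definition trunc_mat :: "(nat \<Rightarrow> 'n) \<Rightarrow> nat \<Rightarrow> 'a::comm_ring_1^'n^'n \<Rightarrow> 'a^'n^'n" where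
  "trunc_mat f l A = (\<chi> i j. if i \<in> f ` {..<l} \<or> j \<in> f ` {..<l} then (if i = j then 1 else 0) else A $ i $ j)"

text \<open>In the Leibniz formula, a permutation contributes only if it fixes \<open>f 0, \<dots>, f (l - 1)\<close>: in the column of the
  first of these indices that it moves, it picks an entry below the diagonal.\<close>

lemma det_partial_triangular:
  fixes A :: "'a::comm_ring_1^'n^'n"
  assumes f: "bij_betw f {..<CARD('n)} UNIV" and l: "l \<le> CARD('n)"
    and zero: "\<And>s r. s < l \<Longrightarrow> s < r \<Longrightarrow> r < CARD('n) \<Longrightarrow> A $ f r $ f s = 0"
  shows "det A = (\<Prod>s<l. A $ f s $ f s) * det (trunc_mat f l A)"
proof -
  have inj: "inj_on f {..<l}" using f l by (auto simp: bij_betw_def intro: inj_on_subset)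
  have "(\<Prod>i\<in>UNIV. A $ i $ p i) = (\<Prod>s<l. A $ f s $ f s) * (\<Prod>i\<in>UNIV. trunc_mat f l A $ i $ p i)"
    if p: "p permutes UNIV" for p
  proof (cases "\<forall>s<l. p (f s) = f s")
    case True
    let ?S = "f ` {..<l}"
    have split: "(\<Prod>i\<in>UNIV. g i) = (\<Prod>s<l. g (f s)) * (\<Prod>i\<in>-?S. g i)" for g :: "'n \<Rightarrow> 'a"
    proof -
      have "(\<Prod>i\<in>UNIV. g i) = (\<Prod>i\<in>?S. g i) * (\<Prod>i\<in>-?S. g i)"
        using prod.union_disjoint[of ?S "-?S" g] by (simp add: Compl_partition)
      then show ?thesis by (simp add: prod.reindex[OF inj])
    qed
    have "p i \<notin> ?S" if i: "i \<notin> ?S" for i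
    proof
      assume "p i \<in> ?S"
      then obtain s where s: "s < l" "p i = f s" by blast
      then have "p i = p (f s)" using True by simp
      then have "i = f s" using permutes_inj[OF p] by (simp add: inj_eq)
      with i s show False by blast
    qed
    then have "(\<Prod>i\<in>-?S. trunc_mat f l A $ i $ p i) = (\<Prod>i\<in>-?S. A $ i $ p i)"
      by (intro prod.cong) (auto simp: trunc_mat_def)
    moreover have "(\<Prod>s<l. trunc_mat f l A $ f s $ p (f s)) = 1"
      using True by (intro prod.neutral) (auto simp: trunc_mat_def)
    moreover have "(\<Prod>s<l. A $ f s $ p (f s)) = (\<Prod>s<l. A $ f s $ f s)"
      using True by (intro prod.cong) auto
    ultimately show ?thesis by (simp add: split)
  next
    case False
    define s where "s = (LEAST s. s < l \<and> p (f s) \<noteq> f s)"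
    have s: "s < l" "p (f s) \<noteq> f s"
      using LeastI_ex[of "\<lambda>s. s < l \<and> p (f s) \<noteq> f s"] False unfolding s_def by blast+
    have least: "p (f t) = f t" if "t < s" for t
      using not_less_Least[of t "\<lambda>s. s < l \<and> p (f s) \<noteq> f s"] that s unfolding s_def by auto
    obtain i where i: "p i = f s" using permutes_surj[OF p] by (metis surjD)
    obtain r where r: "r < CARD('n)" "i = f r" using f by (auto simp: bij_betw_def)
    have "r \<noteq> s" using s i r by auto
    moreover have "\<not> r < s"
    proof
      assume "r < s"
      then have "f r = f s" using least[of r] i r by simp
      then show False using \<open>r < s\<close> s l r f by (auto simp: bij_betw_def dest: inj_onD)
    qed
    ultimately have "s < r" by simp
    then have "A $ i $ p i = 0" using zero s r i by simp
    moreover have "trunc_mat f l A $ i $ p i = 0"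
      using s i by (auto simp: trunc_mat_def)
    ultimately have "(\<Prod>i\<in>UNIV. A $ i $ p i) = 0" "(\<Prod>i\<in>UNIV. trunc_mat f l A $ i $ p i) = 0"
      by (auto intro!: prod_zero)
    then show ?thesis by simp
  qed
  then show ?thesis
    unfolding det_def by (simp add: sum_distrib_left mult.left_commute)
qed

lemma det_triangular:
  fixes A :: "'a::comm_ring_1^'n^'n"
  assumes f: "bij_betw f {..<CARD('n)} UNIV"
    and zero: "\<And>s r. s < r \<Longrightarrow> r < CARD('n) \<Longrightarrow> A $ f r $ f s = 0"
  shows "det A = (\<Prod>s<CARD('n). A $ f s $ f s)"
proof -
  have "f ` {..<CARD('n)} = UNIV" using f by (simp add: bij_betw_def)
  then have "trunc_mat f CARD('n) A = mat 1" by (auto simp: trunc_mat_def mat_def vec_eq_iff)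
  then show ?thesis using det_partial_triangular[OF f order_refl, of A] zero by simp
qed

lemma poly_charpoly: "poly (charpoly A) x = det (mat x - A)"
proof -
  have "poly (charpoly A) x =
      det (\<chi> i j. poly ((\<chi> i j. (if i = j then [:0, 1:] else 0) - [:A $ i $ j:]) $ i $ j) x)"
    unfolding charpoly_def by (rule det_hom) simp_all
  also have "\<dots> = det (mat x - A)"
    by (rule arg_cong[of _ _ det]) (simp add: vec_eq_iff mat_def)
  finally show ?thesis .
qed

lemma mat_vec: "mat c *v x = c *s x" for x :: "'a::comm_semiring_1^'n"
  by (simp add: vec_eq_iff matrix_vector_mult_def mat_def if_distrib[of "\<lambda>a. a * _"] cong: if_cong)

lemma charpoly_similar:
  fixes A P Q :: "'a::field_char_0^'n^'n"
  assumes "P ** Q = mat 1" "Q ** P = mat 1"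
  shows "charpoly (Q ** A ** P) = charpoly A"
proof (rule poly_ext)
  fix x
  have "Q *v (P *v y) = y" for y using assms by (simp add: matrix_vector_mul_assoc)
  then have "mat x - Q ** A ** P = Q ** (mat x - A) ** P"
    by (simp add: matrix_eq mat_vec matrix_vector_mult_diff_rdistrib matrix_vector_mult_diff_distrib
        vec.scale flip: matrix_vector_mul_assoc)
  then have "det (mat x - Q ** A ** P) = det (Q ** P) * det (mat x - A)"
    by (simp add: det_mul mult.commute mult.left_commute)
  then show "poly (charpoly (Q ** A ** P)) x = poly (charpoly A) x"
    using assms by (simp add: poly_charpoly)
qed

lemma degree_prod_le_sum: "Polynomial.degree (\<Prod>i\<in>S. g i) \<le> (\<Sum>i\<in>S. Polynomial.degree (g i))"
  for g :: "'b \<Rightarrow> 'a::comm_ring_1 poly"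
  by (cases "finite S") (auto intro: degree_prod_sum_le[unfolded o_def])

text \<open>The identity permutation contributes a monic polynomial of full degree. Any other permutation meets a
  constant entry, so its contribution has smaller degree.\<close>

lemma charpoly_monic:
  fixes A :: "'a::field^'n^'n"
  shows "Polynomial.degree (charpoly A) = CARD('n)" and "Polynomial.coeff (charpoly A) CARD('n) = 1"
proof -
  define W where "W = (\<chi> i j. (if i = j then [:0, 1:] else 0) - [:A $ i $ j:])"
  define g where "g = (\<Prod>i\<in>UNIV. [:- A $ i $ i, 1:])"
  define r where "r = (\<Sum>p | p permutes (UNIV :: 'n set) \<and> p \<noteq> id. of_int (sign p) * (\<Prod>i\<in>UNIV. W $ i $ p i))"
  have W: "Polynomial.degree (W $ i $ j) \<le> (if i = j then 1 else 0)" for i j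
    by (simp add: W_def)
  have "charpoly A = (\<Sum>p | p permutes (UNIV :: 'n set). of_int (sign p) * (\<Prod>i\<in>UNIV. W $ i $ p i))"
    by (simp add: charpoly_def det_def W_def)
  also have "\<dots> = of_int (sign (id :: 'n \<Rightarrow> 'n)) * (\<Prod>i\<in>UNIV. W $ i $ id i) + r"
  proof -
    have "{p. p permutes (UNIV :: 'n set)} - {id} = {p. p permutes (UNIV :: 'n set) \<and> p \<noteq> id}" by auto
    then show ?thesis unfolding r_def by (subst sum.remove[of _ id]) (simp_all add: permutes_id)
  qed
  also have "of_int (sign (id :: 'n \<Rightarrow> 'n)) * (\<Prod>i\<in>UNIV. W $ i $ id i) = g"
    by (simp add: g_def W_def)
  finally have eq: "charpoly A = g + r" .
  have g: "Polynomial.degree g = CARD('n)" "Polynomial.coeff g CARD('n) = 1"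
  proof -
    show *: "Polynomial.degree g = CARD('n)" unfolding g_def by (simp add: degree_prod_eq_sum_degree)
    show "Polynomial.coeff g CARD('n) = 1"
      using lead_coeff_prod[of "\<lambda>i. [:- A $ i $ i, 1:]" UNIV] unfolding g_def[symmetric] * by simp
  qed
  have "Polynomial.degree r < CARD('n)"
    unfolding r_def
  proof (rule degree_sum_less)
    fix p :: "'n \<Rightarrow> 'n" assume p: "p \<in> {p. p permutes UNIV \<and> p \<noteq> id}"
    then obtain k where k: "p k \<noteq> k" by (auto simp: fun_eq_iff)
    have "Polynomial.degree (of_int (sign p) * (\<Prod>i\<in>UNIV. W $ i $ p i)) \<le> Polynomial.degree (\<Prod>i\<in>UNIV. W $ i $ p i)"
      by (cases p rule: sign_cases) simp_all
    also have "\<dots> \<le> (\<Sum>i\<in>UNIV. Polynomial.degree (W $ i $ p i))" by (rule degree_prod_le_sum)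
    also have "\<dots> \<le> (\<Sum>i\<in>UNIV. if i = k then 0 else 1)"
    proof (rule sum_mono)
      fix i show "Polynomial.degree (W $ i $ p i) \<le> (if i = k then 0 else 1)"
        using W[of i "p i"] k by (auto split: if_splits)
    qed
    also have "\<dots> < (\<Sum>i\<in>(UNIV :: 'n set). 1)"
      by (rule sum_strict_mono_ex1) (auto intro: exI[of _ k])
    finally show "Polynomial.degree (of_int (sign p) * (\<Prod>i\<in>UNIV. W $ i $ p i)) < CARD('n)" by simp
  qed simp
  then show "Polynomial.degree (charpoly A) = CARD('n)" "Polynomial.coeff (charpoly A) CARD('n) = 1"
    unfolding eq using g by (simp_all add: degree_add_eq_left coeff_eq_0)
qed

context valued_subfield
begin

lemma matrix_mult_closed:
  fixes A :: "'a^'m^'n" and B :: "'a^'l^'m"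
  assumes "\<And>i j. A $ i $ j \<in> K" "\<And>i j. B $ i $ j \<in> K"
  shows "(A ** B) $ i $ j \<in> K"
  by (simp add: matrix_matrix_mult_def) (intro sum_closed mult_closed assms)

lemma matrix_vector_closed:
  fixes A :: "'a^'m^'n"
  assumes "\<And>i j. A $ i $ j \<in> K" "\<And>i. x $ i \<in> K"
  shows "(A *v x) $ i \<in> K"
  by (simp add: matrix_vector_mult_def) (intro sum_closed mult_closed assms)

text \<open>Elimination of one unknown per equation, which stays inside \<open>K\<close>.\<close>

lemma underdetermined_system:
  assumes "finite R" "finite J" "card R < card J" "\<And>r j. a r j \<in> K"
  shows "\<exists>y. (\<forall>j. y j \<in> K) \<and> (\<exists>j\<in>J. y j \<noteq> 0) \<and> (\<forall>r\<in>R. (\<Sum>j\<in>J. a r j * y j) = 0)"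
  using assms
proof (induction R arbitrary: J a)
  case empty
  then have "J \<noteq> {}" by auto
  then show ?case using one_closed by (intro exI[of _ "\<lambda>_. 1"]) auto
next
  case (insert r R)
  show ?case
  proof (cases "\<forall>j\<in>J. a r j = 0")
    case True
    have "card R < card J" using insert by simp
    from insert.IH[OF insert.prems(1) this insert.prems(3)] True show ?thesis by fastforce
  next
    case False
    then obtain k where k: "k \<in> J" "a r k \<noteq> 0" by blast
    define b where "b s j = a s j - a s k / a r k * a r j" for s j
    have "\<exists>y. (\<forall>j. y j \<in> K) \<and> (\<exists>j\<in>J - {k}. y j \<noteq> 0) \<and> (\<forall>s\<in>R. (\<Sum>j\<in>J - {k}. b s j * y j) = 0)"
    proof (rule insert.IH)
      show "b s j \<in> K" for s j
        unfolding b_def using insert.prems by (intro diff_closed mult_closed divide_closed)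
    qed (use insert k in auto)
    then obtain y where y: "\<And>j. y j \<in> K" "\<exists>j\<in>J - {k}. y j \<noteq> 0"
        "\<And>s. s \<in> R \<Longrightarrow> (\<Sum>j\<in>J - {k}. b s j * y j) = 0" by blast
    define u where "u = - (\<Sum>j\<in>J - {k}. a r j * y j) / a r k"
    define z where "z = (\<lambda>j. if j = k then u else y j)"
    have split: "(\<Sum>j\<in>J. a s j * z j) = a s k * u + (\<Sum>j\<in>J - {k}. a s j * y j)" for s
    proof -
      have "(\<Sum>j\<in>J. a s j * z j) = a s k * z k + (\<Sum>j\<in>J - {k}. a s j * z j)"
        using insert.prems k by (intro sum.remove)
      also have "(\<Sum>j\<in>J - {k}. a s j * z j) = (\<Sum>j\<in>J - {k}. a s j * y j)"
        by (intro sum.cong) (auto simp: z_def)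
      finally show ?thesis by (simp add: z_def)
    qed
    have "(\<Sum>j\<in>J. a s j * z j) = 0" if "s \<in> insert r R" for s
    proof (cases "s = r")
      case True
      then show ?thesis using k by (simp add: split u_def)
    next
      case False
      then have "0 = (\<Sum>j\<in>J - {k}. b s j * y j)" using y that by simp
      also have "\<dots> = (\<Sum>j\<in>J - {k}. a s j * y j) - a s k / a r k * (\<Sum>j\<in>J - {k}. a r j * y j)"
        by (simp add: b_def left_diff_distrib sum_subtractf sum_distrib_left mult.assoc)
      also have "\<dots> = (\<Sum>j\<in>J. a s j * z j)" by (simp add: split u_def)
      finally show ?thesis by simp
    qed
    moreover have "z j \<in> K" for j
      unfolding z_def u_def using y insert.prems
      by (auto intro!: divide_closed uminus_closed sum_closed mult_closed)
    moreover have "\<exists>j\<in>J. z j \<noteq> 0" using y(2) by (auto simp: z_def)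
    ultimately show ?thesis by blast
  qed
qed

text \<open>A linear relation between the rows makes one of the equations a consequence of the others. The remaining
  system has more unknowns than equations. The relation itself may have coefficients outside \<open>K\<close>.\<close>

lemma singular_kernel:
  fixes A :: "'a^'n^'n"
  assumes A: "\<And>i j. A $ i $ j \<in> K" and "det A = 0"
  obtains y where "\<And>i. y $ i \<in> K" "y \<noteq> 0" "A *v y = 0"
proof -
  have "\<not> invertible (transpose A)" using assms by (simp add: invertible_det_nz)
  then have "\<exists>z. transpose A *v z = 0 \<and> z \<noteq> 0"
    using matrix_left_invertible_ker[of "transpose A"] invertible_left_inverse[of "transpose A"] by blast
  then obtain z where z: "transpose A *v z = 0" "z \<noteq> 0" by blast
  then obtain r where r: "z $ r \<noteq> 0" by (auto simp: vec_eq_iff)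
  have "\<exists>y. (\<forall>j. y j \<in> K) \<and> (\<exists>j\<in>(UNIV :: 'n set). y j \<noteq> 0) \<and>
      (\<forall>s\<in>UNIV - {r}. (\<Sum>j\<in>UNIV. A $ s $ j * y j) = 0)"
    by (rule underdetermined_system) (auto simp: A card_Diff_singleton card_gt_0_iff)
  then obtain y where y: "\<And>j. y j \<in> K" "\<exists>j. y j \<noteq> 0"
      "\<And>s. s \<noteq> r \<Longrightarrow> (\<Sum>j\<in>UNIV. A $ s $ j * y j) = 0" by auto
  define w where "w = (\<chi> j. y j)"
  have other: "(A *v w) $ s = 0" if "s \<noteq> r" for s
    using y(3)[OF that] by (simp add: w_def matrix_vector_mult_def)
  have "0 = (\<Sum>j\<in>UNIV. (transpose A *v z) $ j * y j)" using z by simp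
  also have "\<dots> = (\<Sum>j\<in>UNIV. \<Sum>s\<in>UNIV. z $ s * (A $ s $ j * y j))"
    by (simp add: matrix_vector_mult_def transpose_def sum_distrib_right sum_distrib_left mult_ac)
  also have "\<dots> = (\<Sum>s\<in>UNIV. z $ s * (A *v w) $ s)"
    by (subst sum.swap) (simp add: matrix_vector_mult_def w_def sum_distrib_left)
  also have "\<dots> = z $ r * (A *v w) $ r"
    by (subst sum.remove[of _ r]) (simp_all add: other)
  finally have "(A *v w) $ r = 0" using r by simp
  with other have "A *v w = 0" by (simp add: vec_eq_iff) (metis)
  moreover have "w \<noteq> 0" using y(2) by (auto simp: w_def vec_eq_iff)
  ultimately show thesis using y(1) that[of w] by (simp add: w_def)
qed

end

section \<open>Triangular form over a subfield\<close>

context valued_subfield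
begin

text \<open>Removing the first \<open>l\<close> linear factors from the characteristic polynomial leaves that of the lower right
  block of \<open>Q ** A ** P\<close>, so the next eigenvalue belongs to this block. An eigenvector \<open>y\<close> of the block over
  \<open>K\<close>, with a nonzero entry at \<open>f k\<close>, replaces the basis vector with that index, and \<open>f\<close> is changed by
  exchanging \<open>l\<close> and \<open>k\<close>.\<close>

lemma triangularization_step:
  fixes A P Q :: "'a^'n^'n"
  assumes A: "\<And>i j. A $ i $ j \<in> K" and es: "set es \<subseteq> K" "length es = CARD('n)"
    and char: "charpoly A = (\<Prod>e\<leftarrow>es. [:- e, 1:])" and l: "l < CARD('n)"
    and f: "bij_betw f {..<CARD('n)} UNIV"
    and PK: "\<And>i j. P $ i $ j \<in> K" and QK: "\<And>i j. Q $ i $ j \<in> K"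
    and PQ: "P ** Q = mat 1" "Q ** P = mat 1"
    and diag: "\<And>s. s < l \<Longrightarrow> (Q ** A ** P) $ f s $ f s = es ! s"
    and zero: "\<And>s r. s < l \<Longrightarrow> s < r \<Longrightarrow> r < CARD('n) \<Longrightarrow> (Q ** A ** P) $ f r $ f s = 0"
  shows "\<exists>f' (P' :: 'a^'n^'n) (Q' :: 'a^'n^'n). bij_betw f' {..<CARD('n)} UNIV \<and>
    (\<forall>i j. P' $ i $ j \<in> K) \<and> (\<forall>i j. Q' $ i $ j \<in> K) \<and> P' ** Q' = mat 1 \<and> Q' ** P' = mat 1 \<and>
    (\<forall>s < Suc l. (Q' ** A ** P') $ f' s $ f' s = es ! s) \<and>
    (\<forall>s r. s < Suc l \<longrightarrow> s < r \<longrightarrow> r < CARD('n) \<longrightarrow> (Q' ** A ** P') $ f' r $ f' s = 0)"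
proof -
  define B where "B = Q ** A ** P"
  define \<mu> where "\<mu> = es ! l"
  define C where "C = trunc_mat f l (mat \<mu> - B)"
  have inj: "f r = f s \<longleftrightarrow> r = s" if "r < CARD('n)" "s < CARD('n)" for r s
    using f that by (auto simp: bij_betw_def dest: inj_onD)
  have surj: "\<exists>r<CARD('n). i = f r" for i using f by (auto simp: bij_betw_def)
  have muK: "\<mu> \<in> K" using es l by (auto simp: \<mu>_def)
  have BK: "B $ i $ j \<in> K" for i j
    unfolding B_def by (intro matrix_mult_closed A PK QK)
  have diagB: "B $ f s $ f s = es ! s" if "s < l" for s using diag that by (simp add: B_def)
  have zeroB: "B $ f r $ f s = 0" if "s < l" "s < r" "r < CARD('n)" for s r
    using zero that by (simp add: B_def)
  have detC: "det C = 0"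
  proof -
    define W :: "'a poly^'n^'n" where "W = (\<chi> i j. (if i = j then [:0, 1:] else 0) - [:B $ i $ j:])"
    define g where "g s = [:- es ! s, 1:]" for s
    have "charpoly B = det W" by (simp add: charpoly_def W_def)
    also have "\<dots> = (\<Prod>s<l. W $ f s $ f s) * det (trunc_mat f l W)"
    proof (rule det_partial_triangular[OF f])
      show "l \<le> CARD('n)" using l by simp
      fix s r assume sr: "s < l" "s < r" "r < CARD('n)"
      then have "f r \<noteq> f s" using inj[of r s] by simp
      then show "W $ f r $ f s = 0" using zeroB[OF sr] by (simp add: W_def)
    qed
    also have "(\<Prod>s<l. W $ f s $ f s) = (\<Prod>s<l. g s)"
      by (intro prod.cong) (auto simp: W_def g_def diagB)
    finally have 1: "charpoly B = (\<Prod>s<l. g s) * det (trunc_mat f l W)" .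
    have "charpoly B = charpoly A" unfolding B_def by (rule charpoly_similar[OF PQ])
    also have "\<dots> = (\<Prod>s<CARD('n). g s)"
      unfolding char g_def es(2)[symmetric] by (simp add: prod.list_conv_set_nth atLeast0LessThan)
    also have "\<dots> = (\<Prod>s<l. g s) * (\<Prod>s=l..<CARD('n). g s)"
      using l prod.atLeastLessThan_concat[of 0 l "CARD('n)" g] by (simp add: atLeast0LessThan)
    finally have "(\<Prod>s<l. g s) * det (trunc_mat f l W) = (\<Prod>s<l. g s) * (\<Prod>s=l..<CARD('n). g s)"
      using 1 by simp
    moreover have "(\<Prod>s<l. g s) \<noteq> 0" by (simp add: g_def)
    ultimately have "det (trunc_mat f l W) = (\<Prod>s=l..<CARD('n). g s)" by simp
    then have "poly (det (trunc_mat f l W)) \<mu> = 0"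
      using l by (auto simp: poly_prod g_def \<mu>_def)
    moreover have "poly (det (trunc_mat f l W)) \<mu> = det (\<chi> i j. poly (trunc_mat f l W $ i $ j) \<mu>)"
      by (rule det_hom) simp_all
    moreover have "(\<chi> i j. poly (trunc_mat f l W $ i $ j) \<mu>) = C"
      by (simp add: C_def trunc_mat_def W_def vec_eq_iff mat_def)
    ultimately show ?thesis by simp
  qed
  have CK: "C $ i $ j \<in> K" for i j
    using BK muK by (auto simp: C_def trunc_mat_def mat_def intro: diff_closed zero_closed one_closed uminus_closed)
  obtain y where yK: "\<And>i. y $ i \<in> K" and y0: "y \<noteq> 0" and Cy: "C *v y = 0"
    using singular_kernel[OF CK detC] by blast
  have low: "y $ f s = 0" if s: "s < l" for s
  proof -
    have "(C *v y) $ f s = (\<Sum>j\<in>UNIV. if f s = j then y $ j else 0)"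
      unfolding matrix_vector_mult_def vec_lambda_beta
      by (rule sum.cong) (use s in \<open>auto simp: C_def trunc_mat_def\<close>)
    then show ?thesis using Cy by simp
  qed
  have eigen: "(B *v y) $ f r = \<mu> * y $ f r" if r: "l \<le> r" "r < CARD('n)" for r
  proof -
    have fr: "f r \<notin> f ` {..<l}" using inj r l by auto
    have "(C *v y) $ f r = (\<Sum>j\<in>UNIV. (mat \<mu> - B) $ f r $ j * y $ j)"
      unfolding matrix_vector_mult_def vec_lambda_beta
      by (rule sum.cong) (use fr low in \<open>auto simp: C_def trunc_mat_def\<close>)
    also have "\<dots> = ((mat \<mu> - B) *v y) $ f r" by (simp add: matrix_vector_mult_def)
    also have "\<dots> = \<mu> * y $ f r - (B *v y) $ f r"
      by (simp add: matrix_vector_mult_diff_rdistrib mat_vec)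
    finally show ?thesis using Cy by simp
  qed
  obtain i where "y $ i \<noteq> 0" using y0 by (auto simp: vec_eq_iff)
  then obtain k where k: "k < CARD('n)" "y $ f k \<noteq> 0" using surj by metis
  then have lk: "l \<le> k" using low[of k] by (meson not_le)
  \<comment> \<open>The index of the pivot moves to position \<open>l\<close> of the enumeration; earlier positions are untouched.\<close>
  define \<tau> where "\<tau> = Transposition.transpose l k"
  have \<tau>: "\<tau> l = k" "\<And>s. s < l \<Longrightarrow> \<tau> s = s" "\<And>r. r < CARD('n) \<Longrightarrow> \<tau> r < CARD('n)"
      "\<And>r. l < r \<Longrightarrow> l \<le> \<tau> r" "\<And>r. l < r \<Longrightarrow> \<tau> r \<noteq> k"
    using lk l k by (auto simp: \<tau>_def Transposition.transpose_def)
  define f' where "f' = f \<circ> \<tau>"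
  have "bij_betw \<tau> {..<CARD('n)} {..<CARD('n)}"
    unfolding \<tau>_def using l k by (intro permutes_imp_bij permutes_swap_id) auto
  then have f': "bij_betw f' {..<CARD('n)} UNIV"
    unfolding f'_def using f by (rule bij_betw_trans)
  define z where "z = elem_inv (f k) y"
  define P' where "P' = P ** elem_mat (f k) y"
  define Q' where "Q' = elem_mat (f k) z ** Q"
  have zK: "z $ i \<in> K" for i
    using yK by (auto simp: z_def elem_inv_def intro: divide_closed uminus_closed one_closed)
  have elemK: "elem_mat c x $ i $ j \<in> K" if "\<And>i. x $ i \<in> K" for c x i j
    using that by (auto simp: elem_mat_def zero_closed one_closed)
  have EE: "elem_mat (f k) y ** elem_mat (f k) z = mat 1" "elem_mat (f k) z ** elem_mat (f k) y = mat 1"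
    using elem_inverse[of y "f k"] k(2) matrix_left_right_inverse unfolding z_def by blast+
  have "P' ** Q' = P ** (elem_mat (f k) y ** elem_mat (f k) z) ** Q"
    by (simp only: P'_def Q'_def matrix_mul_assoc)
  then have PQ1: "P' ** Q' = mat 1" by (simp add: EE PQ)
  then have PQ2: "Q' ** P' = mat 1" using matrix_left_right_inverse by blast
  have P'K: "P' $ i $ j \<in> K" for i j
    unfolding P'_def by (intro matrix_mult_closed PK elemK yK)
  have Q'K: "Q' $ i $ j \<in> K" for i j
    unfolding Q'_def by (intro matrix_mult_closed QK elemK zK)
  define B' where "B' = Q' ** A ** P'"
  have B': "B' = elem_mat (f k) z ** B ** elem_mat (f k) y"
    by (simp only: B'_def Q'_def P'_def B_def matrix_mul_assoc)
  have col: "M $ i $ j = (M *v axis j 1) $ i" for M :: "'a^'n^'n" and i j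
    by (simp add: matrix_vector_mult_def axis_def if_distrib cong: if_cong)
  have B'col: "B' $ i $ j = (elem_mat (f k) z *v (B *v (elem_mat (f k) y *v axis j 1))) $ i" for i j
    by (subst col) (simp only: B' matrix_vector_mul_assoc matrix_mul_assoc)
  have old: "B' $ i $ f s = B $ i $ f s" if s: "s < l" for i s
  proof -
    have sk: "s < k" using s lk by simp
    then have "f s \<noteq> f k" using inj[of s k] k by simp
    then have e: "elem_mat (f k) y *v axis (f s) 1 = axis (f s) 1" by (rule elem_fixes_axis)
    have "(B *v axis (f s) 1) $ f k = 0"
      using zeroB[OF s sk k(1)] by (simp add: col[of B "f k" "f s", symmetric])
    then show ?thesis
      unfolding B'col e by (simp add: elem_vec col[of B, symmetric])
  qed
  have new: "B' $ f r $ f k = (if r = k then \<mu> else 0)" if r: "l \<le> r" "r < CARD('n)" for r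
  proof -
    have "elem_mat (f k) y *v axis (f k) 1 = y" by (auto simp: elem_vec vec_eq_iff axis_def)
    moreover have "f r = f k \<longleftrightarrow> r = k" using inj r k by blast
    ultimately show ?thesis
      unfolding B'col using eigen[OF r] eigen[OF lk k(1)] k(2)
      by (simp add: elem_vec z_def elem_inv_def)
  qed
  have "B' $ f' s $ f' s = es ! s" if "s < Suc l" for s
  proof (cases "s = l")
    case True
    then show ?thesis using new[OF lk k(1)] by (simp add: f'_def \<tau> \<mu>_def)
  next
    case False
    then show ?thesis using that by (simp add: f'_def \<tau> old diagB)
  qed
  moreover have "B' $ f' r $ f' s = 0" if s: "s < Suc l" "s < r" "r < CARD('n)" for s r
  proof (cases "s = l")
    case True
    then show ?thesis using new[of "\<tau> r"] s \<tau> by (simp add: f'_def)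
  next
    case False
    then have sl: "s < l" using s by simp
    have "s < \<tau> r"
    proof (cases "r < l")
      case False
      then have "l \<le> \<tau> r" using \<tau>(1) \<tau>(4)[of r] lk by (cases "r = l") auto
      then show ?thesis using sl by simp
    qed (use s \<tau> in simp)
    then show ?thesis using zeroB[OF sl _ \<tau>(3)[OF s(3)]] sl by (simp add: f'_def \<tau>(2) old)
  qed
  ultimately show ?thesis using f' P'K Q'K PQ1 PQ2 unfolding B'_def by blast
qed

lemma triangularization:
  fixes A :: "'a^'n^'n"
  assumes A: "\<And>i j. A $ i $ j \<in> K" and es: "set es \<subseteq> K" "length es = CARD('n)"
    and char: "charpoly A = (\<Prod>e\<leftarrow>es. [:- e, 1:])"
  obtains f :: "nat \<Rightarrow> 'n" and P Q :: "'a^'n^'n" where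
    "bij_betw f {..<CARD('n)} UNIV" "\<And>i j. P $ i $ j \<in> K" "\<And>i j. Q $ i $ j \<in> K"
    "P ** Q = mat 1" "Q ** P = mat 1"
    "\<And>s. s < CARD('n) \<Longrightarrow> (Q ** A ** P) $ f s $ f s = es ! s"
    "\<And>s r. s < r \<Longrightarrow> r < CARD('n) \<Longrightarrow> (Q ** A ** P) $ f r $ f s = 0"
proof -
  have "\<exists>f (P :: 'a^'n^'n) (Q :: 'a^'n^'n). bij_betw f {..<CARD('n)} UNIV \<and>
    (\<forall>i j. P $ i $ j \<in> K) \<and> (\<forall>i j. Q $ i $ j \<in> K) \<and> P ** Q = mat 1 \<and> Q ** P = mat 1 \<and>
    (\<forall>s < l. (Q ** A ** P) $ f s $ f s = es ! s) \<and>
    (\<forall>s r. s < l \<longrightarrow> s < r \<longrightarrow> r < CARD('n) \<longrightarrow> (Q ** A ** P) $ f r $ f s = 0)"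
    if "l \<le> CARD('n)" for l
    using that
  proof (induction l)
    case 0
    obtain f where f: "bij_betw f {..<CARD('n)} (UNIV :: 'n set)"
      using ex_bij_betw_nat_finite[of "UNIV :: 'n set"] by (auto simp: atLeast0LessThan)
    have one: "mat 1 $ i $ j \<in> K" for i j :: 'n by (simp add: mat_def one_closed zero_closed)
    show ?case
      by (rule exI[of _ f], rule exI[of _ "mat 1"], rule exI[of _ "mat 1"]) (simp add: f one)
  next
    case (Suc l)
    then have "l \<le> CARD('n)" by simp
    from Suc.IH[OF this] obtain f :: "nat \<Rightarrow> 'n" and P Q :: "'a^'n^'n" where IH: "bij_betw f {..<CARD('n)} UNIV"
      "\<forall>i j. P $ i $ j \<in> K" "\<forall>i j. Q $ i $ j \<in> K" "P ** Q = mat 1" "Q ** P = mat 1"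
      "\<forall>s < l. (Q ** A ** P) $ f s $ f s = es ! s"
      "\<forall>s r. s < l \<longrightarrow> s < r \<longrightarrow> r < CARD('n) \<longrightarrow> (Q ** A ** P) $ f r $ f s = 0"
      by blast
    show ?case
      by (rule triangularization_step[OF A es char, where f = f and P = P and Q = Q])
        (use IH Suc.prems in auto)
  qed
  from this[of "CARD('n)"] obtain f :: "nat \<Rightarrow> 'n" and P Q :: "'a^'n^'n" where H: "bij_betw f {..<CARD('n)} UNIV"
      "\<forall>i j. P $ i $ j \<in> K" "\<forall>i j. Q $ i $ j \<in> K" "P ** Q = mat 1" "Q ** P = mat 1"
      "\<forall>s < CARD('n). (Q ** A ** P) $ f s $ f s = es ! s"
      "\<forall>s r. s < CARD('n) \<longrightarrow> s < r \<longrightarrow> r < CARD('n) \<longrightarrow> (Q ** A ** P) $ f r $ f s = 0"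
    by auto
  show thesis by (rule that[of f P Q]) (use H in auto)
qed

end

section \<open>Growth of the determinants of orbit vectors\<close>

text \<open>The rows, rather than the columns, are the vectors \<open>\<phi>\<^sup>i e\<^sub>j\<close>, because determinants are expanded along rows
  below.\<close>

definition orbit_matrix :: "('a::field^'n \<Rightarrow> 'a^'n) \<Rightarrow> ('n \<Rightarrow> nat \<times> 'n) \<Rightarrow> 'a^'n^'n" where
  "orbit_matrix \<phi> a = (\<chi> l. (\<phi> ^^ fst (a l)) (axis (snd (a l)) 1))"

lemma matrix_pow_conj:
  fixes A P Q :: "'a::field^'n^'n"
  assumes "P ** Q = mat 1"
  shows "((*v) A ^^ i) (P *v x) = P *v ((*v) (Q ** A ** P) ^^ i) x"
proof (induction i)
  case (Suc i)
  have "A ** P = P ** (Q ** A ** P)"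
    using assms by (simp add: matrix_mul_assoc)
  then show ?case using Suc by (simp add: matrix_vector_mul_assoc)
qed simp

lemma matrix_pow_axis:
  "((*v) A ^^ i) x = (\<Sum>j\<in>UNIV. x $ j *s ((*v) A ^^ i) (axis j 1))" for A :: "'a::field^'n^'n"
proof (induction i)
  case 0
  show ?case by (simp add: basis_expansion)
next
  case (Suc i)
  then show ?case by (simp add: vec.sum vec.scale)
qed

lemma rows_times_transpose:
  "(\<chi> l. P *v h l) = (\<chi> l. h l) ** transpose P" for P :: "'a::comm_ring_1^'n^'n"
  by (simp add: vec_eq_iff matrix_vector_mult_def matrix_matrix_mult_def transpose_def mult.commute)

context valued_subfield
begin

lemma matrix_pow_closed:
  fixes T :: "'a^'n^'n"
  assumes "\<And>i j. T $ i $ j \<in> K" "\<And>i. x $ i \<in> K"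
  shows "(((*v) T ^^ n) x) $ i \<in> K"
proof (induction n arbitrary: i)
  case (Suc n)
  then show ?case using assms(1) by (simp add: matrix_vector_closed)
qed (simp add: assms)

text \<open>Downward induction on the row. Each step multiplies the entry in row \<open>r\<close> by the diagonal entry and adds
  contributions of later rows. These grow at most like \<open>\<rho> r ^ i\<close>, since \<open>\<rho>\<close> is decreasing along the diagonal,
  with a polynomial factor of smaller degree; summation raises the degree by one.\<close>

lemma triangular_orbit_growth:
  fixes T :: "'a^'n^'n" and \<rho> :: "nat \<Rightarrow> real"
  assumes T: "\<And>i j. T $ i $ j \<in> K" and x: "\<And>i. x $ i \<in> K"
    and f: "bij_betw f {..<CARD('n)} UNIV"
    and zero: "\<And>s r. s < r \<Longrightarrow> r < CARD('n) \<Longrightarrow> T $ f r $ f s = 0"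
    and diag: "\<And>s. s < CARD('n) \<Longrightarrow> v (T $ f s $ f s) \<le> \<rho> s"
    and ge1: "\<And>s. 1 \<le> \<rho> s" and mono: "\<And>r s. r \<le> s \<Longrightarrow> s < CARD('n) \<Longrightarrow> \<rho> s \<le> \<rho> r"
    and r: "r < CARD('n)"
  shows "\<exists>C\<ge>0. \<forall>i. v ((((*v) T ^^ i) x) $ f r) \<le> C * (1 + real i) ^ (CARD('n) - r) * \<rho> r ^ i"
  using r
proof (induction "CARD('n) - r" arbitrary: r rule: less_induct)
  case less
  define y where "y i = ((*v) T ^^ i) x" for i
  have yK: "y i $ j \<in> K" for i j unfolding y_def by (intro matrix_pow_closed T x)
  define I where "I = {r<..<CARD('n)}"
  have "\<forall>s\<in>I. \<exists>C\<ge>0. \<forall>i. v (y i $ f s) \<le> C * (1 + real i) ^ (CARD('n) - s) * \<rho> s ^ i"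
    unfolding y_def I_def using less.prems by (auto intro!: less.hyps)
  then obtain C where C: "\<And>s. s \<in> I \<Longrightarrow> 0 \<le> C s"
      "\<And>s i. s \<in> I \<Longrightarrow> v (y i $ f s) \<le> C s * (1 + real i) ^ (CARD('n) - s) * \<rho> s ^ i"
    by metis
  define D where "D = CARD('n) - Suc r"
  have D: "CARD('n) - r = Suc D" using less.prems by (simp add: D_def)
  define E where "E = (\<Sum>s\<in>I. v (T $ f r $ f s) * C s)"
  have E: "0 \<le> E" unfolding E_def using C T by (intro sum_nonneg mult_nonneg_nonneg v_nonneg) auto
  define G where "G = v (x $ f r) + E"
  have G: "E \<le> G" "0 \<le> G" using v_nonneg[OF x] E by (auto simp: G_def)
  have \<rho>0: "0 \<le> \<rho> s" for s using ge1[of s] by simp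
  have step: "v (y (Suc i) $ f r) \<le> \<rho> r * v (y i $ f r) + E * (1 + real i) ^ D * \<rho> r ^ i" for i
  proof -
    have "y (Suc i) $ f r = (\<Sum>j\<in>UNIV. T $ f r $ j * y i $ j)"
      by (simp add: y_def matrix_vector_mult_def)
    also have "\<dots> = (\<Sum>s<CARD('n). T $ f r $ f s * y i $ f s)"
      using sum.reindex_bij_betw[OF f, of "\<lambda>j. T $ f r $ j * y i $ j"] by simp
    also have "\<dots> = (\<Sum>s\<in>insert r I. T $ f r $ f s * y i $ f s)"
    proof (rule sum.mono_neutral_right)
      show "\<forall>s\<in>{..<CARD('n)} - insert r I. T $ f r $ f s * y i $ f s = 0"
        using zero[OF _ less.prems] by (auto simp: I_def not_less)
    qed (use less.prems in \<open>auto simp: I_def\<close>)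
    also have "\<dots> = T $ f r $ f r * y i $ f r + (\<Sum>s\<in>I. T $ f r $ f s * y i $ f s)"
      by (simp add: I_def)
    finally have "v (y (Suc i) $ f r) \<le> v (T $ f r $ f r * y i $ f r) + v (\<Sum>s\<in>I. T $ f r $ f s * y i $ f s)"
      using T yK by (simp add: v_add mult_closed sum_closed)
    also have "v (T $ f r $ f r * y i $ f r) \<le> \<rho> r * v (y i $ f r)"
      using diag[OF less.prems] v_nonneg[OF yK] T yK by (simp add: v_mult mult_right_mono)
    also have "v (\<Sum>s\<in>I. T $ f r $ f s * y i $ f s) \<le> (\<Sum>s\<in>I. v (T $ f r $ f s * y i $ f s))"
      by (intro v_sum mult_closed T yK)
    also have "\<dots> \<le> (\<Sum>s\<in>I. (v (T $ f r $ f s) * C s) * ((1 + real i) ^ D * \<rho> r ^ i))"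
    proof (rule sum_mono)
      fix s assume s: "s \<in> I"
      then have "CARD('n) - s \<le> D" "\<rho> s \<le> \<rho> r" using mono[of r s] by (auto simp: I_def D_def)
      then have "(1 + real i) ^ (CARD('n) - s) * \<rho> s ^ i \<le> (1 + real i) ^ D * \<rho> r ^ i"
        using \<rho>0 by (intro mult_mono power_increasing power_mono) auto
      then have "v (y i $ f s) \<le> C s * ((1 + real i) ^ D * \<rho> r ^ i)"
        using C(2)[OF s, of i] mult_left_mono[OF _ C(1)[OF s]] by (fastforce simp: mult.assoc)
      then show "v (T $ f r $ f s * y i $ f s) \<le> (v (T $ f r $ f s) * C s) * ((1 + real i) ^ D * \<rho> r ^ i)"
        using T yK by (simp add: v_mult mult.assoc mult_left_mono v_nonneg)
    qed
    also have "\<dots> = E * (1 + real i) ^ D * \<rho> r ^ i"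
      by (simp only: E_def mult.assoc sum_distrib_right)
    finally show ?thesis by simp
  qed
  have "v (y i $ f r) \<le> G * (1 + real i) ^ Suc D * \<rho> r ^ i" for i
  proof (induction i)
    case 0
    show ?case using E by (simp add: y_def G_def)
  next
    case (Suc i)
    define q where "q = (1 + real i) ^ D"
    have q: "0 \<le> q" by (simp add: q_def)
    have \<rho>i: "0 \<le> \<rho> r ^ i" using \<rho>0 by simp
    have "v (y (Suc i) $ f r) \<le> \<rho> r * (G * (1 + real i) ^ Suc D * \<rho> r ^ i) + E * q * \<rho> r ^ i"
      using step[of i] mult_left_mono[OF Suc \<rho>0[of r]] unfolding q_def by linarith
    also have "E * q * \<rho> r ^ i \<le> G * q * \<rho> r ^ Suc i"
    proof (intro mult_mono)
      show "\<rho> r ^ i \<le> \<rho> r ^ Suc i" using ge1[of r] by (intro power_increasing) auto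
    qed (use G q \<rho>i in auto)
    also have "\<rho> r * (G * (1 + real i) ^ Suc D * \<rho> r ^ i) + G * q * \<rho> r ^ Suc i
        = G * (q * (1 + real (Suc i))) * \<rho> r ^ Suc i"
      by (simp add: q_def algebra_simps)
    also have "\<dots> \<le> G * ((1 + real (Suc i)) ^ D * (1 + real (Suc i))) * \<rho> r ^ Suc i"
      using G \<rho>0 unfolding q_def
      by (intro mult_right_mono mult_left_mono power_mono zero_le_power) auto
    finally show ?case by (simp add: mult_ac)
  qed
  then show ?case using G(2) unfolding D y_def by blast
qed

text \<open>In the triangular basis, each summand of the Leibniz formula has one factor from every row, and the bounds
  for the rows multiply to \<open>R ^ n\<close>.\<close>

lemma det_orbit_matrix_upper:
  fixes A :: "'a^'n^'n"
  assumes A: "\<And>i j. A $ i $ j \<in> K" and es: "set es \<subseteq> K" "length es = CARD('n)"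
    and char: "charpoly A = (\<Prod>e\<leftarrow>es. [:- e, 1:])"
    and sorted: "\<And>r s. r \<le> s \<Longrightarrow> s < CARD('n) \<Longrightarrow> v (es ! s) \<le> v (es ! r)"
  shows "\<exists>c\<ge>0. \<exists>d. \<forall>n a. (\<forall>l. fst (a l) < n) \<longrightarrow>
    v (det (orbit_matrix ((*v) A) a)) \<le> c * real n ^ d * (\<Prod>s<CARD('n). max 1 (v (es ! s))) ^ n"
proof -
  obtain f :: "nat \<Rightarrow> 'n" and P Q :: "'a^'n^'n" where
    f: "bij_betw f {..<CARD('n)} UNIV" and PK: "\<And>i j. P $ i $ j \<in> K" and QK: "\<And>i j. Q $ i $ j \<in> K"
    and PQ: "P ** Q = mat 1" "Q ** P = mat 1"
    and diag: "\<And>s. s < CARD('n) \<Longrightarrow> (Q ** A ** P) $ f s $ f s = es ! s"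
    and zero: "\<And>s r. s < r \<Longrightarrow> r < CARD('n) \<Longrightarrow> (Q ** A ** P) $ f r $ f s = 0"
    using triangularization[OF A es char] by blast
  define T where "T = Q ** A ** P"
  define \<rho> where "\<rho> s = max 1 (v (es ! s))" for s
  define R where "R = (\<Prod>s<CARD('n). \<rho> s)"
  have TK: "T $ i $ j \<in> K" for i j unfolding T_def by (intro matrix_mult_closed A PK QK)
  have axisK: "axis j 1 $ i \<in> K" for i j :: 'n by (simp add: axis_def zero_closed one_closed)
  define t where "t i j = ((*v) T ^^ i) (Q *v axis j 1)" for i j
  have tK: "t i j $ m \<in> K" for i j m
    unfolding t_def by (intro matrix_pow_closed TK matrix_vector_closed QK axisK)
  have "\<exists>C\<ge>0. \<forall>i. v (t i j $ f r) \<le> C * (1 + real i) ^ (CARD('n) - r) * \<rho> r ^ i"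
    if "r < CARD('n)" for j r
    unfolding t_def
  proof (rule triangular_orbit_growth[OF TK _ f])
    show "T $ f r $ f s = 0" if "s < r" "r < CARD('n)" for s r using zero that by (simp add: T_def)
    show "v (T $ f s $ f s) \<le> \<rho> s" if "s < CARD('n)" for s using diag that by (simp add: T_def \<rho>_def)
    show "\<rho> s \<le> \<rho> r" if "r \<le> s" "s < CARD('n)" for r s
      using sorted[OF that] unfolding \<rho>_def by linarith
    show "(Q *v axis j 1) $ i \<in> K" for i by (intro matrix_vector_closed QK axisK)
  qed (use that in \<open>auto simp: \<rho>_def\<close>)
  then have "\<forall>j r. \<exists>C. r < CARD('n) \<longrightarrow>
      0 \<le> C \<and> (\<forall>i. v (t i j $ f r) \<le> C * (1 + real i) ^ (CARD('n) - r) * \<rho> r ^ i)"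
    by blast
  then obtain C where "\<forall>j r. r < CARD('n) \<longrightarrow>
      0 \<le> C j r \<and> (\<forall>i. v (t i j $ f r) \<le> C j r * (1 + real i) ^ (CARD('n) - r) * \<rho> r ^ i)"
    by (simp only: choice_iff) blast
  then have C: "\<And>j r. r < CARD('n) \<Longrightarrow> 0 \<le> C j r"
      "\<And>i j r. r < CARD('n) \<Longrightarrow> v (t i j $ f r) \<le> C j r * (1 + real i) ^ (CARD('n) - r) * \<rho> r ^ i"
    by blast+
  define B where "B = (\<Sum>j\<in>UNIV. \<Sum>r<CARD('n). C j r)"
  have CB: "C j r \<le> B" if "r < CARD('n)" for j r
  proof -
    have "C j r \<le> (\<Sum>r<CARD('n). C j r)" using that C by (intro member_le_sum) auto
    also have "\<dots> \<le> B" unfolding B_def using C by (intro member_le_sum sum_nonneg) auto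
    finally show ?thesis .
  qed
  have B: "0 \<le> B" unfolding B_def using C by (intro sum_nonneg) auto
  define g where "g = inv_into {..<CARD('n)} f"
  have g: "f (g i) = i" "g i < CARD('n)" for i
    using f inv_into_into[of i f "{..<CARD('n)}"] by (auto simp: g_def bij_betw_def f_inv_into_f)
  have \<rho>1: "1 \<le> \<rho> s" for s by (simp add: \<rho>_def)
  have prod\<rho>: "(\<Prod>i\<in>UNIV. \<rho> (g i)) = R"
    unfolding R_def using prod.reindex_bij_betw[OF f, of "\<lambda>i. \<rho> (g i)"] f
    by (simp add: g_def bij_betw_def inv_into_f_f)
  have entry: "v (t i j $ m) \<le> B * real n ^ CARD('n) * \<rho> (g m) ^ n" if "i < n" for i j m n
  proof -
    have "v (t i j $ m) \<le> C j (g m) * (1 + real i) ^ (CARD('n) - g m) * \<rho> (g m) ^ i"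
      using C(2)[of "g m" i j] by (simp add: g)
    also have "\<dots> \<le> B * real n ^ CARD('n) * \<rho> (g m) ^ n"
    proof (intro mult_mono)
      have "(1 + real i) ^ (CARD('n) - g m) \<le> real n ^ (CARD('n) - g m)"
        using that by (intro power_mono) auto
      also have "\<dots> \<le> real n ^ CARD('n)" using that by (intro power_increasing) auto
      finally show "(1 + real i) ^ (CARD('n) - g m) \<le> real n ^ CARD('n)" .
      show "\<rho> (g m) ^ i \<le> \<rho> (g m) ^ n" using that \<rho>1 by (intro power_increasing) auto
    qed (use B C CB g \<rho>1 in \<open>auto intro!: zero_le_power intro: order_trans[OF zero_le_one]\<close>)
    finally show ?thesis .
  qed
  define S where "S = real (card {p. p permutes (UNIV :: 'n set)})"
  define c where "c = S * B ^ CARD('n) * v (det P)"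
  have "v (det (orbit_matrix ((*v) A) a)) \<le> c * real n ^ (CARD('n) * CARD('n)) * R ^ n"
    if a: "\<And>l. fst (a l) < n" for n a
  proof -
    define H where "H = (\<chi> l. t (fst (a l)) (snd (a l)))"
    have "((*v) A ^^ i) (axis j 1) = P *v t i j" for i j
      using matrix_pow_conj[OF PQ(1), where A = A and i = i and x = "Q *v axis j 1"]
      by (simp add: t_def T_def matrix_vector_mul_assoc PQ)
    then have "orbit_matrix ((*v) A) a = H ** transpose P"
      unfolding orbit_matrix_def H_def by (simp add: rows_times_transpose)
    then have "v (det (orbit_matrix ((*v) A) a)) = v (det H) * v (det P)"
      using det_closed[of H] det_closed[OF PK] tK by (simp add: det_mul v_mult H_def)
    also have "v (det H) \<le> (\<Sum>p | p permutes (UNIV :: 'n set). \<Prod>l\<in>UNIV. v (H $ l $ p l))"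
      by (rule v_det_le) (simp add: H_def tK)
    also have "\<dots> \<le> (\<Sum>p | p permutes (UNIV :: 'n set). (B * real n ^ CARD('n)) ^ CARD('n) * R ^ n)"
    proof (rule sum_mono)
      fix p :: "'n \<Rightarrow> 'n" assume "p \<in> {p. p permutes UNIV}"
      then have p: "p permutes UNIV" by simp
      have "(\<Prod>l\<in>UNIV. v (H $ l $ p l)) \<le> (\<Prod>l\<in>UNIV. B * real n ^ CARD('n) * \<rho> (g (p l)) ^ n)"
        using a by (intro prod_mono conjI) (simp_all add: H_def v_nonneg tK entry)
      also have "\<dots> = (B * real n ^ CARD('n)) ^ CARD('n) * (\<Prod>l\<in>UNIV. \<rho> (g (p l))) ^ n"
        by (simp add: prod.distrib prod_power_distrib power_mult_distrib)
      also have "(\<Prod>l\<in>UNIV. \<rho> (g (p l))) = R"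
        using prod.permute[OF p, of "\<lambda>i. \<rho> (g i)"] prod\<rho> by (simp add: o_def)
      finally show "(\<Prod>l\<in>UNIV. v (H $ l $ p l)) \<le> (B * real n ^ CARD('n)) ^ CARD('n) * R ^ n" .
    qed
    also have "\<dots> * v (det P) = c * real n ^ (CARD('n) * CARD('n)) * R ^ n"
      by (simp add: S_def c_def power_mult_distrib power_mult)
    finally show ?thesis using v_nonneg[OF det_closed[OF PK]] by (simp add: mult_right_mono)
  qed
  moreover have "0 \<le> c" using B v_nonneg[OF det_closed[OF PK]] by (simp add: c_def S_def)
  ultimately show ?thesis unfolding R_def \<rho>_def by blast
qed

text \<open>In the triangular basis, apply \<open>n - 1\<close> steps to the basis vectors with \<open>v \<lambda> > 1\<close> and none to the others. The
  determinant of these vectors is a combination, with coefficients independent of \<open>n\<close>, of determinants of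
  orbit matrices, so one of these is at least as large up to a constant factor.\<close>

lemma det_orbit_matrix_lower:
  fixes A :: "'a^'n^'n"
  assumes A: "\<And>i j. A $ i $ j \<in> K" and es: "set es \<subseteq> K" "length es = CARD('n)"
    and char: "charpoly A = (\<Prod>e\<leftarrow>es. [:- e, 1:])"
  shows "\<exists>c>0. \<forall>n\<ge>1. \<exists>a. (\<forall>l. fst (a l) < n) \<and>
    c * (\<Prod>s<CARD('n). max 1 (v (es ! s))) ^ n \<le> v (det (orbit_matrix ((*v) A) a))"
proof -
  obtain f :: "nat \<Rightarrow> 'n" and P Q :: "'a^'n^'n" where
    f: "bij_betw f {..<CARD('n)} UNIV" and PK: "\<And>i j. P $ i $ j \<in> K" and QK: "\<And>i j. Q $ i $ j \<in> K"
    and PQ: "P ** Q = mat 1" "Q ** P = mat 1"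
    and diag: "\<And>s. s < CARD('n) \<Longrightarrow> (Q ** A ** P) $ f s $ f s = es ! s"
    and zero: "\<And>s r. s < r \<Longrightarrow> r < CARD('n) \<Longrightarrow> (Q ** A ** P) $ f r $ f s = 0"
    using triangularization[OF A es char] by blast
  define T where "T = Q ** A ** P"
  define R where "R = (\<Prod>s<CARD('n). max 1 (v (es ! s)))"
  have R: "1 \<le> R" unfolding R_def by (intro prod_ge_1) simp
  have axisK: "axis j 1 $ i \<in> K" for i j :: 'n by (simp add: axis_def zero_closed one_closed)
  have surj: "\<exists>r<CARD('n). i = f r" for i using f by (auto simp: bij_betw_def)
  have inj: "f r = f s \<longleftrightarrow> r = s" if "r < CARD('n)" "s < CARD('n)" for r s
    using f that by (auto simp: bij_betw_def dest: inj_onD)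
  have pow: "(((*v) T ^^ i) (axis (f s) 1)) $ f r = (if r = s then (es ! s) ^ i else 0)"
    if "s \<le> r" "r < CARD('n)" for i s r
    using that
  proof (induction i arbitrary: r)
    case 0
    then show ?case using inj[of r s] by (simp add: axis_def)
  next
    case (Suc i)
    define y where "y = ((*v) T ^^ i) (axis (f s) 1)"
    have "(((*v) T ^^ Suc i) (axis (f s) 1)) $ f r = (\<Sum>j\<in>UNIV. T $ f r $ j * y $ j)"
      by (simp add: y_def matrix_vector_mult_def)
    also have "\<dots> = (\<Sum>u<CARD('n). T $ f r $ f u * y $ f u)"
      using sum.reindex_bij_betw[OF f, of "\<lambda>j. T $ f r $ j * y $ j"] by simp
    also have "\<dots> = (\<Sum>u<CARD('n). if u = r then T $ f r $ f r * y $ f r else 0)"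
    proof (rule sum.cong)
      fix u assume u: "u \<in> {..<CARD('n)}"
      show "T $ f r $ f u * y $ f u = (if u = r then T $ f r $ f r * y $ f r else 0)"
      proof (cases u r rule: linorder_cases)
        case less
        then show ?thesis using zero Suc.prems by (simp add: T_def)
      next
        case greater
        then show ?thesis using Suc u by (simp add: y_def)
      qed simp
    qed simp
    also have "\<dots> = T $ f r $ f r * y $ f r" using Suc.prems by simp
    finally show ?case using Suc diag[of r] by (simp add: y_def T_def)
  qed
  \<comment> \<open>The total weight of the coefficients in the multilinear expansion over choices \<open>h\<close> of unit vectors.\<close>
  define W where "W = (\<Sum>h\<in>(UNIV :: ('n \<Rightarrow> 'n) set). \<Prod>l\<in>UNIV. v (P $ h l $ l))"
  have W: "0 \<le> W" unfolding W_def using PK by (intro sum_nonneg prod_nonneg) (simp add: v_nonneg)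
  have detP: "0 < v (det P)"
  proof -
    have "det P * det Q = 1" using PQ(1) by (metis det_I det_mul)
    then show ?thesis using v_pos[OF det_closed[OF PK]] by force
  qed
  \<comment> \<open>The factor \<open>R\<close> turns \<open>R ^ (n - 1)\<close> into \<open>R ^ n\<close>; the summand \<open>1\<close> makes the final inequality strict.\<close>
  define c where "c = v (det P) / (R * (W + 1))"
  have "\<exists>a. (\<forall>l. fst (a l) < n) \<and> c * R ^ n \<le> v (det (orbit_matrix ((*v) A) a))" if n: "1 \<le> n" for n
  proof (rule ccontr)
    assume none: "\<not> ?thesis"
    define e where "e s = (if 1 < v (es ! s) then n - 1 else 0)" for s
    define g where "g = inv_into {..<CARD('n)} f"
    have g: "f (g i) = i" "g i < CARD('n)" for i
      using f inv_into_into[of i f "{..<CARD('n)}"] by (auto simp: g_def bij_betw_def f_inv_into_f)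
    have gf: "g (f s) = s" if "s < CARD('n)" for s
      using f that by (simp add: g_def bij_betw_def inv_into_f_f)
    define H where "H = (\<chi> l. ((*v) T ^^ e (g l)) (axis l 1))"
    have "det H = det (transpose H)" by simp
    also have "\<dots> = (\<Prod>s<CARD('n). transpose H $ f s $ f s)"
    proof (rule det_triangular[OF f])
      fix s r assume "s < r" "r < CARD('n)"
      then show "transpose H $ f r $ f s = 0"
        using pow[of s r "e s"] by (simp add: transpose_def H_def gf)
    qed
    also have "\<dots> = (\<Prod>s<CARD('n). (es ! s) ^ e s)"
      using pow by (intro prod.cong) (simp_all add: transpose_def H_def gf)
    finally have dH: "det H = (\<Prod>s<CARD('n). (es ! s) ^ e s)" .
    have "v (det H) = (\<Prod>s<CARD('n). v (es ! s) ^ e s)"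
    proof -
      have "es ! s \<in> K" if "s < CARD('n)" for s using es that by (auto simp: subset_iff)
      then show ?thesis
        by (subst dH, subst v_prod) (simp_all add: power_closed v_power)
    qed
    also have "\<dots> = (\<Prod>s<CARD('n). max 1 (v (es ! s)) ^ (n - 1))"
      by (intro prod.cong) (auto simp: e_def max_def)
    finally have detH: "v (det H) = R ^ (n - 1)" by (simp add: R_def prod_power_distrib)
    have HK: "H $ i $ j \<in> K" for i j
    proof -
      have "T $ i $ j \<in> K" for i j unfolding T_def by (intro matrix_mult_closed A PK QK)
      then show ?thesis unfolding H_def vec_lambda_beta by (intro matrix_pow_closed axisK)
    qed
    define G where "G h = det (orbit_matrix ((*v) A) (\<lambda>l. (e (g l), h l)))" for h
    have orbK: "orbit_matrix ((*v) A) a $ i $ j \<in> K" for a i j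
      unfolding orbit_matrix_def vec_lambda_beta by (intro matrix_pow_closed A axisK)
    have GK: "G h \<in> K" for h unfolding G_def by (intro det_closed orbK)
    have Gc: "v (G h) \<le> c * R ^ n" for h
    proof -
      have "fst ((e (g l), h l)) < n" for l using n by (simp add: e_def)
      then show ?thesis using none unfolding G_def by (meson linear)
    qed
    have "H ** transpose P = (\<chi> l. P *v ((*v) T ^^ e (g l)) (axis l 1))"
      unfolding H_def by (rule rows_times_transpose[symmetric])
    also have "\<dots> = (\<chi> l. ((*v) A ^^ e (g l)) (P *v axis l 1))"
      unfolding T_def by (simp add: matrix_pow_conj[OF PQ(1)])
    also have "\<dots> = (\<chi> l. \<Sum>j\<in>UNIV. P $ j $ l *s ((*v) A ^^ e (g l)) (axis j 1))"
    proof -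
      have "(P *v axis l 1) $ j = P $ j $ l" for j l
        by (simp add: matrix_vector_mult_def axis_def if_distrib cong: if_cong)
      then show ?thesis by (subst matrix_pow_axis) simp
    qed
    finally have "det H * det P = det (\<chi> l. \<Sum>j\<in>UNIV. P $ j $ l *s ((*v) A ^^ e (g l)) (axis j 1))"
      by (metis det_mul det_transpose)
    also have "\<dots> = (\<Sum>h\<in>{h. \<forall>l. h l \<in> UNIV}. det (\<chi> l. P $ h l $ l *s ((*v) A ^^ e (g l)) (axis (h l) 1)))"
      by (rule det_linear_rows_sum) simp
    also have "\<dots> = (\<Sum>h\<in>UNIV. (\<Prod>l\<in>UNIV. P $ h l $ l) * G h)"
      by (intro sum.cong) (simp_all add: det_rows_mul G_def orbit_matrix_def)
    finally have "v (det H * det P) = v (\<Sum>h\<in>UNIV. (\<Prod>l\<in>UNIV. P $ h l $ l) * G h)" by simp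
    also have "\<dots> \<le> (\<Sum>h\<in>UNIV. v ((\<Prod>l\<in>UNIV. P $ h l $ l) * G h))"
      by (intro v_sum mult_closed prod_closed PK GK)
    also have "\<dots> \<le> (\<Sum>h\<in>UNIV. (\<Prod>l\<in>UNIV. v (P $ h l $ l)) * (c * R ^ n))"
      using PK GK Gc by (intro sum_mono)
        (simp add: v_mult v_prod prod_closed mult_left_mono prod_nonneg v_nonneg)
    also have "\<dots> = W * (c * R ^ n)" by (simp add: W_def sum_distrib_right)
    finally have "R ^ (n - 1) * v (det P) \<le> W * (c * R ^ n)"
      using detH by (simp add: v_mult det_closed HK PK)
    also have "\<dots> = R ^ (n - 1) * v (det P) * (W / (W + 1))"
    proof -
      have "R * (W + 1) \<noteq> 0" "R \<noteq> 0" using R W by auto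
      then have "c * R ^ n = R ^ (n - 1) * v (det P) / (W + 1)"
        using n by (cases n) (simp_all add: c_def)
      then show ?thesis by simp
    qed
    also have "\<dots> < R ^ (n - 1) * v (det P) * 1"
      using R W detP by (intro mult_strict_left_mono) auto
    finally show False by simp
  qed
  moreover have "0 < c" using detP R W by (simp add: c_def)
  ultimately show ?thesis unfolding R_def by blast
qed

end

section \<open>Measures of trajectories\<close>

context haar
begin

lemma mem_trajectory_iff:
  "x \<in> trajectory n \<phi> C \<longleftrightarrow> (\<exists>y. (\<forall>i<n. y i \<in> C) \<and> x = (\<Sum>i<n. (\<phi> ^^ i) (y i)))"
proof
  assume "x \<in> trajectory n \<phi> C"
  then obtain s where s: "x = (\<Sum>i<n. s i)" "\<forall>i\<in>{..<n}. s i \<in> (\<phi> ^^ i) ` C"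
    unfolding trajectory_def by (auto simp: set_sum_alt)
  then have "\<forall>i\<in>{..<n}. \<exists>y\<in>C. s i = (\<phi> ^^ i) y" by blast
  then obtain y where y: "\<forall>i\<in>{..<n}. y i \<in> C \<and> s i = (\<phi> ^^ i) (y i)" by (metis bchoice)
  then have "x = (\<Sum>i<n. (\<phi> ^^ i) (y i))" unfolding s(1) by (intro sum.cong) auto
  then show "\<exists>y. (\<forall>i<n. y i \<in> C) \<and> x = (\<Sum>i<n. (\<phi> ^^ i) (y i))" using y by auto
next
  assume "\<exists>y. (\<forall>i<n. y i \<in> C) \<and> x = (\<Sum>i<n. (\<phi> ^^ i) (y i))"
  then show "x \<in> trajectory n \<phi> C" unfolding trajectory_def by (auto simp: set_sum_alt)
qed

lemma compact_trajectory:
  fixes A :: "'k^'n^'n"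
  assumes C: "compact C"
  shows "compact (trajectory n ((*v) A) C)"
proof (induction n)
  case 0
  show ?case by (simp add: trajectory_def set_zero)
next
  case (Suc n)
  have iter: "compact (((*v) A ^^ i) ` C)" for i
  proof (induction i)
    case (Suc i)
    have "((*v) A ^^ Suc i) ` C = (*v) A ` ((*v) A ^^ i) ` C" by (simp add: image_comp)
    then show ?case using compact_matrix_image[OF Suc] by simp
  qed (simp add: C)
  have "trajectory (Suc n) ((*v) A) C = trajectory n ((*v) A) C + ((*v) A ^^ n) ` C"
    by (simp add: trajectory_def)
  also have "\<dots> = (\<lambda>(x, y). x + y) ` (trajectory n ((*v) A) C \<times> ((*v) A ^^ n) ` C)"
    by (rule set_plus_image)
  also have "compact \<dots>"
    by (intro compact_continuous_image compact_Times Suc iter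
        continuous_on_subset[OF continuous_add_pair]) simp
  finally show ?case .
qed

lemma measure_scaled_cube:
  fixes c :: 'k
  assumes "c \<noteq> 0"
  shows "measure M (cube (Qp_abs c)) = Qp_abs c ^ CARD('n) * measure M (cube 1)"
proof -
  have det: "det (mat c :: 'k^'n^'n) = c ^ CARD('n)"
    by (subst det_diagonal) (simp_all add: mat_def)
  have "(cube (Qp_abs c) :: ('k^'n) set) = (*v) (mat c :: 'k^'n^'n) ` cube 1"
    by (simp add: scaled_cube[OF assms] flip: smult_eq_matrix)
  then show ?thesis
    using measure_linear_image[of "mat c :: 'k^'n^'n" "cube 1"] assms by (simp add: det v_power)
qed

text \<open>If \<open>N * Qp_abs e \<le> Qp_abs b\<close>, grouping the vectors in \<open>G\<close> by their exponent exhibits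
  their combination with coefficients \<open>y\<close> in the cube of size \<open>Qp_abs e\<close> as a sum of \<open>A\<^sup>i z\<^sub>i\<close> with \<open>z\<^sub>i\<close> in the cube of size \<open>Qp_abs b\<close>, which lies in \<open>C\<close>.\<close>

lemma measure_trajectory_lower:
  fixes A :: "'k^'n^'n"
  assumes C: "compact C" "0 \<in> interior C"
  shows "\<exists>c>0. \<forall>n a. (\<forall>l. fst (a l) < n) \<longrightarrow>
    c * Qp_abs (det (orbit_matrix ((*v) A) a)) \<le> measure M (trajectory n ((*v) A) C)"
proof -
  obtain b :: 'k where b: "b \<noteq> 0" "cube (Qp_abs b) \<subseteq> C"
    using C(2) by (rule cube_subset_neighbourhood)
  obtain m where m: "Qp_abs \<theta> ^ m < 1 / real CARD('n)"
    using real_arch_pow_inv[OF _ theta_less, of "1 / real CARD('n)"] by auto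
  define e where "e = b * \<theta> ^ m"
  have e0: "e \<noteq> 0" using b theta_nonzero by (simp add: e_def)
  have e: "real CARD('n) * Qp_abs e \<le> Qp_abs b"
  proof -
    have "Qp_abs b * (real CARD('n) * Qp_abs \<theta> ^ m) \<le> Qp_abs b * 1"
      using m v_nonneg[of b] by (intro mult_left_mono) (simp_all add: field_simps)
    then show ?thesis by (simp add: e_def v_mult v_power mult_ac)
  qed
  define c where "c = measure M (cube (Qp_abs e))"
  have c: "0 < c" unfolding c_def using v_pos[of e] e0 cube_pos by (simp add: measure_scaled_cube)
  have "c * Qp_abs (det G) \<le> measure M (trajectory n ((*v) A) C)"
    if a: "\<forall>l. fst (a l) < n" and G: "G = orbit_matrix ((*v) A) a" for n a G
  proof (cases "det G = 0")
    case False
    have "(*v) (transpose G) ` cube (Qp_abs e) \<subseteq> trajectory n ((*v) A) C"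
    proof
      fix x assume "x \<in> (*v) (transpose G) ` cube (Qp_abs e)"
      then obtain y where y: "y \<in> cube (Qp_abs e)" "x = transpose G *v y" by blast
      define z where "z i = (\<Sum>l | fst (a l) = i. y $ l *s axis (snd (a l)) 1)" for i
      have "z i \<in> C" for i
      proof -
        have "Qp_abs (z i $ j) \<le> Qp_abs b" for j
        proof -
          have "Qp_abs (z i $ j) \<le> (\<Sum>l | fst (a l) = i. Qp_abs (y $ l * axis (snd (a l)) 1 $ j))"
            unfolding z_def sum_component vector_smult_component by (rule v_sum) simp
          also have "\<dots> \<le> (\<Sum>l | fst (a l) = i. Qp_abs e)"
            using cubeD[OF y(1)] v_nonneg[of e] by (intro sum_mono) (auto simp: axis_def)
          also have "\<dots> \<le> (\<Sum>l\<in>(UNIV :: 'n set). Qp_abs e)"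
            using v_nonneg[of e] by (intro sum_mono2) auto
          also have "\<dots> \<le> Qp_abs b" using e by simp
          finally show ?thesis .
        qed
        then show ?thesis using b(2) by (auto intro: cubeI)
      qed
      moreover have "x = (\<Sum>i<n. ((*v) A ^^ i) (z i))"
      proof -
        have "x = (\<Sum>l\<in>UNIV. y $ l *s ((*v) A ^^ fst (a l)) (axis (snd (a l)) 1))"
          by (simp add: y(2) matrix_vector_mult_def vec_eq_iff transpose_def G orbit_matrix_def mult.commute)
        also have "\<dots> = (\<Sum>i<n. \<Sum>l | l \<in> UNIV \<and> fst (a l) = i. y $ l *s ((*v) A ^^ fst (a l)) (axis (snd (a l)) 1))"
          by (rule sum.group[symmetric]) (use a in auto)
        also have "\<dots> = (\<Sum>i<n. ((*v) A ^^ i) (z i))"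
        proof (rule sum.cong)
          fix i
          have lin: "((*v) A ^^ i) (\<Sum>l\<in>S. c l *s h l) = (\<Sum>l\<in>S. c l *s ((*v) A ^^ i) (h l))"
            for S :: "'n set" and c :: "'n \<Rightarrow> 'k" and h
            by (induction i) (simp_all add: vec.sum vec.scale)
          have "((*v) A ^^ i) (z i) = (\<Sum>l | fst (a l) = i. y $ l *s ((*v) A ^^ i) (axis (snd (a l)) 1))"
            unfolding z_def by (rule lin)
          also have "\<dots> = (\<Sum>l | l \<in> UNIV \<and> fst (a l) = i. y $ l *s ((*v) A ^^ fst (a l)) (axis (snd (a l)) 1))"
            by (rule sum.cong) auto
          finally show "(\<Sum>l | l \<in> UNIV \<and> fst (a l) = i. y $ l *s ((*v) A ^^ fst (a l)) (axis (snd (a l)) 1))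
              = ((*v) A ^^ i) (z i)" by simp
        qed simp
        finally show ?thesis .
      qed
      ultimately show "x \<in> trajectory n ((*v) A) C" unfolding mem_trajectory_iff
        by (intro exI[of _ z]) simp
    qed
    then have "measure M ((*v) (transpose G) ` cube (Qp_abs e)) \<le> measure M (trajectory n ((*v) A) C)"
      by (intro measure_mono_fmeasurable fmeasurableD compact_fmeasurable compact_trajectory
          compact_matrix_image compact_cube C)
    then show ?thesis
      using measure_linear_image[of "transpose G" "cube (Qp_abs e)"] False
      by (simp add: c_def mult.commute)
  qed simp
  with c show ?thesis by blast
qed

text \<open>The choice \<open>a\<close> maximises the determinant. By Cramer's rule, the coordinates of \<open>A\<^sup>i e\<^sub>j\<close> with respect to the
  chosen vectors are quotients of two such determinants and therefore at most \<open>1\<close>.\<close>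

lemma measure_trajectory_upper:
  fixes A :: "'k^'n^'n"
  assumes C: "compact C"
  shows "\<exists>c\<ge>0. \<exists>d. \<forall>n\<ge>1. \<exists>a. (\<forall>l. fst (a l) < n) \<and>
    measure M (trajectory n ((*v) A) C) \<le> c * real n ^ d * Qp_abs (det (orbit_matrix ((*v) A) a))"
proof -
  obtain r where r: "1 \<le> r" "C \<subseteq> cube r" using compact_subset_cube[OF C] by blast
  define c where "c = (real CARD('n) * r / Qp_abs \<theta>) ^ CARD('n) * measure M (cube 1)"
  have "\<exists>a. (\<forall>l. fst (a l) < n) \<and> measure M (trajectory n ((*v) A) C)
      \<le> c * real n ^ CARD('n) * Qp_abs (det (orbit_matrix ((*v) A) a))" if n: "1 \<le> n" for n
  proof -
    \<comment> \<open>Finitely many choices; the choice of the standard basis, with determinant \<open>1\<close>, shows that the maximum is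
      positive.\<close>
    define S where "S = {a :: 'n \<Rightarrow> nat \<times> 'n. \<forall>l. fst (a l) < n}"
    define h where "h a = Qp_abs (det (orbit_matrix ((*v) A) a))" for a
    have "S = PiE UNIV (\<lambda>_. {..<n} \<times> UNIV)" by (auto simp: S_def PiE_UNIV_domain Pi_iff mem_Times_iff)
    then have finS: "finite S" by (simp add: finite_PiE)
    have id: "(\<lambda>l. (0, l)) \<in> S" using n by (simp add: S_def)
    have "orbit_matrix ((*v) A) (\<lambda>l. (0, l)) = mat 1"
      by (simp add: orbit_matrix_def mat_def axis_def vec_eq_iff)
    then have h1: "h (\<lambda>l. (0, l)) = 1" by (simp add: h_def)
    have "Max (h ` S) \<in> h ` S" using finS id by (intro Max_in) auto
    then obtain a where a: "a \<in> S" "h a = Max (h ` S)" by auto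
    then have max: "h b \<le> h a" if "b \<in> S" for b using finS that by simp
    have ha: "0 < h a" using max[OF id] h1 by simp
    define G where "G = orbit_matrix ((*v) A) a"
    have G0: "det (transpose G) \<noteq> 0" using ha by (auto simp: h_def G_def)
    have unit: "\<exists>w\<in>cube 1. transpose G *v w = ((*v) A ^^ i) (axis j 1)" if i: "i < n" for i j
    proof -
      define b where "b = ((*v) A ^^ i) (axis j 1)"
      define w where "w = (\<chi> k. det (\<chi> i j. if j = k then b $ i else transpose G $ i $ j) / det (transpose G))"
      have "transpose G *v w = b" using cramer[OF G0, of w b] by (simp add: w_def)
      moreover have "Qp_abs (w $ k) \<le> 1" for k
      proof -
        have "(\<chi> i j. if j = k then b $ i else transpose G $ i $ j)
            = transpose (orbit_matrix ((*v) A) (a(k := (i, j))))"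
          by (auto simp: vec_eq_iff transpose_def G_def orbit_matrix_def b_def)
        then have "Qp_abs (w $ k) = h (a(k := (i, j))) / h a"
          unfolding w_def vec_lambda_beta by (simp add: v_divide h_def G_def)
        also have "\<dots> \<le> 1" using max[of "a(k := (i, j))"] a(1) i ha by (auto simp: S_def)
        finally show ?thesis .
      qed
      ultimately show ?thesis unfolding b_def by (auto intro: cubeI)
    qed
    then have "\<forall>i\<in>{..<n}. \<forall>j. \<exists>w. w \<in> cube 1 \<and> transpose G *v w = ((*v) A ^^ i) (axis j 1)" by blast
    then obtain w where w: "\<And>i j. i < n \<Longrightarrow> w i j \<in> cube 1"
        "\<And>i j. i < n \<Longrightarrow> transpose G *v w i j = ((*v) A ^^ i) (axis j 1)"
      by (metis lessThan_iff)
    define q where "q = real n * (real CARD('n) * r)"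
    have "1 * 1 \<le> real n * (real CARD('n) * r)"
      using n r mult_mono[of 1 "real CARD('n)" 1 r] by (intro mult_mono) auto
    then have q: "1 \<le> q" by (simp add: q_def)
    have sub: "trajectory n ((*v) A) C \<subseteq> (*v) (transpose G) ` cube q"
    proof
      fix x assume "x \<in> trajectory n ((*v) A) C"
      then obtain y where y: "\<And>i. i < n \<Longrightarrow> y i \<in> C" "x = (\<Sum>i<n. ((*v) A ^^ i) (y i))"
        unfolding mem_trajectory_iff by blast
      define u where "u = (\<Sum>i<n. \<Sum>j\<in>UNIV. y i $ j *s w i j)"
      have "x = (\<Sum>i<n. \<Sum>j\<in>UNIV. y i $ j *s (transpose G *v w i j))"
        unfolding y(2)
      proof (intro sum.cong refl)
        fix i assume "i \<in> {..<n}"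
        then have i: "i < n" by simp
        show "((*v) A ^^ i) (y i) = (\<Sum>j\<in>UNIV. y i $ j *s (transpose G *v w i j))"
          unfolding w(2)[OF i] by (rule matrix_pow_axis)
      qed
      also have "\<dots> = transpose G *v u" by (simp add: u_def vec.sum vec.scale)
      finally have "x = transpose G *v u" .
      moreover have "u \<in> cube q"
      proof (rule cubeI)
        fix k
        have "Qp_abs (u $ k) \<le> (\<Sum>i<n. Qp_abs (\<Sum>j\<in>UNIV. y i $ j * w i j $ k))"
          unfolding u_def sum_component vector_smult_component by (rule v_sum) simp
        also have "\<dots> \<le> (\<Sum>i<n. \<Sum>j\<in>(UNIV :: 'n set). r)"
        proof (rule sum_mono)
          fix i assume i: "i \<in> {..<n}"
          have "Qp_abs (\<Sum>j\<in>UNIV. y i $ j * w i j $ k) \<le> (\<Sum>j\<in>UNIV. Qp_abs (y i $ j * w i j $ k))"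
            by (rule v_sum) simp
          also have "\<dots> \<le> (\<Sum>j\<in>(UNIV :: 'n set). r * 1)"
          proof (rule sum_mono)
            fix j
            have yi: "y i \<in> cube r" and wi: "w i j \<in> cube 1" using y(1) w(1) i r(2) by auto
            show "Qp_abs (y i $ j * w i j $ k) \<le> r * 1"
              unfolding v_mult[OF UNIV_I UNIV_I] using r(1)
              by (intro mult_mono cubeD[OF yi] cubeD[OF wi] v_nonneg) auto
          qed
          finally show "Qp_abs (\<Sum>j\<in>UNIV. y i $ j * w i j $ k) \<le> (\<Sum>j\<in>(UNIV :: 'n set). r)" by simp
        qed
        also have "\<dots> = q" by (simp add: q_def)
        finally show "Qp_abs (u $ k) \<le> q" .
      qed
      ultimately show "x \<in> (*v) (transpose G) ` cube q" by blast
    qed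
    obtain b :: 'k where b: "q \<le> Qp_abs b" "Qp_abs b \<le> q / Qp_abs \<theta>" using large_scalar[OF q] by blast
    have b0: "b \<noteq> 0" using b q by auto
    have "measure M (trajectory n ((*v) A) C) \<le> measure M ((*v) (transpose G) ` cube (Qp_abs b))"
    proof (intro measure_mono_fmeasurable fmeasurableD compact_fmeasurable compact_trajectory C
          compact_matrix_image compact_cube)
      show "trajectory n ((*v) A) C \<subseteq> (*v) (transpose G) ` cube (Qp_abs b)"
        using sub cube_mono[OF b(1)] by blast
    qed
    also have "\<dots> = h a * (Qp_abs b ^ CARD('n) * measure M (cube 1))"
      using measure_linear_image[OF G0 cube_borel] by (simp add: h_def G_def measure_scaled_cube[OF b0])
    also have "\<dots> \<le> h a * ((q / Qp_abs \<theta>) ^ CARD('n) * measure M (cube 1))"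
      using b ha v_nonneg[of b] by (intro mult_left_mono mult_right_mono power_mono) auto
    also have "\<dots> = c * real n ^ CARD('n) * h a"
      by (simp add: c_def q_def power_mult_distrib power_divide)
    finally show ?thesis using a(1) unfolding S_def h_def by blast
  qed
  moreover have "0 \<le> c" using r v_nonneg[of \<theta>] by (simp add: c_def)
  ultimately show ?thesis by blast
qed

end

section \<open>The entropy formula\<close>

text \<open>Constant and polynomial factors disappear in the growth rate.\<close>

lemma exponential_growth_rate:
  fixes m :: "nat \<Rightarrow> real"
  assumes "0 < c" "1 \<le> R"
    and lower: "\<And>n. 1 \<le> n \<Longrightarrow> c * R ^ n \<le> m n"
    and upper: "\<And>n. 1 \<le> n \<Longrightarrow> m n \<le> C * real n ^ d * R ^ n"
  shows "(\<lambda>n. ln (m n) / real n) \<longlonglongrightarrow> ln R"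
proof (rule tendsto_sandwich)
  have m: "0 < m n" if "1 \<le> n" for n
    using lower[OF that] assms by (meson less_le_trans mult_pos_pos zero_less_power less_le_trans zero_less_one)
  have C: "0 < C" using m[of 1] upper[of 1] assms(2) mult_nonpos_nonneg[of C R]
    by (cases "0 < C") auto
  show "\<forall>\<^sub>F n in sequentially. (ln c + real n * ln R) / real n \<le> ln (m n) / real n"
  proof (rule eventually_sequentiallyI[of 1])
    fix n :: nat assume n: "1 \<le> n"
    have "ln c + real n * ln R = ln (c * R ^ n)" using assms by (simp add: ln_mult ln_realpow)
    also have "\<dots> \<le> ln (m n)" using lower[OF n] assms m[OF n] by (intro ln_mono) auto
    finally show "(ln c + real n * ln R) / real n \<le> ln (m n) / real n" by (intro divide_right_mono) auto
  qed
  show "\<forall>\<^sub>F n in sequentially. ln (m n) / real n \<le> (ln C + real d * ln (real n) + real n * ln R) / real n"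
  proof (rule eventually_sequentiallyI[of 1])
    fix n :: nat assume n: "1 \<le> n"
    have "ln (m n) \<le> ln (C * real n ^ d * R ^ n)"
      using upper[OF n] m[OF n] by (intro ln_mono) auto
    also have "\<dots> = ln C + real d * ln (real n) + real n * ln R"
      using C n assms by (simp add: ln_mult ln_realpow)
    finally show "ln (m n) / real n \<le> (ln C + real d * ln (real n) + real n * ln R) / real n"
      by (intro divide_right_mono) auto
  qed
  show "(\<lambda>n. (ln c + real n * ln R) / real n) \<longlonglongrightarrow> ln R" by real_asymp
  show "(\<lambda>n. (ln C + real d * ln (real n) + real n * ln R) / real n) \<longlonglongrightarrow> ln R" by real_asymp
qed

lemma ln_prod_max_eq_sum_mset:
  fixes v :: "'a \<Rightarrow> real"
  shows "ln (\<Prod>s<length es. max 1 (v (es ! s))) = (\<Sum>x\<in>#{#x \<in># mset es. v x > 1#}. ln (v x))"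
proof -
  have "ln (\<Prod>e\<leftarrow>es. max 1 (v e)) = (\<Sum>x\<in>#{#x \<in># mset es. v x > 1#}. ln (v x))"
  proof (induction es)
    case (Cons e es)
    have "0 < (\<Prod>e\<leftarrow>es. max 1 (v e))" by (induction es) (auto simp: max_def)
    then show ?case using Cons by (simp add: ln_mult max_def)
  qed simp
  then show ?thesis by (simp add: prod.list_conv_set_nth atLeast0LessThan)
qed

lemma charpoly_map_to_ac:
  "charpoly (\<chi> i j. to_ac (A $ i $ j)) = map_poly to_ac (charpoly A)" for A :: "'k::field^'n^'n"
proof -
  have mult: "map_poly to_ac (p * q) = map_poly to_ac p * map_poly to_ac q" for p q :: "'k poly"
    by (rule poly_eqI) (simp add: coeff_map_poly coeff_mult to_ac_sum)
  have add: "map_poly to_ac (p + q) = map_poly to_ac p + map_poly to_ac q" for p q :: "'k poly"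
    by (rule poly_eqI) (simp add: coeff_map_poly)
  show ?thesis
    unfolding charpoly_def
    by (subst det_hom[of "map_poly to_ac"])
      (auto simp: mult add map_poly_pCons vec_eq_iff intro!: arg_cong[of _ _ det])
qed

text \<open>The characteristic polynomial is monic and splits over the algebraic closure.\<close>

lemma eigenvalues_factorization:
  fixes \<phi> :: "'k::field^'n \<Rightarrow> 'k^'n"
  shows "charpoly (\<chi> i j. to_ac (matrix \<phi> $ i $ j)) = (\<Prod>x\<in>#eigenvalues \<phi>. [:- x, 1:])"
    and "size (eigenvalues \<phi>) = CARD('n)"
proof -
  define q where "q = charpoly (\<chi> i j. to_ac (matrix \<phi> $ i $ j))"
  have q: "Polynomial.degree q = CARD('n)" "Polynomial.coeff q CARD('n) = 1"
    unfolding q_def by (rule charpoly_monic)+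
  then have "q \<noteq> 0" by auto
  then obtain E where E: "size E = Polynomial.degree q" "q = Polynomial.smult (Polynomial.coeff q (Polynomial.degree q)) (\<Prod>x\<in>#E. [:- x, 1:])"
    using alg_closed_imp_factorization by blast
  then have qE: "q = (\<Prod>x\<in>#E. [:- x, 1:])" by (simp add: q)
  have "proots (\<Prod>x\<in>#E. [:- x, 1:]) = E"
  proof (induction E)
    case (add x E)
    have "(\<Prod>x\<in>#E. [:- x, 1:]) \<noteq> 0" by (auto simp: prod_mset_zero_iff)
    then have "proots ([:- x, 1:] * (\<Prod>x\<in>#E. [:- x, 1:])) = {#x#} + E"
      using add by (subst proots_mult) (simp_all del: mult_pCons_left)
    then show ?case by (simp del: mult_pCons_left)
  qed simp
  then have "eigenvalues \<phi> = E"
    unfolding eigenvalues_def charpoly_map_to_ac[symmetric] q_def[symmetric] by (simp add: qE)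
  then show "charpoly (\<chi> i j. to_ac (matrix \<phi> $ i $ j)) = (\<Prod>x\<in>#eigenvalues \<phi>. [:- x, 1:])"
    "size (eigenvalues \<phi>) = CARD('n)" using E qE q unfolding q_def by simp_all
qed

lemma orbit_matrix_to_ac:
  fixes A :: "'k::field^'n^'n"
  shows "det (orbit_matrix ((*v) (\<chi> i j. to_ac (A $ i $ j))) a) = to_ac (det (orbit_matrix ((*v) A) a))"
proof -
  have "((*v) (\<chi> i j. to_ac (A $ i $ j)) ^^ n) (axis l 1) = (\<chi> i. to_ac ((((*v) A ^^ n) (axis l 1)) $ i))" for n l
    by (induction n) (auto simp: axis_def vec_eq_iff matrix_vector_mult_def to_ac_sum)
  then have "orbit_matrix ((*v) (\<chi> i j. to_ac (A $ i $ j))) a = (\<chi> i j. to_ac (orbit_matrix ((*v) A) a $ i $ j))"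
    by (simp add: orbit_matrix_def vec_eq_iff)
  then show ?thesis by (subst det_hom[of to_ac]) simp_all
qed

lemma haar_measure_imp_haar:
  fixes M :: "('k::{field_char_0,metric_space}^'n) measure"
  assumes "tiled_field \<theta> (F :: 'k set)" and M: "haar_measure M"
  shows "haar \<theta> F M"
proof -
  interpret tiled_field \<theta> F by fact
  have fin: "emeasure M (cube r) < \<infinity>" for r
    using M compact_cube[of r] unfolding haar_measure_def by blast
  have inv: "invariant_measure \<theta> F M"
    by unfold_locales (use M fin in \<open>auto simp: haar_measure_def\<close>)
  have "0 < emeasure M (interior (cube 1))"
    using M cube_neighbourhood[of 1] unfolding haar_measure_def by (metis open_interior empty_iff zero_less_one)
  also have "\<dots> \<le> emeasure M (cube 1)"
    using invariant_measure.cube_borel[OF inv] invariant_measure.sets_M[OF inv]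
    by (intro emeasure_mono interior_subset) simp
  finally have "0 < measure M (cube 1)"
    using fin[of 1] by (simp add: measure_def enn2real_positive_iff)
  then show ?thesis using inv by (simp add: haar_def haar_axioms_def)
qed

theorem factA:
  fixes p :: enat
    and \<phi> :: "'k::{field_char_0,metric_space}^'n \<Rightarrow> 'k^'n"
    and M :: "('k^'n) measure"
  assumes "p = \<infinity> \<or> (\<exists>q. Factorial_Ring.prime q \<and> p = enat q)"
    and "is_Qp p TYPE('k)"
    and "Modules.additive \<phi>" and "continuous_on UNIV \<phi>"
    and "haar_measure M"
  shows "(\<exists>K. finite_extension K \<and> set_mset (eigenvalues \<phi>) \<subseteq> K) \<and>
    (\<forall>K v. finite_extension K \<and> set_mset (eigenvalues \<phi>) \<subseteq> K \<and> extends_Qp_abs K v \<longrightarrow>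
       algebraic_entropy M \<phi>
         = ereal (\<Sum>x\<in>#{#x \<in># eigenvalues \<phi>. v x > 1#}. ln (v x)))"
proof (intro conjI allI impI)
  show "\<exists>K. finite_extension K \<and> set_mset (eigenvalues \<phi>) \<subseteq> K"
    by (rule finite_extension_exists) simp
next
  fix K v
  assume Kv: "finite_extension K \<and> set_mset (eigenvalues \<phi>) \<subseteq> K \<and> extends_Qp_abs K v"
  obtain \<theta> :: 'k and F where tiled: "tiled_field \<theta> F"
    using is_Qp_tiled_field[OF assms(1,2)] by blast
  interpret haar \<theta> F M by (rule haar_measure_imp_haar[OF tiled assms(5)])
  have base: "to_ac x \<in> K" for x using Kv by (auto simp: finite_extension_def)
  interpret L: valued_subfield K v
  proof
    show "abs_value_on K v" using Kv by (simp add: extends_Qp_abs_def)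
    show "1 \<in> K" using base[of 1] by simp
  qed (use Kv in \<open>auto simp: finite_extension_def\<close>)
  have v: "v (to_ac x) = Qp_abs x" for x using Kv by (simp add: extends_Qp_abs_def)
  define A where "A = matrix \<phi>"
  have \<phi>: "\<phi> = (*v) A"
    using matrix_works[OF additive_continuous_linear[OF assms(3,4)]] by (auto simp: A_def)
  define B where "B = (\<chi> i j. to_ac (A $ i $ j))"
  have BK: "B $ i $ j \<in> K" for i j by (simp add: B_def base)
  obtain xs where xs: "mset xs = eigenvalues \<phi>" using ex_mset by blast
  \<comment> \<open>Triangularisation accepts the eigenvalues in any order; the growth estimate for rows requires decreasing
    absolute values.\<close>
  define es where "es = sort_key (\<lambda>x. - v x) xs"
  have es: "mset es = eigenvalues \<phi>" by (simp add: es_def xs)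
  have esK: "set es \<subseteq> K" using Kv unfolding es[symmetric] by simp
  have len: "length es = CARD('n)" using eigenvalues_factorization(2)[of \<phi>] unfolding es[symmetric] by simp
  have char: "charpoly B = (\<Prod>e\<leftarrow>es. [:- e, 1:])"
    using eigenvalues_factorization(1)[of \<phi>] unfolding es[symmetric] B_def A_def
    by (simp add: prod_mset_prod_list flip: mset_map)
  have sorted: "v (es ! s) \<le> v (es ! r)" if "r \<le> s" "s < CARD('n)" for r s
    using sorted_nth_mono[OF sorted_sort_key[of "\<lambda>x. - v x" xs], of r s] that len
    by (simp add: es_def)
  define R where "R = (\<Prod>s<CARD('n). max 1 (v (es ! s)))"
  have R: "1 \<le> R" unfolding R_def by (intro prod_ge_1) simp
  define D where "D a = Qp_abs (det (orbit_matrix \<phi> a))" for a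
  have D: "v (det (orbit_matrix ((*v) B) a)) = D a" for a
    unfolding D_def B_def \<phi> by (simp add: orbit_matrix_to_ac v)
  obtain c1 where c1: "0 < c1" "\<And>n. 1 \<le> n \<Longrightarrow> \<exists>a. (\<forall>l. fst (a l) < n) \<and> c1 * R ^ n \<le> D a"
    using L.det_orbit_matrix_lower[OF BK esK len char] unfolding D R_def[symmetric] by blast
  obtain c2 d2 where c2: "0 \<le> c2" "\<And>n a. (\<forall>l. fst (a l) < n) \<Longrightarrow> D a \<le> c2 * real n ^ d2 * R ^ n"
    using L.det_orbit_matrix_upper[OF BK esK len char sorted] unfolding D R_def[symmetric] by blast
  have "entropy_wrt M \<phi> C = ereal (ln R)" if C: "C \<in> compact_nhds" for C
  proof -
    have C': "compact C" "0 \<in> interior C" using C by (auto simp: compact_nhds_def)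
    obtain c3 where c3: "0 < c3" "\<And>n a. (\<forall>l. fst (a l) < n) \<Longrightarrow> c3 * D a \<le> measure M (trajectory n \<phi> C)"
      using measure_trajectory_lower[OF C', of A] unfolding D_def \<phi> by blast
    obtain c4 d4 where c4: "0 \<le> c4" "\<And>n. 1 \<le> n \<Longrightarrow> \<exists>a. (\<forall>l. fst (a l) < n) \<and>
        measure M (trajectory n \<phi> C) \<le> c4 * real n ^ d4 * D a"
      using measure_trajectory_upper[OF C'(1), of A] unfolding D_def \<phi> by blast
    have "(\<lambda>n. ln (measure M (trajectory n \<phi> C)) / real n) \<longlonglongrightarrow> ln R"
    proof (rule exponential_growth_rate)
      show "0 < c3 * c1" using c1 c3 by simp
      fix n :: nat assume n: "1 \<le> n"
      obtain a where a: "\<forall>l. fst (a l) < n" "c1 * R ^ n \<le> D a" using c1(2)[OF n] by blast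
      have "c3 * c1 * R ^ n \<le> c3 * D a" using a(2) c3(1) by (simp add: mult.assoc)
      also have "\<dots> \<le> measure M (trajectory n \<phi> C)" by (rule c3(2)[OF a(1)])
      finally show "c3 * c1 * R ^ n \<le> measure M (trajectory n \<phi> C)" .
      obtain b where b: "\<forall>l. fst (b l) < n" "measure M (trajectory n \<phi> C) \<le> c4 * real n ^ d4 * D b"
        using c4(2)[OF n] by blast
      note b(2)
      also have "c4 * real n ^ d4 * D b \<le> c4 * real n ^ d4 * (c2 * real n ^ d2 * R ^ n)"
        using c2(2)[OF b(1)] c4(1) by (intro mult_left_mono) auto
      also have "\<dots> = c4 * c2 * real n ^ (d4 + d2) * R ^ n" by (simp add: power_add mult_ac)
      finally show "measure M (trajectory n \<phi> C) \<le> c4 * c2 * real n ^ (d4 + d2) * R ^ n" .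
    qed (rule R)
    then have "(\<lambda>n. ereal (ln (measure M (trajectory n \<phi> C)) / real n)) \<longlonglongrightarrow> ereal (ln R)"
      by (intro tendsto_intros)
    then show ?thesis unfolding entropy_wrt_def by (intro lim_imp_Limsup) simp_all
  qed
  then have "algebraic_entropy M \<phi> = (SUP C \<in> compact_nhds :: ('k^'n) set set. ereal (ln R))"
    unfolding algebraic_entropy_def by (rule SUP_cong[OF refl])
  also have "cube 1 \<in> (compact_nhds :: ('k^'n) set set)"
    by (simp add: compact_nhds_def compact_cube cube_neighbourhood)
  then have "(SUP C \<in> compact_nhds :: ('k^'n) set set. ereal (ln R)) = ereal (ln R)"
    by (intro SUP_const) auto
  also have "ln R = (\<Sum>x\<in>#{#x \<in># eigenvalues \<phi>. v x > 1#}. ln (v x))"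
    unfolding R_def len[symmetric] es[symmetric] by (rule ln_prod_max_eq_sum_mset)
  finally show "algebraic_entropy M \<phi> = ereal (\<Sum>x\<in>#{#x \<in># eigenvalues \<phi>. v x > 1#}. ln (v x))" .
qed

end
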